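(* Let $n\geq3$ and let $S_n$ act on $V=\mathbb{C}^n$ by the natural permutation representation. The Drinfeld orbifold algebra maps $\kappa$ for this action that are supported only off the identity are precisely the maps of the form $\kappa=\kappa^L_{\mathrm{tri}}+\kappa^C_{\mathrm{penta}}+\kappa^C_{\mathrm{tri}}$ for parameters $a,b,c\in\mathbb{C}$, where $\kappa^L_{\mathrm{tri}}$, $\kappa^C_{\mathrm{tri}}$, $\kappa^C_{\mathrm{penta}}$ are defined below (with $\kappa^L_{\mathrm{tri}}$ and $\kappa^C_{\mathrm{penta}}$ using the same $a,b$).
   Context: $S_n$ acts by $\sigma e_i=e_{\sigma(i)}$; $V^g$ is the fixed space of $g$. Cochains: a linear (resp. constant) $2$-cochain is $\alpha=\sum_{g}\alpha_g g$, $\alpha_g:\bigwedge^2V\to V$ (resp. $\to\mathbb{C}$); it is $G$-invariant if $h(\alpha_g(v,w))=\alpha_{hgh^{-1}}(hv,hw)$; support of $\kappa=\kappa^L+\kappa^C$ is $\{g:\kappa^L_g+\kappa^C_g\neq0\}$. With $\mathrm{Alt}_3$ the cyclic permutations of $\{1,2,3\}$, $\kappa=\kappa^L+\kappa^C$ is a Drinfeld orbifold algebra map if for all $g$, $v_1,v_2,v_3$: (0) $\operatorname{im}\kappa^L_g\subseteq V^g$; (1) $\kappa^L,\kappa^C$ are $S_n$-invariant; (2) $\sum_{\sigma\in\mathrm{Alt}_3}\kappa^L_g(v_{\sigma(2)},v_{\sigma(3)})(gv_{\sigma(1)}-v_{\sigma(1)})=0$ in $S(V)$; (3) $\sum_{\sigma}\sum_{xy=g}\kappa^L_x(v_{\sigma(1)}+yv_{\sigma(1)},\kappa^L_y(v_{\sigma(2)},v_{\sigma(3)}))=2\sum_{\sigma}\kappa^C_g(v_{\sigma(2)},v_{\sigma(3)})(gv_{\sigma(1)}-v_{\sigma(1)})$;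 (4) $\sum_\sigma\sum_{xy=g}\kappa^C_x(v_{\sigma(1)}+yv_{\sigma(1)},\kappa^L_y(v_{\sigma(2)},v_{\sigma(3)}))=0$. Definitions: $\kappa^L_{\mathrm{tri}}$ is the linear 2-cochain supported on 3-cycles with, for each 3-cycle $(ijk)$, $\kappa^L_{(ijk)}(e_i,e_j)=\kappa^L_{(ijk)}(e_j,e_k)=\kappa^L_{(ijk)}(e_k,e_i)=a(e_i+e_j+e_k)+b\sum_{l\notin\{i,j,k\}}e_l$ and $\kappa^L_{(ijk)}(e_l,e_m)=0$ whenever $e_l\in V^{(ijk)}$ or $e_m\in V^{(ijk)}$. $\kappa^C_{\mathrm{tri}}$ is the constant 2-cochain supported on 3-cycles with $\kappa^C_{(ijk)}(e_i,e_j)=\kappa^C_{(ijk)}(e_j,e_k)=\kappa^C_{(ijk)}(e_k,e_i)=c$ and $\kappa^C_{(ijk)}(e_l,e_m)=0$ whenever $e_l$ or $e_m$ lies in $V^{(ijk)}$. $\kappa^C_{\mathrm{penta}}$ is the constant 2-cochain with $\kappa^C_g=0$ unless $g$ is a 5-cycle, and for a 5-cycle $g$, $\kappa^C_g(e_i,e_j)=(a-b)^2\big([g]_{ij}-[g]_{ji}-2[g^2]_{ij}+2[g^2]_{ji}\big)$, where $[h]$ is the permutation matrix of $h$ in the basis $e_1,\dots,e_n$ ($[h]_{ij}=1$ iff $i=h(j)$, else $0$). (For $n\le4$, $\kappa^C_{\mathrm{penta}}=0$.) *)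

theory Defs
  imports "HOL-Analysis.Analysis"
begin

text \<open>Setting: the index set of the basis e_i of V = C^n is a finite type 'n
  (n = CARD('n)); V is complex^'n; S_n is the set of permutations of UNIV::'n set;
  the group product xy is composition x o y.\<close>

definition perm_act :: "('n::finite \<Rightarrow> 'n) \<Rightarrow> complex^'n \<Rightarrow> complex^'n" where
  "perm_act g v = (\<chi> j. v $ (inv g j))"
  \<comment> \<open>so that perm_act g (axis i 1) = axis (g i) 1\<close>

definition bilin_vec :: "(complex^'n \<Rightarrow> complex^'n \<Rightarrow> complex^'n) \<Rightarrow> bool" where
  "bilin_vec f \<longleftrightarrow>
     (\<forall>u v w. f (u + v) w = f u w + f v w \<and> f w (u + v) = f w u + f w v) \<and>
     (\<forall>c u w. f (c *s u) w = c *s f u w \<and> f w (c *s u) = c *s f w u)"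

definition bilin_scal :: "(complex^'n \<Rightarrow> complex^'n \<Rightarrow> complex) \<Rightarrow> bool" where
  "bilin_scal f \<longleftrightarrow>
     (\<forall>u v w. f (u + v) w = f u w + f v w \<and> f w (u + v) = f w u + f w v) \<and>
     (\<forall>c u w. f (c *s u) w = c * f u w \<and> f w (c *s u) = c * f w u)"

text \<open>Linear 2-cochain: each component is a complex-linear map from the exterior square to V,
  i.e. an alternating complex-bilinear map.\<close>
definition linear_cochain ::
  "(('n::finite \<Rightarrow> 'n) \<Rightarrow> complex^'n \<Rightarrow> complex^'n \<Rightarrow> complex^'n) \<Rightarrow> bool" where
  "linear_cochain \<alpha> \<longleftrightarrow>
     (\<forall>g. g permutes (UNIV::'n set) \<longrightarrow> bilin_vec (\<alpha> g) \<and> (\<forall>v. \<alpha> g v v = 0))"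

definition const_cochain ::
  "(('n::finite \<Rightarrow> 'n) \<Rightarrow> complex^'n \<Rightarrow> complex^'n \<Rightarrow> complex) \<Rightarrow> bool" where
  "const_cochain \<alpha> \<longleftrightarrow>
     (\<forall>g. g permutes (UNIV::'n set) \<longrightarrow> bilin_scal (\<alpha> g) \<and> (\<forall>v. \<alpha> g v v = 0))"

text \<open>Product of two vectors of V in the symmetric algebra S(V), degree 2 part,
  represented faithfully (char 0) as the symmetric tensor u*w + w*u.\<close>
definition sym_prod :: "complex^'n \<Rightarrow> complex^'n \<Rightarrow> complex^'n^'n" where
  "sym_prod u w = (\<chi> i j. u $ i * w $ j + u $ j * w $ i)"

definition cyc_sum :: "('v \<Rightarrow> 'v \<Rightarrow> 'v \<Rightarrow> 'a::comm_monoid_add) \<Rightarrow> 'v \<Rightarrow> 'v \<Rightarrow> 'v \<Rightarrow> 'a" where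
  "cyc_sum F v1 v2 v3 = F v1 v2 v3 + F v2 v3 v1 + F v3 v1 v2"

definition fact_pairs :: "('n::finite \<Rightarrow> 'n) \<Rightarrow> (('n \<Rightarrow> 'n) \<times> ('n \<Rightarrow> 'n)) set" where
  "fact_pairs g = {(x, y). x permutes (UNIV::'n set) \<and> y permutes (UNIV::'n set) \<and> x \<circ> y = g}"

definition DOA_map ::
  "(('n::finite \<Rightarrow> 'n) \<Rightarrow> complex^'n \<Rightarrow> complex^'n \<Rightarrow> complex^'n) \<Rightarrow>
   (('n \<Rightarrow> 'n) \<Rightarrow> complex^'n \<Rightarrow> complex^'n \<Rightarrow> complex) \<Rightarrow> bool" where
  "DOA_map kL kC \<longleftrightarrow>
    \<comment> \<open>(0)\<close>
    (\<forall>g. g permutes (UNIV::'n set) \<longrightarrow> (\<forall>v w. perm_act g (kL g v w) = kL g v w)) \<and>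
    \<comment> \<open>(1)\<close>
    (\<forall>g h. g permutes (UNIV::'n set) \<longrightarrow> h permutes (UNIV::'n set) \<longrightarrow>
       (\<forall>v w. perm_act h (kL g v w) = kL (h \<circ> g \<circ> inv h) (perm_act h v) (perm_act h w))) \<and>
    (\<forall>g h. g permutes (UNIV::'n set) \<longrightarrow> h permutes (UNIV::'n set) \<longrightarrow>
       (\<forall>v w. kC g v w = kC (h \<circ> g \<circ> inv h) (perm_act h v) (perm_act h w))) \<and>
    \<comment> \<open>(2)\<close>
    (\<forall>g. g permutes (UNIV::'n set) \<longrightarrow> (\<forall>v1 v2 v3.
       cyc_sum (\<lambda>a b c. sym_prod (kL g b c) (perm_act g a - a)) v1 v2 v3 = 0)) \<and>
    \<comment> \<open>(3)\<close>
    (\<forall>g. g permutes (UNIV::'n set) \<longrightarrow> (\<forall>v1 v2 v3.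
       cyc_sum (\<lambda>a b c. \<Sum>(x, y)\<in>fact_pairs g. kL x (a + perm_act y a) (kL y b c)) v1 v2 v3 =
       2 *s cyc_sum (\<lambda>a b c. kC g b c *s (perm_act g a - a)) v1 v2 v3)) \<and>
    \<comment> \<open>(4)\<close>
    (\<forall>g. g permutes (UNIV::'n set) \<longrightarrow> (\<forall>v1 v2 v3.
       cyc_sum (\<lambda>a b c. \<Sum>(x, y)\<in>fact_pairs g. kC x (a + perm_act y a) (kL y b c)) v1 v2 v3 = 0))"

definition is_kcycle :: "nat \<Rightarrow> ('n \<Rightarrow> 'n) \<Rightarrow> bool" where
  "is_kcycle k g \<longleftrightarrow> g permutes (UNIV::'n set) \<and>
     (\<exists>xs. length xs = k \<and> distinct xs \<and> (\<forall>i<k. g (xs ! i) = xs ! ((i + 1) mod k)) \<and>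
           (\<forall>l. l \<notin> set xs \<longrightarrow> g l = l))"

definition perm_mat :: "('n \<Rightarrow> 'n) \<Rightarrow> 'n \<Rightarrow> 'n \<Rightarrow> complex" where
  "perm_mat h i j = (if i = h j then 1 else 0)"

definition triL_basis :: "complex \<Rightarrow> complex \<Rightarrow> ('n::finite \<Rightarrow> 'n) \<Rightarrow> 'n \<Rightarrow> 'n \<Rightarrow> complex^'n" where
  "triL_basis a b g p q =
     (let M = {l. g l \<noteq> l}; X = (\<chi> l. if l \<in> M then a else b) in
      if p \<in> M \<and> q \<in> M \<and> q = g p then X
      else if p \<in> M \<and> q \<in> M \<and> p = g q then - X else 0)"

definition triC_basis :: "complex \<Rightarrow> ('n::finite \<Rightarrow> 'n) \<Rightarrow> 'n \<Rightarrow> 'n \<Rightarrow> complex" where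
  "triC_basis c g p q =
     (let M = {l. g l \<noteq> l} in
      if p \<in> M \<and> q \<in> M \<and> q = g p then c
      else if p \<in> M \<and> q \<in> M \<and> p = g q then - c else 0)"

definition kappaL_tri :: "complex \<Rightarrow> complex \<Rightarrow> ('n::finite \<Rightarrow> 'n) \<Rightarrow> complex^'n \<Rightarrow> complex^'n \<Rightarrow> complex^'n" where
  "kappaL_tri a b g v w =
     (if is_kcycle 3 g then (\<Sum>p\<in>UNIV. \<Sum>q\<in>UNIV. (v $ p * w $ q) *s triL_basis a b g p q) else 0)"

definition kappaC_tri :: "complex \<Rightarrow> ('n::finite \<Rightarrow> 'n) \<Rightarrow> complex^'n \<Rightarrow> complex^'n \<Rightarrow> complex" where
  "kappaC_tri c g v w =
     (if is_kcycle 3 g then (\<Sum>p\<in>UNIV. \<Sum>q\<in>UNIV. v $ p * w $ q * triC_basis c g p q) else 0)"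

definition kappaC_penta :: "complex \<Rightarrow> complex \<Rightarrow> ('n::finite \<Rightarrow> 'n) \<Rightarrow> complex^'n \<Rightarrow> complex^'n \<Rightarrow> complex" where
  "kappaC_penta a b g v w =
     (if is_kcycle 5 g then
        (\<Sum>p\<in>UNIV. \<Sum>q\<in>UNIV. v $ p * w $ q * ((a - b)^2 *
           (perm_mat g p q - perm_mat g q p - 2 * perm_mat (g \<circ> g) p q + 2 * perm_mat (g \<circ> g) q p)))
      else 0)"

end

theory Submission
  imports Defs
begin

text \<open>
  A 3-cycle \<open>y\<close> carries the 2-form \<open>\<omega>\<^sub>y\<close> with \<open>\<omega>\<^sub>y(e\<^sub>p, e\<^sub>q) = [q = y p] - [p = y q]\<close>, and
  \<open>\<kappa>\<^sup>L\<^sub>y = \<omega>\<^sub>y \<cdot> (b \<Sum>\<^sub>l e\<^sub>l + (a - b) 1\<^sub>M)\<close> where \<open>M\<close> is the set of points moved by \<open>y\<close>. Condition (2) for \<open>\<omega>\<^sub>y\<close>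
  allows \<open>v + y v\<close> to be replaced by \<open>2 v\<close> in (3) and (4), and the invariant part of \<open>\<kappa>\<^sup>L\<close> contracts to zero.
  What remains are sums over triples \<open>(x, y, z)\<close> with \<open>x \<circ> y = g\<close> and \<open>z\<close> moved by both \<open>x\<close> and \<open>y\<close>,
  that is, over tuples \<open>(z, a\<^sub>1, \<dots>; b\<^sub>1, b\<^sub>2)\<close> with \<open>x = (z a\<^sub>1 \<dots>)\<close> and \<open>y = (z b\<^sub>1 b\<^sub>2)\<close>. Splitting by the coincidences between
  the \<open>a\<^sub>i\<close> and the \<open>b\<^sub>j\<close> fixes the cycle type of \<open>g\<close>, and everything cancels by relabelling, except for
  5-cycles \<open>g\<close> in (3), which produce the coboundary of the 5-cycle form.

  Conversely, let \<open>B\<close> be an alternating form with \<open>\<Sum> B(v\<^sub>2, v\<^sub>3) (g v\<^sub>1 - v\<^sub>1) = 0\<close>, the sum running over cyclic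
  permutations. If \<open>B(e\<^sub>q, e\<^sub>r) \<noteq> 0\<close> then \<open>g\<close> moves only points of \<open>{q, r, g q, g r}\<close>; together with invariance
  this forces \<open>g\<close> to be a 3-cycle and \<open>B\<close> to be a multiple of \<open>\<omega>\<^sub>g\<close>. This applies to the components of \<open>\<kappa>\<^sup>L\<^sub>g\<close>
  and, by the computation of (3), to the difference of \<open>\<kappa>\<^sup>C\<^sub>g\<close> and the 5-cycle form.
\<close>

section \<open>Cycles and sums over tuples of distinct points\<close>

text \<open>Explicit notation for a cycle. The encoding by \<open>map_of\<close> lets concrete
  cycles compute to the nested conditionals of \<open>cyc_simps\<close>, on which all later case
  distinctions rest.\<close>

definition cyc :: "'a list \<Rightarrow> 'a \<Rightarrow> 'a" where
  "cyc ts l = (case map_of (zip ts (rotate1 ts)) l of None \<Rightarrow> l | Some m \<Rightarrow> m)"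

lemma cyc_simps:
  "cyc [a, b] l = (if l = a then b else if l = b then a else l)"
  "cyc [a, b, c] l = (if l = a then b else if l = b then c else if l = c then a else l)"
  "cyc [a, b, c, d] l =
    (if l = a then b else if l = b then c else if l = c then d else if l = d then a else l)"
  "cyc [a, b, c, d, e] l =
    (if l = a then b else if l = b then c else if l = c then d else if l = d then e
     else if l = e then a else l)"
  "cyc [a, b, c, d, e, f, g] l =
    (if l = a then b else if l = b then c else if l = c then d else if l = d then e
     else if l = e then f else if l = f then g else if l = g then a else l)"
  by (simp_all add: cyc_def)

lemma cyc_nth:
  assumes "distinct ts" "i < length ts"
  shows "cyc ts (ts ! i) = ts ! (Suc i mod length ts)"
  using map_of_zip_nth[of ts "rotate1 ts" i] assms by (simp add: cyc_def nth_rotate1)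

lemma cyc_notin: "l \<notin> set ts \<Longrightarrow> cyc ts l = l"
  by (auto simp: cyc_def map_of_zip_is_None split: option.split dest: map_of_SomeD set_zip_leftD)

lemma cyc_permutes:
  assumes "distinct (ts :: 'a::finite list)"
  shows "cyc ts permutes UNIV"
proof -
  have "set ts \<subseteq> cyc ts ` set ts"
  proof
    fix l assume "l \<in> set ts"
    then obtain i where i: "i < length ts" "l = ts ! i" by (auto simp: in_set_conv_nth)
    \<comment> \<open>Position of the cyclic predecessor of \<open>ts ! i\<close>; position 0 wraps
      around to the last one.\<close>
    define j where "j = (if i = 0 then length ts - 1 else i - 1)"
    have "j < length ts" "Suc j mod length ts = i" using i by (auto simp: j_def)
    then show "l \<in> cyc ts ` set ts" using cyc_nth[OF assms] i by (metis image_eqI nth_mem)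
  qed
  then have sub: "l \<in> range (cyc ts)" for l
    using cyc_notin[of l ts] by (cases "l \<in> set ts") (auto intro: range_eqI[of _ _ l])
  then have "surj (cyc ts)" by blast
  then have "bij (cyc ts)" by (simp add: bij_def finite_UNIV_surj_inj)
  then show ?thesis by (auto intro: bij_imp_permutes)
qed

lemma is_kcycle_iff:
  "is_kcycle k (g :: 'n::finite \<Rightarrow> 'n) \<longleftrightarrow> (\<exists>ts. length ts = k \<and> distinct ts \<and> g = cyc ts)"
proof
  assume "is_kcycle k g"
  then obtain xs where xs: "length xs = k" "distinct xs"
    "\<And>i. i < k \<Longrightarrow> g (xs ! i) = xs ! ((i + 1) mod k)" "\<And>l. l \<notin> set xs \<Longrightarrow> g l = l"
    unfolding is_kcycle_def by blast
  have "g l = cyc xs l" for l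
    by (cases "l \<in> set xs") (use xs cyc_nth[of xs] cyc_notin[of l xs] in \<open>auto simp: in_set_conv_nth\<close>)
  with xs show "\<exists>ts. length ts = k \<and> distinct ts \<and> g = cyc ts" by blast
next
  assume "\<exists>ts. length ts = k \<and> distinct ts \<and> g = cyc ts"
  then obtain ts where ts: "length ts = k" "distinct ts" "g = cyc ts" by blast
  then have "\<forall>i<k. g (ts ! i) = ts ! ((i + 1) mod k)" "\<forall>l. l \<notin> set ts \<longrightarrow> g l = l"
    using cyc_nth[of ts] cyc_notin[of _ ts] by auto
  then show "is_kcycle k g"
    unfolding is_kcycle_def using ts cyc_permutes by blast
qed

text \<open>Successors are read modulo the length, so only the cyclic order of the entries
  counts.\<close>

lemma cyc_rotate:
  assumes "distinct (ts :: 'n::finite list)"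
  shows "cyc (rotate m ts) = cyc ts"
proof
  fix l
  show "cyc (rotate m ts) l = cyc ts l"
  proof (cases "l \<in> set ts")
    case True
    then obtain i where i: "i < length ts" "l = rotate m ts ! i"
      by (metis in_set_conv_nth length_rotate set_rotate)
    have lt: "j mod length ts < length ts" for j
      using i by (intro mod_less_divisor) linarith
    have "cyc (rotate m ts) l = rotate m ts ! (Suc i mod length ts)"
      using cyc_nth[of "rotate m ts" i] i assms by simp
    also have "\<dots> = ts ! (Suc (m + i) mod length ts)"
      using lt by (simp add: nth_rotate mod_simps)
    also have "\<dots> = cyc ts (ts ! ((m + i) mod length ts))"
      using cyc_nth[OF assms lt[of "m + i"]] by (simp add: mod_Suc_eq)
    also have "\<dots> = cyc ts l"
      using i by (simp add: nth_rotate add.commute)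
    finally show ?thesis .
  qed (simp add: cyc_notin)
qed

section \<open>Tuples of distinct points and reindexing of sums over them\<close>

definition dlists :: "nat \<Rightarrow> 'n list set" where
  "dlists m = {ts. length ts = m \<and> distinct ts}"

lemma finite_dlists [simp]: "finite (dlists m :: 'n::finite list set)"
  unfolding dlists_def
  by (rule finite_subset[OF _ finite_lists_length_eq[of UNIV m]]) auto

text \<open>A permutation \<sigma> of the positions acts injectively on the finite set
  \<open>dlists m\<close>, hence bijectively.\<close>

lemma sum_dlists_relabel:
  assumes "distinct \<sigma>" "set \<sigma> = {..<m}"
  shows "(\<Sum>ts\<in>dlists m. F ts) = (\<Sum>ts\<in>dlists m. F (map ((!) (ts :: 'n::finite list)) \<sigma>))"
proof -
  have len: "length \<sigma> = m" using assms distinct_card[of \<sigma>] by simp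
  let ?f = "\<lambda>ts :: 'n list. map ((!) ts) \<sigma>"
  have "inj_on ((!) ts) (set \<sigma>)" if "ts \<in> dlists m" for ts :: "'n list"
    by (rule inj_on_nth) (use that assms(2) in \<open>simp_all add: dlists_def\<close>)
  then have sub: "?f ` dlists m \<subseteq> dlists m"
    using assms(1) len by (simp add: dlists_def distinct_map image_subset_iff)
  have inj: "inj_on ?f (dlists m)"
  proof (rule inj_onI)
    fix s t :: "'n list" assume st: "s \<in> dlists m" "t \<in> dlists m" "?f s = ?f t"
    then have "s ! i = t ! i" if "i < m" for i using assms(2) that by simp
    then show "s = t" using st by (simp add: dlists_def list_eq_iff_nth_eq)
  qed
  have "bij_betw ?f (dlists m) (dlists m)"
    using sub inj by (simp add: bij_betw_def endo_inj_surj)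
  then show ?thesis by (rule sum.reindex_bij_betw[symmetric])
qed

lemma sum_dlists_Suc:
  "(\<Sum>ts\<in>dlists (Suc m). F ts) = (\<Sum>ts\<in>dlists m. \<Sum>b\<in>- set ts. F (ts @ [b :: 'n::finite]))"
proof -
  have "(\<Sum>ts\<in>dlists m. \<Sum>b\<in>- set ts. F (ts @ [b])) =
      (\<Sum>(ts, b)\<in>Sigma (dlists m) (\<lambda>ts. - set ts). F (ts @ [b]))"
    by (simp add: sum.Sigma)
  also have "\<dots> = (\<Sum>ts\<in>dlists (Suc m). F ts)"
  proof (rule sum.reindex_bij_witness[of _ "\<lambda>ts. (butlast ts, last ts)" "\<lambda>(ts, b). ts @ [b]"])
    fix ts :: "'n list" assume "ts \<in> dlists (Suc m)"
    then show "(\<lambda>(ts, b). ts @ [b]) (butlast ts, last ts) = ts"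
      "(butlast ts, last ts) \<in> Sigma (dlists m) (\<lambda>ts. - set ts)"
      by (cases ts rule: rev_cases; auto simp: dlists_def)+
  qed (auto simp: dlists_def)
  finally show ?thesis by simp
qed

lemma cyc_funpow_hd:
  assumes "distinct ts" "i < length ts"
  shows "(cyc ts ^^ i) (ts ! 0) = ts ! i"
  using assms(2) by (induction i) (auto simp: cyc_nth[OF assms(1)])

text \<open>A k-cycle with a chosen moved point is the same as a tuple: the cycle written out from
  that point, recovered by iterating the cycle. The bound on \<open>k\<close> makes the first entry
  a moved point.\<close>

lemma sum_kcycles:
  assumes "k \<ge> 2"
  shows "(\<Sum>x | is_kcycle k x. \<Sum>z | x z \<noteq> z. G x z) =
    (\<Sum>ts\<in>dlists k. G (cyc ts) (ts ! 0 :: 'n::finite))"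
proof -
  have "(\<Sum>x | is_kcycle k x. \<Sum>z | x z \<noteq> z. G x z) =
      (\<Sum>(x, z)\<in>Sigma {x. is_kcycle k x} (\<lambda>x. {z. x z \<noteq> z}). G x z)"
    by (simp add: sum.Sigma)
  also have "\<dots> = (\<Sum>ts\<in>dlists k. G (cyc ts) (ts ! 0))"
  proof (rule sum.reindex_bij_witness[of _ "\<lambda>ts. (cyc ts, ts ! 0)"
        "\<lambda>(x, z). map (\<lambda>i. (x ^^ i) z) [0..<k]"])
    fix ts :: "'n list" assume ts: "ts \<in> dlists k"
    then have "cyc ts (ts ! 0) \<noteq> ts ! 0"
      using assms cyc_nth[of ts 0] by (auto simp: dlists_def nth_eq_iff_index_eq)
    with ts show "(cyc ts, ts ! 0) \<in> Sigma {x. is_kcycle k x} (\<lambda>x. {z. x z \<noteq> z})"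
      by (auto simp: dlists_def is_kcycle_iff)
    show "(\<lambda>(x, z). map (\<lambda>i. (x ^^ i) z) [0..<k]) (cyc ts, ts ! 0) = ts"
      using ts by (auto simp: dlists_def cyc_funpow_hd list_eq_iff_nth_eq)
  next
    fix p :: "('n \<Rightarrow> 'n) \<times> 'n" assume "p \<in> Sigma {x. is_kcycle k x} (\<lambda>x. {z. x z \<noteq> z})"
    then obtain x z where p: "p = (x, z)" "is_kcycle k x" "x z \<noteq> z" by auto
    then obtain xs where xs: "length xs = k" "distinct xs" "x = cyc xs" by (auto simp: is_kcycle_iff)
    then have "z \<in> set xs" using p cyc_notin[of z xs] by auto
    then obtain j where j: "j < k" "z = xs ! j" using xs by (auto simp: in_set_conv_nth)
    define ts where "ts = rotate j xs"
    have ts: "ts \<in> dlists k" "cyc ts = x" "ts ! 0 = z"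
      using xs j by (auto simp: ts_def dlists_def cyc_rotate nth_rotate)
    have eq: "map (\<lambda>i. (x ^^ i) z) [0..<k] = ts"
      using ts by (auto simp: dlists_def cyc_funpow_hd list_eq_iff_nth_eq)
    show "(\<lambda>ts. (cyc ts, ts ! 0)) ((\<lambda>(x, z). map (\<lambda>i. (x ^^ i) z) [0..<k]) p) = p"
      "(\<lambda>(x, z). map (\<lambda>i. (x ^^ i) z) [0..<k]) p \<in> dlists k"
      "(\<lambda>ts. G (cyc ts) (ts ! 0)) ((\<lambda>(x, z). map (\<lambda>i. (x ^^ i) z) [0..<k]) p) =
        (case p of (x, z) \<Rightarrow> G x z)"
      using eq ts p by simp_all
  qed
  finally show ?thesis .
qed

text \<open>A 3-cycle \<open>y\<close> moving \<open>z\<close> is written as (z b c) in exactly one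
  way, with b = y z and c = y (y z).\<close>

lemma sum_3cycles_at:
  "(\<Sum>y | is_kcycle 3 y \<and> y z \<noteq> z. G y) =
    (\<Sum>b\<in>- {z}. \<Sum>c\<in>- {z, b}. G (cyc [z, b, c :: 'n::finite]))"
proof -
  have "(\<Sum>b\<in>- {z}. \<Sum>c\<in>- {z, b}. G (cyc [z, b, c])) =
      (\<Sum>(b, c)\<in>Sigma (- {z}) (\<lambda>b. - {z, b}). G (cyc [z, b, c]))"
    by (simp add: sum.Sigma)
  also have "\<dots> = (\<Sum>y | is_kcycle 3 y \<and> y z \<noteq> z. G y)"
  proof (rule sum.reindex_bij_witness[of _ "\<lambda>y. (y z, y (y z))" "\<lambda>(b, c). cyc [z, b, c]"])
    fix y :: "'n \<Rightarrow> 'n" assume "y \<in> {y. is_kcycle 3 y \<and> y z \<noteq> z}"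
    then obtain ts where ts: "length ts = 3" "distinct ts" "y = cyc ts" "y z \<noteq> z"
      by (auto simp: is_kcycle_iff)
    then obtain a b c where abc: "ts = [a, b, c]" by (auto simp: numeral_3_eq_3 length_Suc_conv)
    with ts have "z = a \<or> z = b \<or> z = c" by (auto simp: cyc_simps split: if_splits)
    then show "(\<lambda>(b, c). cyc [z, b, c]) (y z, y (y z)) = y"
      "(y z, y (y z)) \<in> Sigma (- {z}) (\<lambda>b. - {z, b})"
      using ts abc by (auto simp: cyc_simps fun_eq_iff)
  next
    fix p :: "'n \<times> 'n" assume "p \<in> Sigma (- {z}) (\<lambda>b. - {z, b})"
    then obtain b c where bc: "p = (b, c)" "b \<noteq> z" "c \<noteq> z" "c \<noteq> b" by auto
    then show "(\<lambda>y. (y z, y (y z))) ((\<lambda>(b, c). cyc [z, b, c]) p) = p"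
      by (auto simp: cyc_simps)
    have "is_kcycle 3 (cyc [z, b, c])"
      using bc by (auto simp: is_kcycle_iff intro!: exI[of _ "[z, b, c]"])
    then show "(\<lambda>(b, c). cyc [z, b, c]) p \<in> {y. is_kcycle 3 y \<and> y z \<noteq> z}"
      using bc by (auto simp: cyc_simps)
  qed auto
  finally show ?thesis by simp
qed

section \<open>Alternating sums over factorizations\<close>

text \<open>Distinctness is supplied for the tuple and for its reverse, so that the simplifier has
  every inequality in both orientations.\<close>

lemma dlists_cases:
  "ts \<in> dlists 3 \<Longrightarrow> (\<And>a b c. distinct [a, b, c] \<Longrightarrow> distinct [c, b, a] \<Longrightarrow>
    P [a, b, c]) \<Longrightarrow> P ts"
  "ts \<in> dlists 4 \<Longrightarrow> (\<And>a b c d. distinct [a, b, c, d] \<Longrightarrow> distinct [d, c, b, a] \<Longrightarrow>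
    P [a, b, c, d]) \<Longrightarrow> P ts"
  "ts \<in> dlists 5 \<Longrightarrow> (\<And>a b c d e. distinct [a, b, c, d, e] \<Longrightarrow> distinct [e, d, c, b, a] \<Longrightarrow>
    P [a, b, c, d, e]) \<Longrightarrow> P ts"
  "ts \<in> dlists 6 \<Longrightarrow> (\<And>a b c d e f. distinct [a, b, c, d, e, f] \<Longrightarrow> distinct [f, e, d, c, b, a] \<Longrightarrow>
    P [a, b, c, d, e, f]) \<Longrightarrow> P ts"
  "ts \<in> dlists 7 \<Longrightarrow> (\<And>a b c d e f g. distinct [a, b, c, d, e, f, g] \<Longrightarrow> distinct [g, f, e, d, c, b, a] \<Longrightarrow>
    P [a, b, c, d, e, f, g]) \<Longrightarrow> P ts"
  using distinct_rev[of ts]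
  by (auto simp: dlists_def numeral_eq_Suc length_Suc_conv)

definition alternating3 :: "('n \<Rightarrow> 'n \<Rightarrow> 'n \<Rightarrow> complex) \<Rightarrow> bool" where
  "alternating3 \<delta> \<longleftrightarrow> (\<forall>i j k. \<delta> i j k = - \<delta> j i k \<and> \<delta> i j k = \<delta> j k i)"

lemma alternating3D:
  assumes "alternating3 \<delta>"
  shows "\<delta> i j k = - \<delta> j i k" "\<delta> i j k = - \<delta> i k j"
    "\<delta> i i k = 0" "\<delta> i k k = 0" "\<delta> i k i = 0"
proof -
  have alt: "\<delta> a b c = - \<delta> b a c" "\<delta> a b c = \<delta> b c a" for a b c
    using assms unfolding alternating3_def by blast+
  have z: "\<delta> a a c = 0" for a c using alt(1)[of a a c] by simp
  show "\<delta> i j k = - \<delta> j i k" by (rule alt)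
  show "\<delta> i j k = - \<delta> i k j" by (metis alt)
  show "\<delta> i i k = 0" "\<delta> i k k = 0" "\<delta> i k i = 0"
    using alt(2)[of i k k] alt(2)[of i i k] z by auto
qed

text \<open>\<open>C\<close> assigns a permutation to a tuple of distinct points; only the tuples mapped to \<open>g\<close> count.\<close>
definition class_sum ::
  "nat \<Rightarrow> ('n list \<Rightarrow> 'n \<Rightarrow> 'n) \<Rightarrow> ('n \<Rightarrow> 'n) \<Rightarrow> ('n list \<Rightarrow> complex) \<Rightarrow> complex" where
  "class_sum m C g \<phi> = (\<Sum>ts\<in>dlists m. of_bool (C ts = g) * \<phi> ts)"

lemma class_sum_cong:
  "(\<And>ts. ts \<in> dlists m \<Longrightarrow> C ts = C' ts) \<Longrightarrow> (\<And>ts. ts \<in> dlists m \<Longrightarrow> \<phi> ts = \<phi>' ts) \<Longrightarrow>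
    class_sum m C g \<phi> = class_sum m C' g \<phi>'"
  by (simp add: class_sum_def)

lemma class_sum_linear:
  "class_sum m C g (\<lambda>ts. \<phi> ts + \<psi> ts) = class_sum m C g \<phi> + class_sum m C g \<psi>"
  "class_sum m C g (\<lambda>ts. \<phi> ts - \<psi> ts) = class_sum m C g \<phi> - class_sum m C g \<psi>"
  "class_sum m C g (\<lambda>ts. - \<phi> ts) = - class_sum m C g \<phi>"
  "class_sum m C g (\<lambda>ts. a * \<phi> ts) = a * class_sum m C g \<phi>"
  by (simp_all add: class_sum_def algebra_simps sum.distrib sum_subtractf sum_negf sum_distrib_left)

lemma class_sum_relabel:
  fixes C :: "'n::finite list \<Rightarrow> 'n \<Rightarrow> 'n"
  assumes "distinct \<sigma>" "set \<sigma> = {..<m}"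
    and "\<And>ts. ts \<in> dlists m \<Longrightarrow> C' (map ((!) ts) \<sigma>) = C ts"
  shows "class_sum m C' g \<phi> = class_sum m C g (\<lambda>ts. \<phi> (map ((!) ts) \<sigma>))"
  unfolding class_sum_def
  by (subst sum_dlists_relabel[OF assms(1,2)]) (simp add: assms(3))

text \<open>A relabelling that leaves \<open>C\<close> unchanged is a symmetry of the class sum. It
  moves the positions at which \<delta> is evaluated, so class sums agree along orbits of position
  triples.\<close>

lemma class_sum_relabel_nth:
  fixes C :: "'n::finite list \<Rightarrow> 'n \<Rightarrow> 'n"
  assumes "distinct \<sigma>" "set \<sigma> = {..<m}"
    and "\<And>ts. ts \<in> dlists m \<Longrightarrow> C (map ((!) ts) \<sigma>) = C ts" "i < m" "j < m" "k < m"
  shows "class_sum m C g (\<lambda>ts. \<delta> (ts ! i) (ts ! j) (ts ! k)) =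
    class_sum m C g (\<lambda>ts. \<delta> (ts ! (\<sigma> ! i)) (ts ! (\<sigma> ! j)) (ts ! (\<sigma> ! k)))"
proof -
  have "length \<sigma> = m" using assms(1,2) distinct_card[of \<sigma>] by simp
  then show ?thesis
    using assms class_sum_relabel[of \<sigma> m C C g "\<lambda>ts. \<delta> (ts ! i) (ts ! j) (ts ! k)"] by simp
qed

text \<open>Conditional on the order of the positions, these equations form a terminating rewrite
  system: triples of positions become increasing and repeated positions give 0.\<close>

lemma class_sum_sort:
  assumes "alternating3 \<delta>"
  shows "j < i \<Longrightarrow> class_sum m C g (\<lambda>ts. \<delta> (ts ! i) (ts ! j) (ts ! k)) =
      - class_sum m C g (\<lambda>ts. \<delta> (ts ! j) (ts ! i) (ts ! k))"
    and "k < j \<Longrightarrow> class_sum m C g (\<lambda>ts. \<delta> (ts ! i) (ts ! j) (ts ! k)) =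
      - class_sum m C g (\<lambda>ts. \<delta> (ts ! i) (ts ! k) (ts ! j))"
    and "class_sum m C g (\<lambda>ts. \<delta> (ts ! i) (ts ! i) (ts ! k)) = 0"
    and "class_sum m C g (\<lambda>ts. \<delta> (ts ! i) (ts ! k) (ts ! k)) = 0"
    and "class_sum m C g (\<lambda>ts. \<delta> (ts ! i) (ts ! k) (ts ! i)) = 0"
proof -
  note alt = alternating3D[OF assms]
  show "class_sum m C g (\<lambda>ts. \<delta> (ts ! i) (ts ! j) (ts ! k)) =
      - class_sum m C g (\<lambda>ts. \<delta> (ts ! j) (ts ! i) (ts ! k))"
    unfolding class_sum_linear(3)[symmetric] by (intro class_sum_cong refl alt)
  show "class_sum m C g (\<lambda>ts. \<delta> (ts ! i) (ts ! j) (ts ! k)) =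
      - class_sum m C g (\<lambda>ts. \<delta> (ts ! i) (ts ! k) (ts ! j))"
    unfolding class_sum_linear(3)[symmetric] by (intro class_sum_cong refl alt)
qed (simp_all add: class_sum_def alternating3D(3-5)[OF assms])

text \<open>For \<open>x = (z a1 a2 a3 a4)\<close> and \<open>y = (z b1 b2)\<close> this is the wedge of the 2-form of \<open>y\<close> with the
  contraction of the 2-form of \<open>x\<close> by the basis vector of \<open>z\<close>, with \<open>\<delta> i j k\<close> standing for
  \<open>e\<^sub>i \<and> e\<^sub>j \<and> e\<^sub>k\<close>.\<close>
definition penta_tri_term ::
  "('a \<Rightarrow> 'a \<Rightarrow> 'a \<Rightarrow> complex) \<Rightarrow> 'a \<Rightarrow> 'a \<Rightarrow> 'a \<Rightarrow> 'a \<Rightarrow> 'a \<Rightarrow> 'a \<Rightarrow> 'a \<Rightarrow> complex" where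
  "penta_tri_term \<delta> z a1 a2 a3 a4 b1 b2 =
    (\<delta> z b1 a1 + \<delta> b1 b2 a1 + \<delta> b2 z a1) - (\<delta> z b1 a4 + \<delta> b1 b2 a4 + \<delta> b2 z a4)
    + 2 * (\<delta> z b1 a3 + \<delta> b1 b2 a3 + \<delta> b2 z a3) - 2 * (\<delta> z b1 a2 + \<delta> b1 b2 a2 + \<delta> b2 z a2)"

text \<open>The numerical arguments are positions in the tuple; a repeated position encodes a point
  common to the 5-cycle and the 3-cycle.\<close>
definition pattern_sum ::
  "nat \<Rightarrow> ('n \<Rightarrow> 'n) \<Rightarrow> ('n \<Rightarrow> 'n \<Rightarrow> 'n \<Rightarrow> complex) \<Rightarrow>
    nat \<Rightarrow> nat \<Rightarrow> nat \<Rightarrow> nat \<Rightarrow> nat \<Rightarrow> nat \<Rightarrow> nat \<Rightarrow> complex" where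
  "pattern_sum m g \<delta> z a1 a2 a3 a4 b1 b2 = class_sum m
    (\<lambda>ts. cyc [ts ! z, ts ! a1, ts ! a2, ts ! a3, ts ! a4] \<circ> cyc [ts ! z, ts ! b1, ts ! b2]) g
    (\<lambda>ts. penta_tri_term \<delta> (ts ! z) (ts ! a1) (ts ! a2) (ts ! a3) (ts ! a4) (ts ! b1) (ts ! b2))"

text \<open>The relabelling brings \<open>x \<circ> y\<close> to a reference permutation
  \<open>C\<close>, and \<open>penta_tri_term\<close> is linear in \<delta>. Being polymorphic, it
  is reused here on positions, with class sums in the role of \<delta>.\<close>

lemma pattern_sum_relabel:
  fixes C :: "'n::finite list \<Rightarrow> 'n \<Rightarrow> 'n"
  assumes "distinct \<sigma>" "set \<sigma> = {..<m}"
    and "z < m" "a1 < m" "a2 < m" "a3 < m" "a4 < m" "b1 < m" "b2 < m"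
    and "\<And>ts. ts \<in> dlists m \<Longrightarrow>
      cyc [ts ! (\<sigma> ! z), ts ! (\<sigma> ! a1), ts ! (\<sigma> ! a2), ts ! (\<sigma> ! a3), ts ! (\<sigma> ! a4)] \<circ>
      cyc [ts ! (\<sigma> ! z), ts ! (\<sigma> ! b1), ts ! (\<sigma> ! b2)] = C ts"
  shows "pattern_sum m g \<delta> z a1 a2 a3 a4 b1 b2 =
    penta_tri_term (\<lambda>i j k. class_sum m C g (\<lambda>ts. \<delta> (ts ! i) (ts ! j) (ts ! k)))
      (\<sigma> ! z) (\<sigma> ! a1) (\<sigma> ! a2) (\<sigma> ! a3) (\<sigma> ! a4) (\<sigma> ! b1) (\<sigma> ! b2)"
proof -
  have "length \<sigma> = m" using assms(1,2) distinct_card[of \<sigma>] by simp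
  then show ?thesis
    unfolding pattern_sum_def
    by (subst class_sum_relabel[OF assms(1,2), where C = C])
      (use assms in \<open>simp_all add: penta_tri_term_def class_sum_linear\<close>)
qed

text \<open>A suffix \<open>\<lambda>\<close> collects the patterns in which \<open>x \<circ> y\<close> has cycle type \<open>\<lambda>\<close> on the points involved.
  Relabelling tuples by the centralizer of \<open>x \<circ> y\<close> identifies the wedge terms up to sign.\<close>
lemma penta_tri_class_5:
  fixes \<delta> :: "'n::finite \<Rightarrow> 'n \<Rightarrow> 'n \<Rightarrow> complex"
  assumes "alternating3 \<delta>"
  shows "pattern_sum 5 g \<delta> 0 1 2 3 4 1 2 + pattern_sum 5 g \<delta> 0 1 2 3 4 1 3 +
    pattern_sum 5 g \<delta> 0 1 2 3 4 1 4 + pattern_sum 5 g \<delta> 0 1 2 3 4 2 3 +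
    pattern_sum 5 g \<delta> 0 1 2 3 4 2 4 + pattern_sum 5 g \<delta> 0 1 2 3 4 3 4 = 0"
proof -
  let ?C = "\<lambda>ts :: 'n list. cyc [ts ! 0, ts ! 1, ts ! 2, ts ! 3, ts ! 4]"
  let ?N = "\<lambda>i j k. class_sum 5 ?C g (\<lambda>ts. \<delta> (ts ! i) (ts ! j) (ts ! k))"
  note sort = class_sum_sort[OF assms, where m = 5 and C = ?C and g = g]
  note pattern = pattern_sum_relabel[where C = ?C]
  \<comment> \<open>Rotating the five positions does not change the reference cycle.\<close>
  have s0: "?N i j k = ?N ([1, 2, 3, 4, 0] ! i) ([1, 2, 3, 4, 0] ! j) ([1, 2, 3, 4, 0] ! k)"
    if "i < 5" "j < 5" "k < 5" for i j k
    by (rule class_sum_relabel_nth[OF _ _ _ that])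
      ((erule dlists_cases, rule ext, simp add: cyc_simps) | (auto)[1])+
  \<comment> \<open>Each orbit of increasing triples under the rotation is reduced to one
    representative, here \<open>?N 0 1 2\<close> and \<open>?N 0 1 3\<close>. Removing
    \<open>One_nat_def\<close> keeps the positions in the literal form in which these equations
    match.\<close>
  have r0: "?N 1 2 3 = ?N 0 1 2"
    using s0[of 0 1 2] by (simp add: sort del: One_nat_def)
  have r1: "?N 2 3 4 = ?N 1 2 3"
    using s0[of 1 2 3] by (simp add: sort del: One_nat_def)
  have r2: "?N 0 3 4 = ?N 2 3 4"
    using s0[of 2 3 4] by (simp add: sort del: One_nat_def)
  have r3: "?N 0 1 4 = ?N 0 3 4"
    using s0[of 0 3 4] by (simp add: sort del: One_nat_def)
  have r4: "?N 1 2 4 = ?N 0 1 3"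
    using s0[of 0 1 3] by (simp add: sort del: One_nat_def)
  have r5: "?N 0 2 3 = ?N 1 2 4"
    using s0[of 1 2 4] by (simp add: sort del: One_nat_def)
  have r6: "?N 1 3 4 = ?N 0 2 3"
    using s0[of 0 2 3] by (simp add: sort del: One_nat_def)
  have r7: "?N 0 2 4 = ?N 1 3 4"
    using s0[of 1 3 4] by (simp add: sort del: One_nat_def)
  \<comment> \<open>The list places the entries of the pattern on the reference cycle so that
    \<open>x \<circ> y\<close> becomes (0 1 2 3 4).\<close>
  have p0: "pattern_sum 5 g \<delta> 0 1 2 3 4 1 2 = penta_tri_term ?N 0 2 1 3 4 2 1"
    by (subst pattern[of "[0, 2, 1, 3, 4]"])
      ((erule dlists_cases, rule ext, simp add: cyc_simps) | (auto)[1])+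
  have p1: "pattern_sum 5 g \<delta> 0 1 2 3 4 1 3 = penta_tri_term ?N 0 3 1 2 4 3 2"
    by (subst pattern[of "[0, 3, 1, 2, 4]"])
      ((erule dlists_cases, rule ext, simp add: cyc_simps) | (auto)[1])+
  have p2: "pattern_sum 5 g \<delta> 0 1 2 3 4 1 4 = penta_tri_term ?N 0 4 1 2 3 4 3"
    by (subst pattern[of "[0, 4, 1, 2, 3]"])
      ((erule dlists_cases, rule ext, simp add: cyc_simps) | (auto)[1])+
  have p3: "pattern_sum 5 g \<delta> 0 1 2 3 4 2 3 = penta_tri_term ?N 0 2 3 1 4 3 1"
    by (subst pattern[of "[0, 2, 3, 1, 4]"])
      ((erule dlists_cases, rule ext, simp add: cyc_simps) | (auto)[1])+
  have p4: "pattern_sum 5 g \<delta> 0 1 2 3 4 2 4 = penta_tri_term ?N 0 3 4 1 2 4 2"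
    by (subst pattern[of "[0, 3, 4, 1, 2]"])
      ((erule dlists_cases, rule ext, simp add: cyc_simps) | (auto)[1])+
  have p5: "pattern_sum 5 g \<delta> 0 1 2 3 4 3 4 = penta_tri_term ?N 0 2 3 4 1 4 1"
    by (subst pattern[of "[0, 2, 3, 4, 1]"])
      ((erule dlists_cases, rule ext, simp add: cyc_simps) | (auto)[1])+
  show ?thesis
    unfolding p0 p1 p2 p3 p4 p5 penta_tri_term_def
    by (simp add: sort r0 r1 r2 r3 r4 r5 r6 r7 del: One_nat_def)
qed

lemma penta_tri_class_42:
  fixes \<delta> :: "'n::finite \<Rightarrow> 'n \<Rightarrow> 'n \<Rightarrow> complex"
  assumes "alternating3 \<delta>"
  shows "pattern_sum 6 g \<delta> 0 1 2 3 4 1 5 + pattern_sum 6 g \<delta> 0 1 2 3 4 3 5 +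
    pattern_sum 6 g \<delta> 0 1 2 3 4 5 2 + pattern_sum 6 g \<delta> 0 1 2 3 4 5 4 = 0"
proof -
  let ?C = "\<lambda>ts :: 'n list. cyc [ts ! 0, ts ! 1, ts ! 2, ts ! 3] \<circ> cyc [ts ! 4, ts ! 5]"
  let ?N = "\<lambda>i j k. class_sum 6 ?C g (\<lambda>ts. \<delta> (ts ! i) (ts ! j) (ts ! k))"
  note sort = class_sum_sort[OF assms, where m = 6 and C = ?C and g = g]
  note pattern = pattern_sum_relabel[where C = ?C]
  \<comment> \<open>The symmetries are the rotation of the 4-cycle and the exchange of the two
    points of the 2-cycle.\<close>
  have s0: "?N i j k = ?N ([1, 2, 3, 0, 4, 5] ! i) ([1, 2, 3, 0, 4, 5] ! j) ([1, 2, 3, 0, 4, 5] ! k)"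
    if "i < 6" "j < 6" "k < 6" for i j k
    by (rule class_sum_relabel_nth[OF _ _ _ that])
      ((erule dlists_cases, rule ext, simp add: cyc_simps) | (auto)[1])+
  have s1: "?N i j k = ?N ([0, 1, 2, 3, 5, 4] ! i) ([0, 1, 2, 3, 5, 4] ! j) ([0, 1, 2, 3, 5, 4] ! k)"
    if "i < 6" "j < 6" "k < 6" for i j k
    by (rule class_sum_relabel_nth[OF _ _ _ that])
      ((erule dlists_cases, rule ext, simp add: cyc_simps) | (auto)[1])+
  have r0: "?N 1 2 3 = ?N 0 1 2"
    using s0[of 0 1 2] by (simp add: sort del: One_nat_def)
  have r1: "?N 0 2 3 = ?N 1 2 3"
    using s0[of 1 2 3] by (simp add: sort del: One_nat_def)
  have r2: "?N 0 1 3 = ?N 0 2 3"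
    using s0[of 0 2 3] by (simp add: sort del: One_nat_def)
  have r3: "?N 0 1 5 = ?N 0 1 4"
    using s1[of 0 1 4] by (simp add: sort del: One_nat_def)
  have r4: "?N 0 2 5 = ?N 0 2 4"
    using s1[of 0 2 4] by (simp add: sort del: One_nat_def)
  have r5: "?N 1 2 4 = ?N 0 1 4"
    using s0[of 0 1 4] by (simp add: sort del: One_nat_def)
  have r6: "?N 2 3 4 = ?N 1 2 4"
    using s0[of 1 2 4] by (simp add: sort del: One_nat_def)
  have r7: "?N 0 3 4 = - ?N 2 3 4"
    using s0[of 2 3 4] by (simp add: sort del: One_nat_def)
  have r8: "?N 0 3 5 = ?N 0 3 4"
    using s1[of 0 3 4] by (simp add: sort del: One_nat_def)
  have r9: "?N 1 2 5 = ?N 1 2 4"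
    using s1[of 1 2 4] by (simp add: sort del: One_nat_def)
  have r10: "?N 1 3 4 = ?N 0 2 4"
    using s0[of 0 2 4] by (simp add: sort del: One_nat_def)
  have r11: "?N 1 3 5 = ?N 1 3 4"
    using s1[of 1 3 4] by (simp add: sort del: One_nat_def)
  have r12: "?N 1 4 5 = ?N 0 4 5"
    using s0[of 0 4 5] by (simp add: sort del: One_nat_def)
  have r13: "?N 2 3 5 = ?N 2 3 4"
    using s1[of 2 3 4] by (simp add: sort del: One_nat_def)
  have r14: "?N 2 4 5 = ?N 1 4 5"
    using s0[of 1 4 5] by (simp add: sort del: One_nat_def)
  have r15: "?N 3 4 5 = ?N 2 4 5"
    using s0[of 2 4 5] by (simp add: sort del: One_nat_def)
  \<comment> \<open>A triple whose orbit contains an odd rearrangement of itself has class sum equal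
    to its own negative.\<close>
  have z0: "?N 0 2 4 = 0"
    using s0[of 1 3 4] by (simp add: sort r0 r1 r2 r3 r4 r5 r6 r7 r8 r9 r10 r11 r12 r13 r14 r15 del: One_nat_def)
  have z1: "?N 0 4 5 = 0"
    using s1[of 0 4 5] by (simp add: sort r0 r1 r2 r3 r4 r5 r6 r7 r8 r9 r10 r11 r12 r13 r14 r15 del: One_nat_def)
  have p0: "pattern_sum 6 g \<delta> 0 1 2 3 4 1 5 = penta_tri_term ?N 0 4 1 2 3 4 5"
    by (subst pattern[of "[0, 4, 1, 2, 3, 5]"])
      ((erule dlists_cases, rule ext, simp add: cyc_simps) | (auto)[1])+
  have p1: "pattern_sum 6 g \<delta> 0 1 2 3 4 3 5 = penta_tri_term ?N 4 0 1 2 5 2 3"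
    by (subst pattern[of "[4, 0, 1, 2, 5, 3]"])
      ((erule dlists_cases, rule ext, simp add: cyc_simps) | (auto)[1])+
  have p2: "pattern_sum 6 g \<delta> 0 1 2 3 4 5 2 = penta_tri_term ?N 0 4 5 2 3 1 5"
    by (subst pattern[of "[0, 4, 5, 2, 3, 1]"])
      ((erule dlists_cases, rule ext, simp add: cyc_simps) | (auto)[1])+
  have p3: "pattern_sum 6 g \<delta> 0 1 2 3 4 5 4 = penta_tri_term ?N 4 0 1 2 3 5 3"
    by (subst pattern[of "[4, 0, 1, 2, 3, 5]"])
      ((erule dlists_cases, rule ext, simp add: cyc_simps) | (auto)[1])+
  show ?thesis
    unfolding p0 p1 p2 p3 penta_tri_term_def
    by (simp add: sort r0 r1 r2 r3 r4 r5 r6 r7 r8 r9 r10 r11 r12 r13 r14 r15 z0 z1 del: One_nat_def)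
qed

lemma penta_tri_class_311:
  fixes \<delta> :: "'n::finite \<Rightarrow> 'n \<Rightarrow> 'n \<Rightarrow> complex"
  assumes "alternating3 \<delta>"
  shows "pattern_sum 5 g \<delta> 0 1 2 3 4 2 1 + pattern_sum 5 g \<delta> 0 1 2 3 4 4 1 +
    pattern_sum 5 g \<delta> 0 1 2 3 4 4 3 = 0"
proof -
  let ?C = "\<lambda>ts :: 'n list. cyc [ts ! 0, ts ! 1, ts ! 2]"
  let ?N = "\<lambda>i j k. class_sum 5 ?C g (\<lambda>ts. \<delta> (ts ! i) (ts ! j) (ts ! k))"
  note sort = class_sum_sort[OF assms, where m = 5 and C = ?C and g = g]
  note pattern = pattern_sum_relabel[where C = ?C]
  \<comment> \<open>The symmetries are the rotation of the 3-cycle and the exchange of the two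
    points fixed by the product.\<close>
  have s0: "?N i j k = ?N ([1, 2, 0, 3, 4] ! i) ([1, 2, 0, 3, 4] ! j) ([1, 2, 0, 3, 4] ! k)"
    if "i < 5" "j < 5" "k < 5" for i j k
    by (rule class_sum_relabel_nth[OF _ _ _ that])
      ((erule dlists_cases, rule ext, simp add: cyc_simps) | (auto)[1])+
  have s1: "?N i j k = ?N ([0, 1, 2, 4, 3] ! i) ([0, 1, 2, 4, 3] ! j) ([0, 1, 2, 4, 3] ! k)"
    if "i < 5" "j < 5" "k < 5" for i j k
    by (rule class_sum_relabel_nth[OF _ _ _ that])
      ((erule dlists_cases, rule ext, simp add: cyc_simps) | (auto)[1])+
  have r0: "?N 0 1 4 = ?N 0 1 3"
    using s1[of 0 1 3] by (simp add: sort del: One_nat_def)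
  have r1: "?N 1 2 3 = ?N 0 1 3"
    using s0[of 0 1 3] by (simp add: sort del: One_nat_def)
  have r2: "?N 0 2 3 = - ?N 1 2 3"
    using s0[of 1 2 3] by (simp add: sort del: One_nat_def)
  have r3: "?N 0 2 4 = ?N 0 2 3"
    using s1[of 0 2 3] by (simp add: sort del: One_nat_def)
  have r4: "?N 1 2 4 = ?N 1 2 3"
    using s1[of 1 2 3] by (simp add: sort del: One_nat_def)
  have r5: "?N 1 3 4 = ?N 0 3 4"
    using s0[of 0 3 4] by (simp add: sort del: One_nat_def)
  have r6: "?N 2 3 4 = ?N 1 3 4"
    using s0[of 1 3 4] by (simp add: sort del: One_nat_def)
  have z0: "?N 0 3 4 = 0"
    using s1[of 0 3 4] by (simp add: sort r0 r1 r2 r3 r4 r5 r6 del: One_nat_def)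
  have p0: "pattern_sum 5 g \<delta> 0 1 2 3 4 2 1 = penta_tri_term ?N 0 3 4 1 2 4 3"
    by (subst pattern[of "[0, 3, 4, 1, 2]"])
      ((erule dlists_cases, rule ext, simp add: cyc_simps) | (auto)[1])+
  have p1: "pattern_sum 5 g \<delta> 0 1 2 3 4 4 1 = penta_tri_term ?N 3 4 0 1 2 2 4"
    by (subst pattern[of "[3, 4, 0, 1, 2]"])
      ((erule dlists_cases, rule ext, simp add: cyc_simps) | (auto)[1])+
  have p2: "pattern_sum 5 g \<delta> 0 1 2 3 4 4 3 = penta_tri_term ?N 3 0 1 2 4 4 2"
    by (subst pattern[of "[3, 0, 1, 2, 4]"])
      ((erule dlists_cases, rule ext, simp add: cyc_simps) | (auto)[1])+
  show ?thesis
    unfolding p0 p1 p2 penta_tri_term_def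
    by (simp add: sort r0 r1 r2 r3 r4 r5 r6 z0 del: One_nat_def)
qed

lemma penta_tri_class_33:
  fixes \<delta> :: "'n::finite \<Rightarrow> 'n \<Rightarrow> 'n \<Rightarrow> complex"
  assumes "alternating3 \<delta>"
  shows "pattern_sum 6 g \<delta> 0 1 2 3 4 2 5 + pattern_sum 6 g \<delta> 0 1 2 3 4 5 3 = 0"
proof -
  let ?C = "\<lambda>ts :: 'n list. cyc [ts ! 0, ts ! 1, ts ! 2] \<circ> cyc [ts ! 3, ts ! 4, ts ! 5]"
  let ?N = "\<lambda>i j k. class_sum 6 ?C g (\<lambda>ts. \<delta> (ts ! i) (ts ! j) (ts ! k))"
  note sort = class_sum_sort[OF assms, where m = 6 and C = ?C and g = g]
  note pattern = pattern_sum_relabel[where C = ?C]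
  \<comment> \<open>The symmetries rotate either 3-cycle separately or exchange the two
    3-cycles.\<close>
  have s0: "?N i j k = ?N ([1, 2, 0, 3, 4, 5] ! i) ([1, 2, 0, 3, 4, 5] ! j) ([1, 2, 0, 3, 4, 5] ! k)"
    if "i < 6" "j < 6" "k < 6" for i j k
    by (rule class_sum_relabel_nth[OF _ _ _ that])
      ((erule dlists_cases, rule ext, simp add: cyc_simps) | (auto)[1])+
  have s1: "?N i j k = ?N ([0, 1, 2, 4, 5, 3] ! i) ([0, 1, 2, 4, 5, 3] ! j) ([0, 1, 2, 4, 5, 3] ! k)"
    if "i < 6" "j < 6" "k < 6" for i j k
    by (rule class_sum_relabel_nth[OF _ _ _ that])
      ((erule dlists_cases, rule ext, simp add: cyc_simps) | (auto)[1])+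
  have s2: "?N i j k = ?N ([3, 4, 5, 0, 1, 2] ! i) ([3, 4, 5, 0, 1, 2] ! j) ([3, 4, 5, 0, 1, 2] ! k)"
    if "i < 6" "j < 6" "k < 6" for i j k
    by (rule class_sum_relabel_nth[OF _ _ _ that])
      ((erule dlists_cases, rule ext, simp add: cyc_simps) | (auto)[1])+
  have r0: "?N 0 1 4 = ?N 0 1 3"
    using s1[of 0 1 3] by (simp add: sort del: One_nat_def)
  have r1: "?N 0 1 5 = ?N 0 1 4"
    using s1[of 0 1 4] by (simp add: sort del: One_nat_def)
  have r2: "?N 1 2 3 = ?N 0 1 3"
    using s0[of 0 1 3] by (simp add: sort del: One_nat_def)
  have r3: "?N 0 2 3 = - ?N 1 2 3"
    using s0[of 1 2 3] by (simp add: sort del: One_nat_def)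
  have r4: "?N 0 2 4 = ?N 0 2 3"
    using s1[of 0 2 3] by (simp add: sort del: One_nat_def)
  have r5: "?N 0 2 5 = ?N 0 2 4"
    using s1[of 0 2 4] by (simp add: sort del: One_nat_def)
  have r6: "?N 0 3 4 = ?N 0 1 3"
    using s2[of 0 1 3] by (simp add: sort del: One_nat_def)
  have r7: "?N 0 3 5 = ?N 0 2 3"
    using s2[of 0 2 3] by (simp add: sort del: One_nat_def)
  have r8: "?N 0 4 5 = ?N 1 2 3"
    using s2[of 1 2 3] by (simp add: sort del: One_nat_def)
  have r9: "?N 1 2 4 = ?N 1 2 3"
    using s1[of 1 2 3] by (simp add: sort del: One_nat_def)
  have r10: "?N 1 2 5 = ?N 1 2 4"
    using s1[of 1 2 4] by (simp add: sort del: One_nat_def)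
  have r11: "?N 1 3 5 = ?N 0 2 4"
    using s2[of 0 2 4] by (simp add: sort del: One_nat_def)
  have r12: "?N 1 4 5 = ?N 1 2 4"
    using s2[of 1 2 4] by (simp add: sort del: One_nat_def)
  have r13: "?N 2 4 5 = ?N 1 2 5"
    using s2[of 1 2 5] by (simp add: sort del: One_nat_def)
  have r14: "?N 3 4 5 = ?N 0 1 2"
    using s2[of 0 1 2] by (simp add: sort del: One_nat_def)
  have p0: "pattern_sum 6 g \<delta> 0 1 2 3 4 2 5 = penta_tri_term ?N 0 3 4 1 2 4 5"
    by (subst pattern[of "[0, 3, 4, 1, 2, 5]"])
      ((erule dlists_cases, rule ext, simp add: cyc_simps) | (auto)[1])+
  have p1: "pattern_sum 6 g \<delta> 0 1 2 3 4 5 3 = penta_tri_term ?N 0 3 4 5 2 1 5"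
    by (subst pattern[of "[0, 3, 4, 5, 2, 1]"])
      ((erule dlists_cases, rule ext, simp add: cyc_simps) | (auto)[1])+
  show ?thesis
    unfolding p0 p1 penta_tri_term_def
    by (simp add: sort r0 r1 r2 r3 r4 r5 r6 r7 r8 r9 r10 r11 r12 r13 r14 del: One_nat_def)
qed

lemma penta_tri_class_221:
  fixes \<delta> :: "'n::finite \<Rightarrow> 'n \<Rightarrow> 'n \<Rightarrow> complex"
  assumes "alternating3 \<delta>"
  shows "pattern_sum 5 g \<delta> 0 1 2 3 4 3 1 + pattern_sum 5 g \<delta> 0 1 2 3 4 3 2 +
    pattern_sum 5 g \<delta> 0 1 2 3 4 4 2 = 0"
proof -
  let ?C = "\<lambda>ts :: 'n list. cyc [ts ! 0, ts ! 1] \<circ> cyc [ts ! 2, ts ! 3]"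
  let ?N = "\<lambda>i j k. class_sum 5 ?C g (\<lambda>ts. \<delta> (ts ! i) (ts ! j) (ts ! k))"
  note sort = class_sum_sort[OF assms, where m = 5 and C = ?C and g = g]
  note pattern = pattern_sum_relabel[where C = ?C]
  have s0: "?N i j k = ?N ([1, 0, 2, 3, 4] ! i) ([1, 0, 2, 3, 4] ! j) ([1, 0, 2, 3, 4] ! k)"
    if "i < 5" "j < 5" "k < 5" for i j k
    by (rule class_sum_relabel_nth[OF _ _ _ that])
      ((erule dlists_cases, rule ext, simp add: cyc_simps) | (auto)[1])+
  have s1: "?N i j k = ?N ([0, 1, 3, 2, 4] ! i) ([0, 1, 3, 2, 4] ! j) ([0, 1, 3, 2, 4] ! k)"
    if "i < 5" "j < 5" "k < 5" for i j k
    by (rule class_sum_relabel_nth[OF _ _ _ that])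
      ((erule dlists_cases, rule ext, simp add: cyc_simps) | (auto)[1])+
  have s2: "?N i j k = ?N ([2, 3, 0, 1, 4] ! i) ([2, 3, 0, 1, 4] ! j) ([2, 3, 0, 1, 4] ! k)"
    if "i < 5" "j < 5" "k < 5" for i j k
    by (rule class_sum_relabel_nth[OF _ _ _ that])
      ((erule dlists_cases, rule ext, simp add: cyc_simps) | (auto)[1])+
  have r0: "?N 0 1 3 = ?N 0 1 2"
    using s1[of 0 1 2] by (simp add: sort del: One_nat_def)
  have r1: "?N 0 2 3 = ?N 0 1 2"
    using s2[of 0 1 2] by (simp add: sort del: One_nat_def)
  have r2: "?N 0 3 4 = ?N 0 2 4"
    using s1[of 0 2 4] by (simp add: sort del: One_nat_def)
  have r3: "?N 1 2 3 = ?N 0 1 3"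
    using s2[of 0 1 3] by (simp add: sort del: One_nat_def)
  have r4: "?N 1 2 4 = ?N 0 2 4"
    using s0[of 0 2 4] by (simp add: sort del: One_nat_def)
  have r5: "?N 1 3 4 = ?N 1 2 4"
    using s1[of 1 2 4] by (simp add: sort del: One_nat_def)
  have r6: "?N 2 3 4 = ?N 0 1 4"
    using s2[of 0 1 4] by (simp add: sort del: One_nat_def)
  \<comment> \<open>With the equations above, these three vanishings kill all ten class sums, so
    every pattern of this type is zero by itself.\<close>
  have z0: "?N 0 1 2 = 0"
    using s0[of 0 1 2] by (simp add: sort r0 r1 r2 r3 r4 r5 r6 del: One_nat_def)
  have z1: "?N 0 1 4 = 0"
    using s0[of 0 1 4] by (simp add: sort r0 r1 r2 r3 r4 r5 r6 del: One_nat_def)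
  have z2: "?N 0 2 4 = 0"
    using s2[of 0 2 4] by (simp add: sort r0 r1 r2 r3 r4 r5 r6 del: One_nat_def)
  have p0: "pattern_sum 5 g \<delta> 0 1 2 3 4 3 1 = penta_tri_term ?N 0 4 2 3 1 3 4"
    by (subst pattern[of "[0, 4, 2, 3, 1]"])
      ((erule dlists_cases, rule ext, simp add: cyc_simps) | (auto)[1])+
  have p1: "pattern_sum 5 g \<delta> 0 1 2 3 4 3 2 = penta_tri_term ?N 0 2 3 4 1 4 3"
    by (subst pattern[of "[0, 2, 3, 4, 1]"])
      ((erule dlists_cases, rule ext, simp add: cyc_simps) | (auto)[1])+
  have p2: "pattern_sum 5 g \<delta> 0 1 2 3 4 4 2 = penta_tri_term ?N 4 0 1 2 3 3 1"
    by (subst pattern[of "[4, 0, 1, 2, 3]"])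
      ((erule dlists_cases, rule ext, simp add: cyc_simps) | (auto)[1])+
  show ?thesis
    unfolding p0 p1 p2 penta_tri_term_def
    by (simp add: sort r0 r1 r2 r3 r4 r5 r6 z0 z1 z2 del: One_nat_def)
qed

lemma penta_tri_class_51:
  fixes \<delta> :: "'n::finite \<Rightarrow> 'n \<Rightarrow> 'n \<Rightarrow> complex"
  assumes "alternating3 \<delta>"
  shows "pattern_sum 6 g \<delta> 0 1 2 3 4 4 5 + pattern_sum 6 g \<delta> 0 1 2 3 4 5 1 = 0"
proof -
  let ?C = "\<lambda>ts :: 'n list. cyc [ts ! 0, ts ! 1, ts ! 2, ts ! 3, ts ! 4]"
  let ?N = "\<lambda>i j k. class_sum 6 ?C g (\<lambda>ts. \<delta> (ts ! i) (ts ! j) (ts ! k))"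
  note sort = class_sum_sort[OF assms, where m = 6 and C = ?C and g = g]
  note pattern = pattern_sum_relabel[where C = ?C]
  \<comment> \<open>Position 5 is fixed by the product and stays in place under the
    rotation.\<close>
  have s0: "?N i j k = ?N ([1, 2, 3, 4, 0, 5] ! i) ([1, 2, 3, 4, 0, 5] ! j) ([1, 2, 3, 4, 0, 5] ! k)"
    if "i < 6" "j < 6" "k < 6" for i j k
    by (rule class_sum_relabel_nth[OF _ _ _ that])
      ((erule dlists_cases, rule ext, simp add: cyc_simps) | (auto)[1])+
  have r0: "?N 1 2 3 = ?N 0 1 2"
    using s0[of 0 1 2] by (simp add: sort del: One_nat_def)
  have r1: "?N 2 3 4 = ?N 1 2 3"
    using s0[of 1 2 3] by (simp add: sort del: One_nat_def)
  have r2: "?N 0 3 4 = ?N 2 3 4"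
    using s0[of 2 3 4] by (simp add: sort del: One_nat_def)
  have r3: "?N 0 1 4 = ?N 0 3 4"
    using s0[of 0 3 4] by (simp add: sort del: One_nat_def)
  have r4: "?N 1 3 5 = ?N 0 2 5"
    using s0[of 0 2 5] by (simp add: sort del: One_nat_def)
  have r5: "?N 2 4 5 = ?N 1 3 5"
    using s0[of 1 3 5] by (simp add: sort del: One_nat_def)
  have r6: "?N 0 3 5 = - ?N 2 4 5"
    using s0[of 2 4 5] by (simp add: sort del: One_nat_def)
  have r7: "?N 1 2 5 = ?N 0 1 5"
    using s0[of 0 1 5] by (simp add: sort del: One_nat_def)
  have r8: "?N 2 3 5 = ?N 1 2 5"
    using s0[of 1 2 5] by (simp add: sort del: One_nat_def)
  have r9: "?N 3 4 5 = ?N 2 3 5"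
    using s0[of 2 3 5] by (simp add: sort del: One_nat_def)
  have r10: "?N 0 4 5 = - ?N 3 4 5"
    using s0[of 3 4 5] by (simp add: sort del: One_nat_def)
  have r11: "?N 1 2 4 = ?N 0 1 3"
    using s0[of 0 1 3] by (simp add: sort del: One_nat_def)
  have r12: "?N 0 2 3 = ?N 1 2 4"
    using s0[of 1 2 4] by (simp add: sort del: One_nat_def)
  have r13: "?N 1 3 4 = ?N 0 2 3"
    using s0[of 0 2 3] by (simp add: sort del: One_nat_def)
  have r14: "?N 1 4 5 = ?N 0 3 5"
    using s0[of 0 3 5] by (simp add: sort del: One_nat_def)
  have p0: "pattern_sum 6 g \<delta> 0 1 2 3 4 4 5 = penta_tri_term ?N 5 0 1 2 3 3 4"
    by (subst pattern[of "[5, 0, 1, 2, 3, 4]"])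
      ((erule dlists_cases, rule ext, simp add: cyc_simps) | (auto)[1])+
  have p1: "pattern_sum 6 g \<delta> 0 1 2 3 4 5 1 = penta_tri_term ?N 0 5 2 3 4 1 5"
    by (subst pattern[of "[0, 5, 2, 3, 4, 1]"])
      ((erule dlists_cases, rule ext, simp add: cyc_simps) | (auto)[1])+
  show ?thesis
    unfolding p0 p1 penta_tri_term_def
    by (simp add: sort r0 r1 r2 r3 r4 r5 r6 r7 r8 r9 r10 r11 r12 r13 r14 del: One_nat_def)
qed

text \<open>The 5-cycle and the 3-cycle share only \<open>z\<close>, which leaves a single pattern
  with a 7-cycle as product.\<close>

lemma penta_tri_class_7:
  fixes \<delta> :: "'n::finite \<Rightarrow> 'n \<Rightarrow> 'n \<Rightarrow> complex"
  assumes "alternating3 \<delta>"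
  shows "pattern_sum 7 g \<delta> 0 1 2 3 4 5 6 = 0"
proof -
  let ?C = "\<lambda>ts :: 'n list. cyc [ts ! 0, ts ! 1, ts ! 2, ts ! 3, ts ! 4, ts ! 5, ts ! 6]"
  let ?N = "\<lambda>i j k. class_sum 7 ?C g (\<lambda>ts. \<delta> (ts ! i) (ts ! j) (ts ! k))"
  note sort = class_sum_sort[OF assms, where m = 7 and C = ?C and g = g]
  note pattern = pattern_sum_relabel[where C = ?C]
  have s0: "?N i j k = ?N ([1, 2, 3, 4, 5, 6, 0] ! i) ([1, 2, 3, 4, 5, 6, 0] ! j) ([1, 2, 3, 4, 5, 6, 0] ! k)"
    if "i < 7" "j < 7" "k < 7" for i j k
    by (rule class_sum_relabel_nth[OF _ _ _ that])
      ((erule dlists_cases, rule ext, simp add: cyc_simps) | (auto)[1])+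
  have r0: "?N 1 2 3 = ?N 0 1 2"
    using s0[of 0 1 2] by (simp add: sort del: One_nat_def)
  have r1: "?N 2 3 4 = ?N 1 2 3"
    using s0[of 1 2 3] by (simp add: sort del: One_nat_def)
  have r2: "?N 3 4 5 = ?N 2 3 4"
    using s0[of 2 3 4] by (simp add: sort del: One_nat_def)
  have r3: "?N 4 5 6 = ?N 3 4 5"
    using s0[of 3 4 5] by (simp add: sort del: One_nat_def)
  have r4: "?N 0 5 6 = ?N 4 5 6"
    using s0[of 4 5 6] by (simp add: sort del: One_nat_def)
  have r5: "?N 0 1 6 = ?N 0 5 6"
    using s0[of 0 5 6] by (simp add: sort del: One_nat_def)
  have r6: "?N 1 2 6 = ?N 0 1 5"
    using s0[of 0 1 5] by (simp add: sort del: One_nat_def)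
  have r7: "?N 0 2 3 = ?N 1 2 6"
    using s0[of 1 2 6] by (simp add: sort del: One_nat_def)
  have r8: "?N 1 3 5 = ?N 0 2 4"
    using s0[of 0 2 4] by (simp add: sort del: One_nat_def)
  have r9: "?N 2 4 6 = ?N 1 3 5"
    using s0[of 1 3 5] by (simp add: sort del: One_nat_def)
  have r10: "?N 0 3 5 = ?N 2 4 6"
    using s0[of 2 4 6] by (simp add: sort del: One_nat_def)
  have r11: "?N 1 4 6 = ?N 0 3 5"
    using s0[of 0 3 5] by (simp add: sort del: One_nat_def)
  have r12: "?N 0 2 5 = ?N 1 4 6"
    using s0[of 1 4 6] by (simp add: sort del: One_nat_def)
  have r13: "?N 1 2 4 = ?N 0 1 3"
    using s0[of 0 1 3] by (simp add: sort del: One_nat_def)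
  have r14: "?N 2 3 5 = ?N 1 2 4"
    using s0[of 1 2 4] by (simp add: sort del: One_nat_def)
  have r15: "?N 3 4 6 = ?N 2 3 5"
    using s0[of 2 3 5] by (simp add: sort del: One_nat_def)
  have r16: "?N 0 4 5 = ?N 3 4 6"
    using s0[of 3 4 6] by (simp add: sort del: One_nat_def)
  have r17: "?N 1 5 6 = ?N 0 4 5"
    using s0[of 0 4 5] by (simp add: sort del: One_nat_def)
  have r18: "?N 0 2 6 = ?N 1 5 6"
    using s0[of 1 5 6] by (simp add: sort del: One_nat_def)
  have r19: "?N 1 2 5 = ?N 0 1 4"
    using s0[of 0 1 4] by (simp add: sort del: One_nat_def)
  have p0: "pattern_sum 7 g \<delta> 0 1 2 3 4 5 6 = penta_tri_term ?N 0 3 4 5 6 1 2"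
    by (subst pattern[of "[0, 3, 4, 5, 6, 1, 2]"])
      ((erule dlists_cases, rule ext, simp add: cyc_simps) | (auto)[1])+
  show ?thesis
    unfolding p0 penta_tri_term_def
    by (simp add: sort r0 r1 r2 r3 r4 r5 r6 r7 r8 r9 r10 r11 r12 r13 r14 r15 r16 r17 r18 r19 del: One_nat_def)
qed

section \<open>Splitting pairs by their coincidences with a tuple\<close>

lemma sum_pairs_split:
  fixes f :: "'n::finite \<Rightarrow> 'n \<Rightarrow> complex"
  assumes "z \<notin> A"
  shows "(\<Sum>b\<in>- {z}. \<Sum>c\<in>- {z, b}. f b c) =
    (\<Sum>b\<in>A. \<Sum>c\<in>A - {b}. f b c) + (\<Sum>b\<in>- insert z A. \<Sum>a\<in>A. f a b + f b a) +
    (\<Sum>b\<in>- insert z A. \<Sum>c\<in>- insert b (insert z A). f b c)"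
proof -
  let ?R = "- insert z A"
  have out: "(\<Sum>b\<in>- {z}. h b) = (\<Sum>b\<in>A. h b) + (\<Sum>b\<in>?R. h b)" for h :: "'n \<Rightarrow> complex"
  proof -
    have "- {z} = A \<union> ?R" using assms by auto
    moreover have "A \<inter> ?R = {}" by auto
    ultimately show ?thesis by (simp add: sum.union_disjoint)
  qed
  have inA: "(\<Sum>c\<in>- {z, b}. f b c) = (\<Sum>c\<in>A - {b}. f b c) + (\<Sum>c\<in>?R. f b c)" if "b \<in> A" for b
  proof -
    have "- {z, b} = (A - {b}) \<union> ?R" using assms that by auto
    moreover have "(A - {b}) \<inter> ?R = {}" by auto
    ultimately show ?thesis by (simp add: sum.union_disjoint)
  qed
  have inR: "(\<Sum>c\<in>- {z, b}. f b c) = (\<Sum>c\<in>A. f b c) + (\<Sum>c\<in>- insert b (insert z A). f b c)"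
    if "b \<in> ?R" for b
  proof -
    have "- {z, b} = A \<union> - insert b (insert z A)" using assms that by auto
    moreover have "A \<inter> - insert b (insert z A) = {}" by auto
    ultimately show ?thesis by (simp add: sum.union_disjoint)
  qed
  have "(\<Sum>b\<in>A. \<Sum>c\<in>?R. f b c) = (\<Sum>c\<in>?R. \<Sum>b\<in>A. f b c)" by (rule sum.swap)
  then show ?thesis
    unfolding out by (simp add: inA inR sum.distrib)
qed

text \<open>The pair (b, c) has both, exactly one or none of its points among the other entries of
  the tuple. New points are appended at positions k and k + 1, which gives sums over tuples of
  length k, k + 1 and k + 2.\<close>

lemma sum_dlists_split:
  fixes f :: "'n::finite list \<Rightarrow> 'n \<Rightarrow> 'n \<Rightarrow> complex"
  assumes "k \<ge> 1"
  shows "(\<Sum>ts\<in>dlists k. \<Sum>b\<in>- {ts ! 0}. \<Sum>c\<in>- {ts ! 0, b}. f ts b c) =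
    (\<Sum>ts\<in>dlists k. \<Sum>b\<in>set (tl ts). \<Sum>c\<in>set (tl ts) - {b}. f ts b c) +
    (\<Sum>ts\<in>dlists (Suc k). \<Sum>a\<in>set (tl (take k ts)).
      f (take k ts) a (ts ! k) + f (take k ts) (ts ! k) a) +
    (\<Sum>ts\<in>dlists (Suc (Suc k)). f (take k ts) (ts ! k) (ts ! Suc k))"
proof -
  have *: "(\<Sum>b\<in>- {ts ! 0}. \<Sum>c\<in>- {ts ! 0, b}. f ts b c) =
    (\<Sum>b\<in>set (tl ts). \<Sum>c\<in>set (tl ts) - {b}. f ts b c) +
    (\<Sum>b\<in>- set ts. \<Sum>a\<in>set (tl ts). f ts a b + f ts b a) +
    (\<Sum>b\<in>- set ts. \<Sum>c\<in>- set (ts @ [b]). f ts b c)" if mem: "ts \<in> dlists k" for ts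
  proof -
    obtain z as where ts: "ts = z # as" using mem assms by (cases ts) (simp_all add: dlists_def)
    show ?thesis using mem sum_pairs_split[of z "set as" "f ts"] by (simp add: ts dlists_def insert_commute)
  qed
  have "(\<Sum>ts\<in>dlists k. \<Sum>b\<in>- {ts ! 0}. \<Sum>c\<in>- {ts ! 0, b}. f ts b c) =
    (\<Sum>ts\<in>dlists k. \<Sum>b\<in>set (tl ts). \<Sum>c\<in>set (tl ts) - {b}. f ts b c) +
    (\<Sum>ts\<in>dlists k. \<Sum>b\<in>- set ts. \<Sum>a\<in>set (tl ts). f ts a b + f ts b a) +
    (\<Sum>ts\<in>dlists k. \<Sum>b\<in>- set ts. \<Sum>c\<in>- set (ts @ [b]). f ts b c)"
    by (simp only: sum.distrib[symmetric]) (rule sum.cong[OF refl], simp add: *)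
  also have "(\<Sum>ts\<in>dlists k. \<Sum>b\<in>- set ts. \<Sum>a\<in>set (tl ts). f ts a b + f ts b a) =
    (\<Sum>ts\<in>dlists (Suc k). \<Sum>a\<in>set (tl (take k ts)).
      f (take k ts) a (ts ! k) + f (take k ts) (ts ! k) a)"
    unfolding sum_dlists_Suc by (intro sum.cong refl) (auto simp: dlists_def nth_append)
  also have "(\<Sum>ts\<in>dlists k. \<Sum>b\<in>- set ts. \<Sum>c\<in>- set (ts @ [b]). f ts b c) =
    (\<Sum>ts\<in>dlists (Suc (Suc k)). f (take k ts) (ts ! k) (ts ! Suc k))"
    unfolding sum_dlists_Suc by (intro sum.cong refl) (auto simp: dlists_def nth_append)
  finally show ?thesis .
qed

text \<open>Twelve patterns have both \<open>b\<close> and \<open>c\<close> in the 5-cycle, eight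
  have one of them there and one has neither. The seven cycle types partition these 21 sums into
  groups that vanish.\<close>

lemma penta_tri_cancel:
  fixes \<delta> :: "'n::finite \<Rightarrow> 'n \<Rightarrow> 'n \<Rightarrow> complex"
  assumes "alternating3 \<delta>"
  shows "(\<Sum>ts\<in>dlists 5. \<Sum>b\<in>- {ts ! 0}. \<Sum>c\<in>- {ts ! 0, b}.
    of_bool (cyc ts \<circ> cyc [ts ! 0, b, c] = g) *
      penta_tri_term \<delta> (ts ! 0) (ts ! 1) (ts ! 2) (ts ! 3) (ts ! 4) b c) = 0"
proof -
  define f where "f ts b c = of_bool (cyc ts \<circ> cyc [ts ! 0, b, c] = g) *
      penta_tri_term \<delta> (ts ! 0) (ts ! 1) (ts ! 2) (ts ! 3) (ts ! 4) b c" for ts b c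
  have take5: "ts \<in> dlists 5 \<Longrightarrow> cyc ts = cyc [ts ! 0, ts ! 1, ts ! 2, ts ! 3, ts ! 4]"
    "ts \<in> dlists 6 \<Longrightarrow> take 5 ts = [ts ! 0, ts ! 1, ts ! 2, ts ! 3, ts ! 4]"
    "ts \<in> dlists 7 \<Longrightarrow> take 5 ts = [ts ! 0, ts ! 1, ts ! 2, ts ! 3, ts ! 4]" for ts :: "'n list"
    by (erule dlists_cases, simp)+
  have list_nth: "[a, b, c, d, e] ! 0 = a" "[a, b, c, d, e] ! 1 = b" "[a, b, c, d, e] ! 2 = c"
    "[a, b, c, d, e] ! 3 = d" "[a, b, c, d, e] ! 4 = e" for a b c d e :: 'n
    by simp_all
  let ?p5 = "pattern_sum 5 g \<delta> 0 1 2 3 4" and ?p6 = "pattern_sum 6 g \<delta> 0 1 2 3 4"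
  have "(\<Sum>ts\<in>dlists 5. \<Sum>b\<in>set (tl ts). \<Sum>c\<in>set (tl ts) - {b}. f ts b c) =
    (\<Sum>ts\<in>dlists 5. f ts (ts ! 1) (ts ! 2) + f ts (ts ! 1) (ts ! 3) + f ts (ts ! 1) (ts ! 4) +
      f ts (ts ! 2) (ts ! 1) + f ts (ts ! 2) (ts ! 3) + f ts (ts ! 2) (ts ! 4) +
      f ts (ts ! 3) (ts ! 1) + f ts (ts ! 3) (ts ! 2) + f ts (ts ! 3) (ts ! 4) +
      f ts (ts ! 4) (ts ! 1) + f ts (ts ! 4) (ts ! 2) + f ts (ts ! 4) (ts ! 3))"
    by (rule sum.cong[OF refl], erule dlists_cases) (simp add: insert_Diff_if)
  also have "\<dots> = ?p5 1 2 + ?p5 1 3 + ?p5 1 4 + ?p5 2 1 + ?p5 2 3 + ?p5 2 4 +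
      ?p5 3 1 + ?p5 3 2 + ?p5 3 4 + ?p5 4 1 + ?p5 4 2 + ?p5 4 3"
    unfolding pattern_sum_def class_sum_def sum.distrib[symmetric]
    by (rule sum.cong[OF refl]) (simp only: f_def take5)
  finally have e5: "(\<Sum>ts\<in>dlists 5. \<Sum>b\<in>set (tl ts). \<Sum>c\<in>set (tl ts) - {b}. f ts b c) = \<dots>" .
  have "(\<Sum>ts\<in>dlists 6. \<Sum>a\<in>set (tl (take 5 ts)). f (take 5 ts) a (ts ! 5) + f (take 5 ts) (ts ! 5) a) =
      (\<Sum>ts\<in>dlists 6. f (take 5 ts) (ts ! 1) (ts ! 5) + f (take 5 ts) (ts ! 2) (ts ! 5) +
        f (take 5 ts) (ts ! 3) (ts ! 5) + f (take 5 ts) (ts ! 4) (ts ! 5) +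
        f (take 5 ts) (ts ! 5) (ts ! 1) + f (take 5 ts) (ts ! 5) (ts ! 2) +
        f (take 5 ts) (ts ! 5) (ts ! 3) + f (take 5 ts) (ts ! 5) (ts ! 4))"
    by (rule sum.cong[OF refl], erule dlists_cases) simp
  also have "\<dots> = ?p6 1 5 + ?p6 2 5 + ?p6 3 5 + ?p6 4 5 + ?p6 5 1 + ?p6 5 2 + ?p6 5 3 + ?p6 5 4"
    unfolding pattern_sum_def class_sum_def sum.distrib[symmetric]
    by (rule sum.cong[OF refl]) (simp only: f_def take5 list_nth)
  finally have e6: "(\<Sum>ts\<in>dlists 6. \<Sum>a\<in>set (tl (take 5 ts)).
      f (take 5 ts) a (ts ! 5) + f (take 5 ts) (ts ! 5) a) = \<dots>" .
  have e7: "(\<Sum>ts\<in>dlists 7. f (take 5 ts) (ts ! 5) (ts ! 6)) = pattern_sum 7 g \<delta> 0 1 2 3 4 5 6"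
    unfolding pattern_sum_def class_sum_def
    by (rule sum.cong[OF refl]) (simp only: f_def take5 list_nth)
  have "(\<Sum>ts\<in>dlists 5. \<Sum>b\<in>- {ts ! 0}. \<Sum>c\<in>- {ts ! 0, b}. f ts b c) = 0"
    using sum_dlists_split[of 5 f] e5 e6 e7 penta_tri_class_5[OF assms, of g]
      penta_tri_class_42[OF assms, of g] penta_tri_class_33[OF assms, of g]
      penta_tri_class_51[OF assms, of g] penta_tri_class_311[OF assms, of g]
      penta_tri_class_221[OF assms, of g] penta_tri_class_7[OF assms, of g]
    by simp algebra
  then show ?thesis by (simp add: f_def)
qed


section \<open>Pairs of 3-cycles and their product 5-cycles\<close>

text \<open>Analogue of \<open>penta_tri_term\<close> for \<open>x = (z a1 a2)\<close>: contracting
  the form of \<open>x\<close> in its second argument by the basis vector of \<open>z\<close> leaves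
  the coordinate at \<open>a2\<close> minus the one at \<open>a1\<close>.\<close>

definition tri_tri_term ::
  "('a \<Rightarrow> 'a \<Rightarrow> 'a \<Rightarrow> complex) \<Rightarrow> 'a \<Rightarrow> 'a \<Rightarrow> 'a \<Rightarrow> 'a \<Rightarrow> 'a \<Rightarrow> complex" where
  "tri_tri_term \<delta> z a1 a2 b1 b2 =
    (\<delta> z b1 a2 + \<delta> b1 b2 a2 + \<delta> b2 z a2) - (\<delta> z b1 a1 + \<delta> b1 b2 a1 + \<delta> b2 z a1)"

text \<open>The wedge of the 2-form of the 5-cycle \<open>g\<close> on \<open>ts\<close> with \<open>a \<mapsto> g a - a\<close>, paired with \<open>L\<close>.\<close>
definition penta_boundary ::
  "('n \<Rightarrow> 'n \<Rightarrow> 'n \<Rightarrow> complex) \<Rightarrow> ('n \<Rightarrow> complex) \<Rightarrow> 'n list \<Rightarrow> complex" where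
  "penta_boundary \<delta> L ts = (\<Sum>(i, j) \<leftarrow> [(0, 1), (1, 2), (2, 3), (3, 4), (4, 0)].
    (2 * (\<delta> (ts ! 0) (ts ! 2) (ts ! i) + \<delta> (ts ! 1) (ts ! 3) (ts ! i) + \<delta> (ts ! 2) (ts ! 4) (ts ! i)
       + \<delta> (ts ! 3) (ts ! 0) (ts ! i) + \<delta> (ts ! 4) (ts ! 1) (ts ! i))
     - (\<delta> (ts ! 0) (ts ! 1) (ts ! i) + \<delta> (ts ! 1) (ts ! 2) (ts ! i) + \<delta> (ts ! 2) (ts ! 3) (ts ! i)
       + \<delta> (ts ! 3) (ts ! 4) (ts ! i) + \<delta> (ts ! 4) (ts ! 0) (ts ! i)))
    * (L (ts ! j) - L (ts ! i)))"

text \<open>Only pairs of 3-cycles meeting in \<open>z\<close> alone survive, and their product is a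
  5-cycle. With \<open>L\<close> an indicator function the weight is a coordinate of the vector
  attached to \<open>x\<close>; its constant part \<beta> cancels. Summing over the five starting
  points of the product produces the factor 5.\<close>

lemma tri_tri_sum:
  fixes \<delta> :: "'n::finite \<Rightarrow> 'n \<Rightarrow> 'n \<Rightarrow> complex" and L :: "'n \<Rightarrow> complex"
  assumes alt: "alternating3 \<delta>"
  shows "5 * (\<Sum>ts\<in>dlists 3. \<Sum>b\<in>- {ts ! 0}. \<Sum>c\<in>- {ts ! 0, b}.
      of_bool (cyc ts \<circ> cyc [ts ! 0, b, c] = g) *
      (tri_tri_term \<delta> (ts ! 0) (ts ! 1) (ts ! 2) b c * (\<beta> + s * (L (ts ! 0) + L (ts ! 1) + L (ts ! 2))))) =
    s * class_sum 5 cyc g (penta_boundary \<delta> L)"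
proof -
  define f where "f ts b c = of_bool (cyc ts \<circ> cyc [ts ! 0, b, c] = g) *
      (tri_tri_term \<delta> (ts ! 0) (ts ! 1) (ts ! 2) b c *
        (\<beta> + s * (L (ts ! 0) + L (ts ! 1) + L (ts ! 2))))" for ts b c
  note zero = alternating3D(3-5)[OF alt]
  have cyclic: "\<delta> i j k = \<delta> j k i" for i j k
    using alt unfolding alternating3_def by blast
  \<comment> \<open>If \<open>x\<close> and \<open>y\<close> move the same three points, each term
    vanishes because \<delta> is alternating.\<close>
  have e3: "(\<Sum>ts\<in>dlists 3. \<Sum>b\<in>set (tl ts). \<Sum>c\<in>set (tl ts) - {b}. f ts b c) = 0"
  proof (rule sum.neutral, rule ballI, erule dlists_cases)
    fix a b c :: 'n assume "distinct [a, b, c]" "distinct [c, b, a]"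
    moreover have "tri_tri_term \<delta> a b c b c = 0" "tri_tri_term \<delta> a b c c b = 0"
      using cyclic[of a b c] cyclic[of c a b] cyclic[of a c b] cyclic[of b a c]
      by (simp_all add: tri_tri_term_def zero)
    ultimately show "(\<Sum>x\<in>set (tl [a, b, c]). \<Sum>y\<in>set (tl [a, b, c]) - {x}. f [a, b, c] x y) = 0"
      by (simp add: f_def insert_Diff_if)
  qed
  let ?h = "\<lambda>ts. f (take 3 ts) (ts ! 2) (ts ! 3) + f (take 3 ts) (ts ! 3) (ts ! 2)"
  have "(\<Sum>ts\<in>dlists 4. \<Sum>a\<in>set (tl (take 3 ts)). f (take 3 ts) a (ts ! 3) + f (take 3 ts) (ts ! 3) a) =
      (\<Sum>ts\<in>dlists 4. f (take 3 ts) (ts ! 1) (ts ! 3) + f (take 3 ts) (ts ! 3) (ts ! 1)) +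
      (\<Sum>ts\<in>dlists 4. ?h ts)"
    unfolding sum.distrib[symmetric] by (rule sum.cong[OF refl], erule dlists_cases) simp
  \<comment> \<open>The relabelling keeps \<open>x\<close> but starts it at its second entry. When
    \<open>x\<close> and \<open>y\<close> share exactly two points, the terms based at these two
    points cancel.\<close>
  also have "(\<Sum>ts\<in>dlists 4. ?h ts) = (\<Sum>ts\<in>dlists 4. ?h (map ((!) ts) [1, 2, 0, 3]))"
    by (rule sum_dlists_relabel) auto
  also have "(\<Sum>ts\<in>dlists 4. f (take 3 ts) (ts ! 1) (ts ! 3) + f (take 3 ts) (ts ! 3) (ts ! 1)) + \<dots> = 0"
    unfolding sum.distrib[symmetric]
  proof (rule sum.neutral, rule ballI, erule dlists_cases)
    fix z a b c :: 'n assume d: "distinct [z, a, b, c]" "distinct [c, b, a, z]"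
    have "cyc [a, b, z] = cyc [z, a, b]" "cyc [a, c, z] = cyc [z, a, c]" "cyc [a, z, c] = cyc [z, c, a]"
      by (rule ext, use d in \<open>simp add: cyc_simps\<close>)+
    moreover have "tri_tri_term \<delta> a b z c z = - tri_tri_term \<delta> z a b a c"
      "tri_tri_term \<delta> a b z z c = - tri_tri_term \<delta> z a b c a"
      using cyclic[of a c z] cyclic[of c z a] cyclic[of z c a] cyclic[of a z c]
      by (simp_all add: tri_tri_term_def zero)
    ultimately show "f (take 3 [z, a, b, c]) ([z, a, b, c] ! 1) ([z, a, b, c] ! 3) +
        f (take 3 [z, a, b, c]) ([z, a, b, c] ! 3) ([z, a, b, c] ! 1) +
        ?h (map ((!) [z, a, b, c]) [1, 2, 0, 3]) = 0"
      by (simp add: f_def add.commute add.left_commute)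
  qed
  finally have e4: "(\<Sum>ts\<in>dlists 4. \<Sum>a\<in>set (tl (take 3 ts)).
      f (take 3 ts) a (ts ! 3) + f (take 3 ts) (ts ! 3) a) = 0" .
  define T where "T ts = tri_tri_term \<delta> (ts ! 0) (ts ! 3) (ts ! 4) (ts ! 1) (ts ! 2) *
        (\<beta> + s * (L (ts ! 0) + L (ts ! 3) + L (ts ! 4)))" for ts
  have e5: "(\<Sum>ts\<in>dlists 5. f (take 3 ts) (ts ! 3) (ts ! 4)) = class_sum 5 cyc g T"
  proof -
    \<comment> \<open>In the positions chosen, \<open>x = (0 3 4)\<close> and
      \<open>y = (0 1 2)\<close> compose to the 5-cycle in the order of the tuple.\<close>
    have "(\<Sum>ts\<in>dlists 5. f (take 3 ts) (ts ! 3) (ts ! 4)) =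
        (\<Sum>ts\<in>dlists 5. (\<lambda>ts. f (take 3 ts) (ts ! 3) (ts ! 4)) (map ((!) ts) [0, 3, 4, 1, 2]))"
      by (rule sum_dlists_relabel) auto
    also have "\<dots> = class_sum 5 cyc g T"
      unfolding class_sum_def
    proof (rule sum.cong[OF refl], erule dlists_cases)
      fix a b c d e :: 'n assume d: "distinct [a, b, c, d, e]" "distinct [e, d, c, b, a]"
      have "cyc [a, d, e] \<circ> cyc [a, b, c] = cyc [a, b, c, d, e]"
        by (rule ext, use d in \<open>simp add: cyc_simps\<close>)
      then show "(\<lambda>ts. f (take 3 ts) (ts ! 3) (ts ! 4)) (map ((!) [a, b, c, d, e]) [0, 3, 4, 1, 2]) =
          of_bool (cyc [a, b, c, d, e] = g) * T [a, b, c, d, e]"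
        by (simp add: f_def T_def)
    qed
    finally show ?thesis .
  qed
  let ?rot = "\<lambda>ts :: 'n list. map ((!) ts) [1, 2, 3, 4, 0]"
  \<comment> \<open>A rotated tuple gives the same 5-cycle, so five times the class sum of
    \<open>T\<close> is the class sum of \<open>T\<close> added up over all rotations.\<close>
  have rot: "class_sum 5 cyc g \<phi> = class_sum 5 cyc g (\<lambda>ts. \<phi> (?rot ts))" for \<phi>
    by (rule class_sum_relabel) ((erule dlists_cases, rule ext, simp add: cyc_simps) | (auto)[1])+
  have "5 * class_sum 5 cyc g T =
    class_sum 5 cyc g (\<lambda>ts. T ts + T (?rot ts) + T (?rot (?rot ts)) + T (?rot (?rot (?rot ts))) +
      T (?rot (?rot (?rot (?rot ts)))))"
    unfolding class_sum_linear
    using rot[of T] rot[of "\<lambda>ts. T (?rot ts)"] rot[of "\<lambda>ts. T (?rot (?rot ts))"]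
      rot[of "\<lambda>ts. T (?rot (?rot (?rot ts)))"]
    by simp
  also have "\<dots> = class_sum 5 cyc g (\<lambda>ts. s * penta_boundary \<delta> L ts)"
  proof (rule class_sum_cong[OF refl])
    fix ts :: "'n list"
    have sort: "j < i \<Longrightarrow> \<delta> (ts ! i) (ts ! j) (ts ! k) = - \<delta> (ts ! j) (ts ! i) (ts ! k)"
      "k < j \<Longrightarrow> \<delta> (ts ! i) (ts ! j) (ts ! k) = - \<delta> (ts ! i) (ts ! k) (ts ! j)" for i j k
      by (rule alternating3D[OF alt])+
    show "T ts + T (?rot ts) + T (?rot (?rot ts)) + T (?rot (?rot (?rot ts))) +
      T (?rot (?rot (?rot (?rot ts)))) = s * penta_boundary \<delta> L ts"
      by (simp add: T_def tri_tri_term_def penta_boundary_def sort zero) algebra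
  qed
  finally have "5 * class_sum 5 cyc g T = s * class_sum 5 cyc g (penta_boundary \<delta> L)"
    by (simp add: class_sum_linear)
  moreover have "(\<Sum>ts\<in>dlists 3. \<Sum>b\<in>- {ts ! 0}. \<Sum>c\<in>- {ts ! 0, b}. f ts b c) = class_sum 5 cyc g T"
    using sum_dlists_split[of 3 f] e3 e4 e5 by simp
  ultimately show ?thesis by (simp add: f_def)
qed

section \<open>The forms on 3-cycles and 5-cycles\<close>

definition tri_form :: "('n::finite \<Rightarrow> 'n) \<Rightarrow> complex^'n \<Rightarrow> complex^'n \<Rightarrow> complex" where
  "tri_form g v w = (\<Sum>p\<in>UNIV. v $ p * w $ (g p) - v $ (g p) * w $ p)"

definition penta_form :: "('n::finite \<Rightarrow> 'n) \<Rightarrow> complex^'n \<Rightarrow> complex^'n \<Rightarrow> complex" where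
  "penta_form g v w = (\<Sum>p\<in>UNIV. v $ (g p) * w $ p - v $ p * w $ (g p)
     - 2 * (v $ (g (g p)) * w $ p) + 2 * (v $ p * w $ (g (g p))))"

definition tri_vec :: "complex \<Rightarrow> complex \<Rightarrow> ('n::finite \<Rightarrow> 'n) \<Rightarrow> complex^'n" where
  "tri_vec a b g = (\<chi> l. if g l \<noteq> l then a else b)"

lemma three_cycleE:
  fixes g :: "'n::finite \<Rightarrow> 'n"
  assumes "is_kcycle 3 g"
  obtains x y z where "distinct [x, y, z]" "g = cyc [x, y, z]"
  using assms by (auto simp: is_kcycle_iff numeral_3_eq_3 length_Suc_conv)

lemma three_cycle_no_2orbit:
  fixes g :: "'n::finite \<Rightarrow> 'n"
  assumes "is_kcycle 3 g" "g (g p) = p"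
  shows "g p = p"
proof -
  obtain x y z where "distinct [x, y, z]" "g = cyc [x, y, z]"
    using assms(1) by (rule three_cycleE)
  then show ?thesis using assms(2) by (auto simp: cyc_simps split: if_splits)
qed

lemma is_kcycle_permutes: "is_kcycle k (g :: 'n \<Rightarrow> 'n) \<Longrightarrow> g permutes UNIV"
  by (simp add: is_kcycle_def)

text \<open>A 3-cycle has no 2-orbit, so the two signed branches of the definition exclude each
  other on moved points. At a fixed point p = q both indicators are 1 and cancel.\<close>

lemma tri_basis_eq:
  fixes g :: "'n::finite \<Rightarrow> 'n"
  assumes "is_kcycle 3 g"
  shows "triL_basis a b g p q = (of_bool (q = g p) - of_bool (p = g q)) *s tri_vec a b g"
    and "triC_basis c g p q = (of_bool (q = g p) - of_bool (p = g q)) * c"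
proof -
  have inj: "g x = g y \<longleftrightarrow> x = y" for x y
    using permutes_inj[OF is_kcycle_permutes[OF assms]] by (simp add: inj_eq)
  note * = three_cycle_no_2orbit[OF assms]
  show "triL_basis a b g p q = (of_bool (q = g p) - of_bool (p = g q)) *s tri_vec a b g"
    using *[of p] *[of q] by (auto simp: triL_basis_def tri_vec_def Let_def vec_eq_iff inj)
  show "triC_basis c g p q = (of_bool (q = g p) - of_bool (p = g q)) * c"
    using *[of p] *[of q] by (auto simp: triC_basis_def Let_def inj)
qed

lemma sum_form_delta:
  fixes h :: "'n::finite \<Rightarrow> 'n" and v w :: "complex^'n"
  shows "(\<Sum>p\<in>UNIV. \<Sum>q\<in>UNIV. v $ p * w $ q * of_bool (q = h p)) = (\<Sum>p\<in>UNIV. v $ p * w $ (h p))"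
    and "(\<Sum>p\<in>UNIV. \<Sum>q\<in>UNIV. v $ p * w $ q * of_bool (p = h q)) = (\<Sum>p\<in>UNIV. v $ (h p) * w $ p)"
proof -
  show "(\<Sum>p\<in>UNIV. \<Sum>q\<in>UNIV. v $ p * w $ q * of_bool (q = h p)) = (\<Sum>p\<in>UNIV. v $ p * w $ (h p))"
    by (simp add: of_bool_def if_distrib cong: if_cong)
  show "(\<Sum>p\<in>UNIV. \<Sum>q\<in>UNIV. v $ p * w $ q * of_bool (p = h q)) = (\<Sum>p\<in>UNIV. v $ (h p) * w $ p)"
    by (subst sum.swap) (simp add: of_bool_def if_distrib cong: if_cong)
qed

lemma tri_form_double_sum:
  "tri_form g v w = (\<Sum>p\<in>UNIV. \<Sum>q\<in>UNIV. v $ p * w $ q * (of_bool (q = g p) - of_bool (p = g q)))"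
  unfolding right_diff_distrib sum_subtractf sum_form_delta
  by (simp add: tri_form_def sum_subtractf)

lemma kappaL_tri_eq:
  "kappaL_tri a b g v w = (if is_kcycle 3 g then tri_form g v w *s tri_vec a b g else 0)"
proof (cases "is_kcycle 3 g")
  case True
  then show ?thesis
    by (simp add: kappaL_tri_def tri_form_double_sum tri_basis_eq vec_eq_iff sum_component
        sum_distrib_right mult.assoc left_diff_distrib right_diff_distrib)
qed (simp add: kappaL_tri_def)

lemma kappaC_tri_eq:
  "kappaC_tri c g v w = (if is_kcycle 3 g then c * tri_form g v w else 0)"
  by (simp add: kappaC_tri_def tri_form_double_sum tri_basis_eq sum_distrib_left mult_ac)

lemma penta_form_double_sum:
  "penta_form g v w = (\<Sum>p\<in>UNIV. \<Sum>q\<in>UNIV. v $ p * w $ q *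
     (perm_mat g p q - perm_mat g q p - 2 * perm_mat (g \<circ> g) p q + 2 * perm_mat (g \<circ> g) q p))"
proof -
  have eq: "v $ p * w $ q *
     (perm_mat g p q - perm_mat g q p - 2 * perm_mat (g \<circ> g) p q + 2 * perm_mat (g \<circ> g) q p) =
     v $ p * w $ q * of_bool (p = g q) - v $ p * w $ q * of_bool (q = g p)
     - 2 * (v $ p * w $ q * of_bool (p = g (g q))) + 2 * (v $ p * w $ q * of_bool (q = g (g p)))" for p q
    by (simp add: perm_mat_def algebra_simps)
  show ?thesis
    unfolding eq sum_subtractf sum.distrib sum_distrib_left[symmetric] sum_form_delta
    by (simp add: penta_form_def sum_subtractf sum.distrib sum_distrib_left)
qed

lemma kappaC_penta_eq:
  "kappaC_penta a b g v w = (if is_kcycle 5 g then (a - b)^2 * penta_form g v w else 0)"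
  by (simp add: kappaC_penta_def penta_form_double_sum sum_distrib_left mult_ac)

lemma tri_form_linear:
  "tri_form g (u + v) w = tri_form g u w + tri_form g v w"
  "tri_form g w (u + v) = tri_form g w u + tri_form g w v"
  "tri_form g (c *s u) w = c * tri_form g u w"
  "tri_form g w (c *s u) = c * tri_form g w u"
  "tri_form g v v = 0"
  by (simp_all add: tri_form_def algebra_simps sum.distrib sum_subtractf sum_distrib_left)

lemma penta_form_linear:
  "penta_form g (u + v) w = penta_form g u w + penta_form g v w"
  "penta_form g w (u + v) = penta_form g w u + penta_form g w v"
  "penta_form g (c *s u) w = c * penta_form g u w"
  "penta_form g w (c *s u) = c * penta_form g w u"
  "penta_form g v v = 0"
  by (simp_all add: penta_form_def algebra_simps sum.distrib sum_subtractf sum_distrib_left)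

lemma sum_permutes_UNIV:
  fixes h :: "'n::finite \<Rightarrow> 'n"
  assumes "h permutes UNIV"
  shows "(\<Sum>p\<in>UNIV. F (h p)) = (\<Sum>p\<in>UNIV. F p)"
  using sum.permute[OF assms, of F] by (simp add: comp_def)

lemma forms_conj:
  fixes h :: "'n::finite \<Rightarrow> 'n"
  assumes "h permutes UNIV"
  shows "tri_form (h \<circ> g \<circ> inv h) (perm_act h v) (perm_act h w) = tri_form g v w"
    and "penta_form (h \<circ> g \<circ> inv h) (perm_act h v) (perm_act h w) = penta_form g v w"
    and "perm_act h (tri_vec a b g) = tri_vec a b (h \<circ> g \<circ> inv h)"
proof -
  have inv: "inv h (h p) = p" "h (inv h p) = p" for p
    using permutes_inverses[OF assms] by auto
  show "tri_form (h \<circ> g \<circ> inv h) (perm_act h v) (perm_act h w) = tri_form g v w"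
    unfolding tri_form_def
    by (subst sum_permutes_UNIV[OF assms, symmetric]) (simp add: perm_act_def inv)
  show "penta_form (h \<circ> g \<circ> inv h) (perm_act h v) (perm_act h w) = penta_form g v w"
    unfolding penta_form_def
    by (subst sum_permutes_UNIV[OF assms, symmetric]) (simp add: perm_act_def inv)
  have "h (g (inv h l)) = l \<longleftrightarrow> g (inv h l) = inv h l" for l by (metis inv)
  then show "perm_act h (tri_vec a b g) = tri_vec a b (h \<circ> g \<circ> inv h)"
    by (simp add: perm_act_def tri_vec_def vec_eq_iff)
qed

lemma is_kcycle_conj:
  fixes h :: "'n::finite \<Rightarrow> 'n"
  assumes "h permutes UNIV"
  shows "is_kcycle k (h \<circ> g \<circ> inv h) \<longleftrightarrow> is_kcycle k g"
proof -
  \<comment> \<open>One implication for arbitrary \<open>g\<close> and \<open>h\<close>; the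
    converse is its instance for \<open>inv h\<close> and the conjugate.\<close>
  have *: "is_kcycle k (h \<circ> g \<circ> inv h)" if h: "h permutes UNIV" and k: "is_kcycle k g" for g h :: "'n \<Rightarrow> 'n"
  proof -
    from k obtain xs where xs: "length xs = k" "distinct xs"
      "\<forall>i<k. g (xs ! i) = xs ! ((i + 1) mod k)" "\<forall>l. l \<notin> set xs \<longrightarrow> g l = l"
      unfolding is_kcycle_def by blast
    have "(h \<circ> g \<circ> inv h) permutes UNIV"
      using h is_kcycle_permutes[OF k] by (intro permutes_compose permutes_inv)
    moreover have "distinct (map h xs)" using xs(2) permutes_inj_on[OF h] by (simp add: distinct_map)
    moreover have "\<forall>i<k. (h \<circ> g \<circ> inv h) (map h xs ! i) = map h xs ! ((i + 1) mod k)"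
    proof (intro allI impI)
      fix i assume "i < k"
      moreover from this have "(i + 1) mod k < k" by (intro mod_less_divisor) simp
      ultimately show "(h \<circ> g \<circ> inv h) (map h xs ! i) = map h xs ! ((i + 1) mod k)"
        using xs by (simp add: permutes_inverses[OF h])
    qed
    moreover have "\<forall>l. l \<notin> set (map h xs) \<longrightarrow> (h \<circ> g \<circ> inv h) l = l"
    proof (intro allI impI)
      fix l assume "l \<notin> set (map h xs)"
      then have "inv h l \<notin> set xs" using permutes_inverses(1)[OF h, of l] by (metis image_eqI list.set_map)
      then show "(h \<circ> g \<circ> inv h) l = l" using xs by (simp add: permutes_inverses[OF h])
    qed
    ultimately show ?thesis unfolding is_kcycle_def using xs(1) by (metis length_map)
  qed
  have "inv h \<circ> (h \<circ> g \<circ> inv h) \<circ> inv (inv h) = g"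
    by (rule ext) (simp add: permutes_inv_inv[OF assms] permutes_inverses[OF assms])
  then show ?thesis using *[OF assms, of g] *[OF permutes_inv[OF assms], of "h \<circ> g \<circ> inv h"] by auto
qed

lemma perm_act_tri_vec: "g permutes UNIV \<Longrightarrow> perm_act g (tri_vec a b g) = tri_vec a b g"
  using forms_conj(3)[of g a b g] by (simp add: comp_assoc permutes_inv_o)

lemma tri_form_cyc:
  assumes "distinct [x, y, z]"
  shows "tri_form (cyc [x, y, z]) v w =
    v $ x * w $ y - v $ y * w $ x + (v $ y * w $ z - v $ z * w $ y) + (v $ z * w $ x - v $ x * w $ z)"
proof -
  have "tri_form (cyc [x, y, z]) v w = (\<Sum>p\<in>{x, y, z}. v $ p * w $ (cyc [x, y, z] p) - v $ (cyc [x, y, z] p) * w $ p)"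
    unfolding tri_form_def by (rule sum.mono_neutral_right) (auto simp: cyc_notin)
  moreover have "y \<noteq> x" "z \<noteq> x" "z \<noteq> y" using assms by auto
  ultimately show ?thesis using assms by (simp add: cyc_simps)
qed

lemma penta_form_cyc:
  assumes "distinct [a, b, c, d, e]" "distinct [e, d, c, b, a]"
  shows "penta_form (cyc [a, b, c, d, e]) v w =
    2 * ((v $ a * w $ c - v $ c * w $ a) + (v $ b * w $ d - v $ d * w $ b) + (v $ c * w $ e - v $ e * w $ c) +
      (v $ d * w $ a - v $ a * w $ d) + (v $ e * w $ b - v $ b * w $ e)) -
    ((v $ a * w $ b - v $ b * w $ a) + (v $ b * w $ c - v $ c * w $ b) + (v $ c * w $ d - v $ d * w $ c) +
      (v $ d * w $ e - v $ e * w $ d) + (v $ e * w $ a - v $ a * w $ e))"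
proof -
  let ?g = "cyc [a, b, c, d, e]"
  have "penta_form ?g v w = (\<Sum>p\<in>{a, b, c, d, e}. v $ (?g p) * w $ p - v $ p * w $ (?g p)
     - 2 * (v $ (?g (?g p)) * w $ p) + 2 * (v $ p * w $ (?g (?g p))))"
    unfolding penta_form_def by (rule sum.mono_neutral_right) (auto simp: cyc_notin)
  then show ?thesis using assms by (simp add: cyc_simps algebra_simps)
qed

text \<open>For g = (x y z) the form is the wedge of the two coordinate differences x - z and y - z.
  Every coordinate of \<open>perm_act g a - a\<close> is a combination of these differences, so its
  wedge with the form is 0.\<close>

lemma tri_form_cocycle:
  fixes g :: "'n::finite \<Rightarrow> 'n"
  assumes "is_kcycle 3 g"
  shows "cyc_sum (\<lambda>a b c. tri_form g b c *s (perm_act g a - a)) v1 v2 v3 = 0"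
proof -
  obtain x y z where d: "distinct [x, y, z]" and g: "g = cyc [x, y, z]"
    using assms by (rule three_cycleE)
  note inv = permutes_inv_eq[OF is_kcycle_permutes[OF assms]]
  have i: "inv g x = z" "inv g y = x" "inv g z = y" "l \<notin> {x, y, z} \<Longrightarrow> inv g l = l" for l
    unfolding inv using d by (auto simp: g cyc_simps)
  show ?thesis
  proof (subst vec_eq_iff, rule allI)
    fix l
    consider "l = x" | "l = y" | "l = z" | "l \<notin> {x, y, z}" by blast
    then show "cyc_sum (\<lambda>a b c. tri_form g b c *s (perm_act g a - a)) v1 v2 v3 $ l = 0 $ l"
      unfolding cyc_sum_def g tri_form_cyc[OF d]
      unfolding g[symmetric]
      by cases (simp_all add: perm_act_def i algebra_simps)
  qed
qed

section \<open>Reduction of factorization sums to sums over tuples\<close>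

text \<open>The constraint \<open>x \<circ> y = g\<close> becomes an indicator, so that
  \<open>x\<close> and \<open>y\<close> range freely over cycles. Then \<open>x\<close> with the
  common point \<open>z\<close> unfolds to a tuple and \<open>y\<close> to the two points that
  follow \<open>z\<close>.\<close>

lemma sum_fact_pairs_cycles:
  fixes G :: "('n::finite \<Rightarrow> 'n) \<Rightarrow> ('n \<Rightarrow> 'n) \<Rightarrow> 'n \<Rightarrow> complex"
  assumes "k \<ge> 2"
  shows "(\<Sum>(x, y)\<in>fact_pairs g. if is_kcycle k x \<and> is_kcycle 3 y
      then \<Sum>z | x z \<noteq> z \<and> y z \<noteq> z. G x y z else 0) =
    (\<Sum>ts\<in>dlists k. \<Sum>b\<in>- {ts ! 0}. \<Sum>c\<in>- {ts ! 0, b}.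
      of_bool (cyc ts \<circ> cyc [ts ! 0, b, c] = g) * G (cyc ts) (cyc [ts ! 0, b, c]) (ts ! 0))"
proof -
  let ?K = "\<lambda>k. {x :: 'n \<Rightarrow> 'n. is_kcycle k x}"
  have "(\<Sum>(x, y)\<in>fact_pairs g. if is_kcycle k x \<and> is_kcycle 3 y
      then \<Sum>z | x z \<noteq> z \<and> y z \<noteq> z. G x y z else 0) =
    (\<Sum>(x, y)\<in>?K k \<times> ?K 3. of_bool (x \<circ> y = g) * (\<Sum>z | x z \<noteq> z \<and> y z \<noteq> z. G x y z))"
    by (rule sum.mono_neutral_cong)
      (auto simp: fact_pairs_def is_kcycle_permutes split: if_splits)
  also have "\<dots> = (\<Sum>x\<in>?K k. \<Sum>y\<in>?K 3. \<Sum>z | x z \<noteq> z. of_bool (y z \<noteq> z) * (of_bool (x \<circ> y = g) * G x y z))"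
    unfolding sum.cartesian_product[symmetric]
    unfolding sum_distrib_left by (intro sum.cong refl sum.mono_neutral_cong_left) auto
  also have "\<dots> = (\<Sum>x\<in>?K k. \<Sum>z | x z \<noteq> z. \<Sum>y\<in>?K 3. of_bool (y z \<noteq> z) * (of_bool (x \<circ> y = g) * G x y z))"
    by (intro sum.cong refl sum.swap)
  also have "\<dots> = (\<Sum>x\<in>?K k. \<Sum>z | x z \<noteq> z. \<Sum>y | is_kcycle 3 y \<and> y z \<noteq> z. of_bool (x \<circ> y = g) * G x y z)"
    by (intro sum.cong refl sum.mono_neutral_cong_right) auto
  also have "\<dots> = (\<Sum>ts\<in>dlists k. \<Sum>y | is_kcycle 3 y \<and> y (ts ! 0) \<noteq> ts ! 0.
      of_bool (cyc ts \<circ> y = g) * G (cyc ts) y (ts ! 0))"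
    by (rule sum_kcycles[OF assms])
  finally show ?thesis by (simp only: sum_3cycles_at)
qed

lemma cyc_sum_mult: "cyc_sum (\<lambda>a b c. k * F a b c) x y z = k * cyc_sum F x y z"
  for k :: complex
  by (simp add: cyc_sum_def algebra_simps)

lemma cyc_sum_sum:
  "cyc_sum (\<lambda>a b c. \<Sum>i\<in>S. F i a b c) x y z = (\<Sum>i\<in>S. cyc_sum (F i) x y z)"
  by (simp add: cyc_sum_def sum.distrib)

text \<open>By \<open>tri_form_cocycle\<close> a functional cannot distinguish \<open>y a\<close> from \<open>a\<close> in the cyclic sum.\<close>
lemma tri_form_double:
  fixes \<phi> :: "complex^'n::finite \<Rightarrow> complex"
  assumes y: "is_kcycle 3 y" and lin: "\<And>u v. \<phi> (u + v) = \<phi> u + \<phi> v" "\<And>c u. \<phi> (c *s u) = c * \<phi> u"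
  shows "cyc_sum (\<lambda>a b c. tri_form y b c * \<phi> (a + perm_act y a)) v1 v2 v3 =
    2 * cyc_sum (\<lambda>a b c. tri_form y b c * \<phi> a) v1 v2 v3"
proof -
  have diff: "\<phi> (u - v) = \<phi> u - \<phi> v" for u v
    using lin(1)[of "u - v" v] by simp
  have "\<phi> (cyc_sum (\<lambda>a b c. tri_form y b c *s (perm_act y a - a)) v1 v2 v3) = 0"
    using tri_form_cocycle[OF y, of v1 v2 v3] lin(2)[of 0 0] by simp
  then show ?thesis by (simp add: cyc_sum_def lin diff algebra_simps)
qed

text \<open>Common core of the three brackets: \<open>D\<close> is the contraction of the form of
  \<open>x\<close> and \<open>w\<close> a weight. The factor 2 comes from
  \<open>tri_form_double\<close>. As the coefficients of \<open>D\<close> sum to zero, only the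
  excess \<alpha> - \<beta> of the vector of \<open>y\<close> on the points it moves counts.\<close>

lemma sum_fact_pairs_reduce:
  fixes D :: "('n::finite \<Rightarrow> 'n) \<Rightarrow> complex^'n \<Rightarrow> 'n \<Rightarrow> complex"
  assumes k: "k \<ge> 2"
    and lin: "\<And>x u v z. D x (u + v) z = D x u z + D x v z" "\<And>x c u z. D x (c *s u) z = c * D x u z"
    and tot: "\<And>x u. is_kcycle k x \<Longrightarrow> (\<Sum>z\<in>UNIV. D x u z) = 0"
    and fixed: "\<And>x u z. is_kcycle k x \<Longrightarrow> x z = z \<Longrightarrow> D x u z = 0"
  shows "cyc_sum (\<lambda>a b c. \<Sum>(x, y)\<in>fact_pairs g. if is_kcycle k x \<and> is_kcycle 3 y
      then w x * (tri_form y b c * (\<Sum>z\<in>UNIV. D x (a + perm_act y a) z * tri_vec \<alpha> \<beta> y $ z)) else 0) v1 v2 v3 =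
    2 * (\<alpha> - \<beta>) * (\<Sum>ts\<in>dlists k. \<Sum>i\<in>- {ts ! 0}. \<Sum>j\<in>- {ts ! 0, i}.
      of_bool (cyc ts \<circ> cyc [ts ! 0, i, j] = g) * (w (cyc ts) *
        cyc_sum (\<lambda>a b c. tri_form (cyc [ts ! 0, i, j]) b c * D (cyc ts) a (ts ! 0)) v1 v2 v3))"
    (is "?L = _")
proof -
  have D: "(\<Sum>z\<in>UNIV. D x a z * tri_vec \<alpha> \<beta> y $ z) = (\<alpha> - \<beta>) * (\<Sum>z | x z \<noteq> z \<and> y z \<noteq> z. D x a z)"
    if "is_kcycle k x" for x y :: "'n \<Rightarrow> 'n" and a
  proof -
    have "(\<Sum>z\<in>UNIV. D x a z * tri_vec \<alpha> \<beta> y $ z) =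
        (\<Sum>z\<in>UNIV. \<beta> * D x a z + (\<alpha> - \<beta>) * (if y z \<noteq> z then D x a z else 0))"
      by (rule sum.cong) (auto simp: tri_vec_def algebra_simps)
    also have "\<dots> = (\<alpha> - \<beta>) * (\<Sum>z\<in>UNIV. if y z \<noteq> z then D x a z else 0)"
      using tot[OF that] by (simp add: sum.distrib sum_distrib_left[symmetric])
    also have "(\<Sum>z\<in>UNIV. if y z \<noteq> z then D x a z else 0) = (\<Sum>z | x z \<noteq> z \<and> y z \<noteq> z. D x a z)"
      by (rule sum.mono_neutral_cong_right) (use fixed[OF that] in auto)
    finally show ?thesis .
  qed
  have "?L = (\<Sum>(x, y)\<in>fact_pairs g. if is_kcycle k x \<and> is_kcycle 3 y
      then \<Sum>z | x z \<noteq> z \<and> y z \<noteq> z. 2 * (\<alpha> - \<beta>) *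
        (w x * cyc_sum (\<lambda>a b c. tri_form y b c * D x a z) v1 v2 v3) else 0)"
    unfolding cyc_sum_sum
  proof (rule sum.cong[OF refl], clarify)
    fix x y :: "'n \<Rightarrow> 'n"
    show "cyc_sum (\<lambda>a b c. if is_kcycle k x \<and> is_kcycle 3 y
      then w x * (tri_form y b c * (\<Sum>z\<in>UNIV. D x (a + perm_act y a) z * tri_vec \<alpha> \<beta> y $ z)) else 0) v1 v2 v3 =
      (if is_kcycle k x \<and> is_kcycle 3 y then \<Sum>z | x z \<noteq> z \<and> y z \<noteq> z. 2 * (\<alpha> - \<beta>) *
        (w x * cyc_sum (\<lambda>a b c. tri_form y b c * D x a z) v1 v2 v3) else 0)"
    proof (cases "is_kcycle k x \<and> is_kcycle 3 y")
      case True
      let ?\<phi> = "\<lambda>u. \<Sum>z\<in>UNIV. D x u z * tri_vec \<alpha> \<beta> y $ z"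
      have "cyc_sum (\<lambda>a b c. tri_form y b c * ?\<phi> (a + perm_act y a)) v1 v2 v3 =
          2 * cyc_sum (\<lambda>a b c. tri_form y b c * ?\<phi> a) v1 v2 v3"
        by (rule tri_form_double)
          (use True in \<open>simp_all add: lin algebra_simps sum.distrib sum_distrib_left\<close>)
      also have "\<dots> = 2 * (\<alpha> - \<beta>) * (\<Sum>z | x z \<noteq> z \<and> y z \<noteq> z. cyc_sum (\<lambda>a b c. tri_form y b c * D x a z) v1 v2 v3)"
        using True by (simp add: D cyc_sum_def sum.distrib sum_distrib_left algebra_simps)
      finally have "cyc_sum (\<lambda>a b c. tri_form y b c * ?\<phi> (a + perm_act y a)) v1 v2 v3 = \<dots>" .
      then show ?thesis
        using True by (simp add: cyc_sum_mult sum_distrib_left[symmetric] mult_ac)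
    next
      case False
      then show ?thesis by (auto simp: cyc_sum_def)
    qed
  qed
  also have "\<dots> = 2 * (\<alpha> - \<beta>) * (\<Sum>ts\<in>dlists k. \<Sum>i\<in>- {ts ! 0}. \<Sum>j\<in>- {ts ! 0, i}.
      of_bool (cyc ts \<circ> cyc [ts ! 0, i, j] = g) * (w (cyc ts) *
        cyc_sum (\<lambda>a b c. tri_form (cyc [ts ! 0, i, j]) b c * D (cyc ts) a (ts ! 0)) v1 v2 v3))"
    unfolding sum_fact_pairs_cycles[OF k] by (simp add: sum_distrib_left mult_ac)
  finally show ?thesis .
qed

section \<open>The brackets\<close>

text \<open>For a permutation \<open>x\<close>, the coefficient of \<open>X $ z\<close> in
  \<open>tri_form x u X\<close>; \<open>penta_diff\<close> plays the same part for
  \<open>penta_form\<close>. Both facts are in \<open>form_diff\<close>.\<close>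

definition tri_diff :: "('n::finite \<Rightarrow> 'n) \<Rightarrow> complex^'n \<Rightarrow> 'n \<Rightarrow> complex" where
  "tri_diff x u z = u $ (inv x z) - u $ (x z)"

definition penta_diff :: "('n::finite \<Rightarrow> 'n) \<Rightarrow> complex^'n \<Rightarrow> 'n \<Rightarrow> complex" where
  "penta_diff x u z = u $ (x z) - u $ (inv x z) - 2 * u $ (x (x z)) + 2 * u $ (inv x (inv x z))"

lemma form_diff:
  fixes x :: "'n::finite \<Rightarrow> 'n"
  assumes "x permutes UNIV"
  shows "tri_form x u X = (\<Sum>z\<in>UNIV. tri_diff x u z * X $ z)"
    and "penta_form x u X = (\<Sum>z\<in>UNIV. penta_diff x u z * X $ z)"
    and "(\<Sum>z\<in>UNIV. tri_diff x u z) = 0"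
    and "(\<Sum>z\<in>UNIV. penta_diff x u z) = 0"
proof -
  note inv = permutes_inverses[OF assms] and shift = sum_permutes_UNIV[OF assms]
  have a: "(\<Sum>p\<in>UNIV. u $ p * X $ (x p)) = (\<Sum>z\<in>UNIV. u $ (inv x z) * X $ z)" for X
    using shift[of "\<lambda>z. u $ (inv x z) * X $ z"] by (simp add: inv)
  have b: "(\<Sum>p\<in>UNIV. u $ p * X $ (x (x p))) = (\<Sum>z\<in>UNIV. u $ (inv x (inv x z)) * X $ z)" for X
    using shift[of "\<lambda>z. u $ (inv x z) * X $ (x z)"] shift[of "\<lambda>z. u $ (inv x (inv x z)) * X $ z"]
    by (simp add: inv)
  show "tri_form x u X = (\<Sum>z\<in>UNIV. tri_diff x u z * X $ z)"
    by (simp add: tri_form_def tri_diff_def sum_subtractf left_diff_distrib a)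
  show "penta_form x u X = (\<Sum>z\<in>UNIV. penta_diff x u z * X $ z)"
    by (simp add: penta_form_def penta_diff_def sum_subtractf sum.distrib left_diff_distrib
        distrib_right mult.assoc sum_distrib_left[symmetric] a b)
  have c: "(\<Sum>z\<in>UNIV. u $ (x z)) = (\<Sum>z\<in>UNIV. u $ z)" "(\<Sum>z\<in>UNIV. u $ (x (x z))) = (\<Sum>z\<in>UNIV. u $ z)"
    "(\<Sum>z\<in>UNIV. u $ (inv x z)) = (\<Sum>z\<in>UNIV. u $ z)"
    "(\<Sum>z\<in>UNIV. u $ (inv x (inv x z))) = (\<Sum>z\<in>UNIV. u $ z)"
    using shift[of "\<lambda>z. u $ z"] shift[of "\<lambda>z. u $ (x z)"] shift[of "\<lambda>z. u $ (inv x z)"]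
      shift[of "\<lambda>z. u $ (inv x (inv x z))"]
    by (simp_all add: inv)
  show "(\<Sum>z\<in>UNIV. tri_diff x u z) = 0" "(\<Sum>z\<in>UNIV. penta_diff x u z) = 0"
    by (simp_all add: tri_diff_def penta_diff_def sum_subtractf sum.distrib sum_distrib_left[symmetric] c)
qed

lemma diff_fixed:
  fixes x :: "'n::finite \<Rightarrow> 'n"
  assumes "x permutes UNIV" "x z = z"
  shows "tri_diff x u z = 0" "penta_diff x u z = 0"
proof -
  have "inv x z = z" using assms by (metis permutes_inv_eq)
  then show "tri_diff x u z = 0" "penta_diff x u z = 0"
    using assms(2) by (simp_all add: tri_diff_def penta_diff_def)
qed

lemma diff_linear:
  "tri_diff x (u + v) z = tri_diff x u z + tri_diff x v z"
  "tri_diff x (c *s u) z = c * tri_diff x u z"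
  "penta_diff x (u + v) z = penta_diff x u z + penta_diff x v z"
  "penta_diff x (c *s u) z = c * penta_diff x u z"
  by (simp_all add: tri_diff_def penta_diff_def algebra_simps)

lemma diff_cyc:
  "distinct [z, a, b] \<Longrightarrow> tri_diff (cyc [z, a, b :: 'n::finite]) u z = u $ b - u $ a"
  "distinct [z, a, b, c, d] \<Longrightarrow> penta_diff (cyc [z, a, b, c, d :: 'n]) u z =
    u $ a - u $ d + 2 * u $ c - 2 * u $ b"
proof -
  assume d: "distinct [z, a, b]"
  have "inv (cyc [z, a, b]) z = b"
    unfolding permutes_inv_eq[OF cyc_permutes[OF d]] using d by (auto simp: cyc_simps)
  then show "tri_diff (cyc [z, a, b]) u z = u $ b - u $ a"
    by (simp add: tri_diff_def cyc_simps)
next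
  assume d: "distinct [z, a, b, c, d]"
  have "inv (cyc [z, a, b, c, d]) z = d" "inv (cyc [z, a, b, c, d]) d = c"
    unfolding permutes_inv_eq[OF cyc_permutes[OF d]] using d by (auto simp: cyc_simps)
  moreover have "cyc [z, a, b, c, d] (cyc [z, a, b, c, d] z) = b" using d by (auto simp: cyc_simps)
  ultimately show "penta_diff (cyc [z, a, b, c, d]) u z = u $ a - u $ d + 2 * u $ c - 2 * u $ b"
    by (simp add: penta_diff_def cyc_simps)
qed

text \<open>The 3 by 3 minor of the vectors in the coordinates i, j, k, that is, the wedge of three
  coordinate functionals evaluated at them.\<close>

definition det3 :: "complex^'n \<Rightarrow> complex^'n \<Rightarrow> complex^'n \<Rightarrow> 'n \<Rightarrow> 'n \<Rightarrow> 'n \<Rightarrow> complex" where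
  "det3 v1 v2 v3 i j k = cyc_sum (\<lambda>a b c. (b $ i * c $ j - b $ j * c $ i) * a $ k) v1 v2 v3"

lemma alternating3_det3: "alternating3 (det3 v1 v2 v3)"
  unfolding alternating3_def det3_def cyc_sum_def by (auto simp: algebra_simps)

lemma cyc_sum_tri_tri:
  assumes "distinct [z, a1, a2]" "distinct [z, b1, b2 :: 'n::finite]"
  shows "cyc_sum (\<lambda>a b c. tri_form (cyc [z, b1, b2]) b c * tri_diff (cyc [z, a1, a2]) a z) v1 v2 v3 =
    tri_tri_term (det3 v1 v2 v3) z a1 a2 b1 b2"
  unfolding tri_form_cyc[OF assms(2)] diff_cyc(1)[OF assms(1)] tri_tri_term_def det3_def cyc_sum_def
  by (simp add: algebra_simps)

lemma cyc_sum_penta_tri: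
  assumes "distinct [z, a1, a2, a3, a4]" "distinct [z, b1, b2 :: 'n::finite]"
  shows "cyc_sum (\<lambda>a b c. tri_form (cyc [z, b1, b2]) b c * penta_diff (cyc [z, a1, a2, a3, a4]) a z) v1 v2 v3 =
    penta_tri_term (det3 v1 v2 v3) z a1 a2 a3 a4 b1 b2"
  unfolding tri_form_cyc[OF assms(2)] diff_cyc(2)[OF assms(1)] penta_tri_term_def det3_def cyc_sum_def
  by (simp add: algebra_simps)

text \<open>A 5-cycle arises from five tuples, one for each starting point, counted here as its
  moved points.\<close>

lemma class_sum_5_cycles:
  fixes g :: "'n::finite \<Rightarrow> 'n"
  assumes "\<And>ts. ts \<in> dlists 5 \<Longrightarrow> cyc ts = g \<Longrightarrow> \<phi> ts = R"
  shows "class_sum 5 cyc g \<phi> = (if is_kcycle 5 g then 5 * R else 0)"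
proof -
  have "class_sum 5 cyc g \<phi> = (\<Sum>ts\<in>dlists 5. of_bool (cyc ts = g) * R)"
    unfolding class_sum_def by (rule sum.cong) (auto simp: assms)
  also have "\<dots> = (\<Sum>x | is_kcycle 5 x. \<Sum>z | x z \<noteq> z. of_bool (x = g) * R)"
    by (rule sum_kcycles[symmetric]) simp
  also have "\<dots> = (\<Sum>x | is_kcycle 5 x. if x = g then of_nat (card {z. x z \<noteq> z}) * R else 0)"
    by (rule sum.cong) auto
  also have "\<dots> = (if is_kcycle 5 g then of_nat (card {z. g z \<noteq> z}) * R else 0)"
    by simp
  also have "\<dots> = (if is_kcycle 5 g then 5 * R else 0)"
  proof -
    have "card {z. g z \<noteq> z} = 5" if k: "is_kcycle 5 g"
    proof -
      obtain ts where ts: "ts \<in> dlists 5" "g = cyc ts"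
        using k by (auto simp: is_kcycle_iff dlists_def)
      have "cyc ts z \<noteq> z" if "z \<in> set ts" for z
        using ts(1) that by (elim dlists_cases[where P = "\<lambda>ts. z \<in> set ts \<longrightarrow> cyc ts z \<noteq> z", rule_format])
          (auto simp: cyc_simps)
      then have "{z. g z \<noteq> z} = set ts" using ts cyc_notin[of _ ts] by auto
      then show ?thesis using ts by (simp add: dlists_def distinct_card)
    qed
    then show ?thesis by simp
  qed
  finally show ?thesis .
qed

text \<open>The sum runs over the five arrows of the cycle, each carrying the coordinate at its
  source to its target; this is the shape of \<open>penta_boundary\<close>.\<close>

lemma perm_act_cyc5:
  assumes "ts \<in> dlists 5"
  shows "(perm_act (cyc ts) a - a) $ l = (\<Sum>(i, j) \<leftarrow> [(0, 1), (1, 2), (2, 3), (3, 4), (4, 0)].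
    a $ (ts ! i) * (of_bool (ts ! j = l) - of_bool (ts ! i = (l :: 'n::finite))))"
  using assms
proof (rule dlists_cases)
  fix p q r s t :: 'n
  assume d: "distinct [p, q, r, s, t]" "distinct [t, s, r, q, p]"
  note inv = permutes_inv_eq[OF cyc_permutes[OF d(1)]]
  have i: "inv (cyc [p, q, r, s, t]) p = t" "inv (cyc [p, q, r, s, t]) q = p"
    "inv (cyc [p, q, r, s, t]) r = q" "inv (cyc [p, q, r, s, t]) s = r"
    "inv (cyc [p, q, r, s, t]) t = s"
    "l \<notin> {p, q, r, s, t} \<Longrightarrow> inv (cyc [p, q, r, s, t]) l = l" for l
    unfolding inv using d by (simp_all add: cyc_simps)
  consider "l = p" | "l = q" | "l = r" | "l = s" | "l = t" |
    "l \<notin> {p, q, r, s, t}" "p \<noteq> l" "q \<noteq> l" "r \<noteq> l" "s \<noteq> l" "t \<noteq> l" by blast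
  then show "(perm_act (cyc [p, q, r, s, t]) a - a) $ l =
    (\<Sum>(i, j) \<leftarrow> [(0, 1), (1, 2), (2, 3), (3, 4), (4, 0)].
      a $ ([p, q, r, s, t] ! i) * (of_bool ([p, q, r, s, t] ! j = l) - of_bool ([p, q, r, s, t] ! i = l)))"
    by cases (use d in \<open>simp_all add: perm_act_def i\<close>)
qed

lemma penta_boundary_eq:
  assumes "ts \<in> dlists 5"
  shows "penta_boundary (det3 v1 v2 v3) (\<lambda>p. of_bool (p = l)) ts =
    cyc_sum (\<lambda>a b c. penta_form (cyc ts) b c * (perm_act (cyc ts) a - a) $ (l :: 'n::finite)) v1 v2 v3"
proof -
  let ?F = "\<lambda>k. cyc_sum (\<lambda>a b c. penta_form (cyc ts) b c * a $ k) v1 v2 v3"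
  let ?\<delta> = "\<lambda>i j k. det3 v1 v2 v3 (ts ! i) (ts ! j) k"
  have F: "?F k = 2 * (?\<delta> 0 2 k + ?\<delta> 1 3 k + ?\<delta> 2 4 k + ?\<delta> 3 0 k + ?\<delta> 4 1 k)
      - (?\<delta> 0 1 k + ?\<delta> 1 2 k + ?\<delta> 2 3 k + ?\<delta> 3 4 k + ?\<delta> 4 0 k)" for k
    using assms
  proof (rule dlists_cases)
    fix p q r s t :: 'n
    assume d: "distinct [p, q, r, s, t]" "distinct [t, s, r, q, p]"
    let ?ts = "[p, q, r, s, t]" and ?d = "det3 v1 v2 v3"
    have "cyc_sum (\<lambda>a b c. penta_form (cyc ?ts) b c * a $ k) v1 v2 v3 =
      2 * (?d p r k + ?d q s k + ?d r t k + ?d s p k + ?d t q k)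
      - (?d p q k + ?d q r k + ?d r s k + ?d s t k + ?d t p k)"
      unfolding penta_form_cyc[OF d] det3_def cyc_sum_def by (simp add: algebra_simps)
    then show "cyc_sum (\<lambda>a b c. penta_form (cyc ?ts) b c * a $ k) v1 v2 v3 =
      2 * (?d (?ts ! 0) (?ts ! 2) k + ?d (?ts ! 1) (?ts ! 3) k + ?d (?ts ! 2) (?ts ! 4) k +
        ?d (?ts ! 3) (?ts ! 0) k + ?d (?ts ! 4) (?ts ! 1) k)
      - (?d (?ts ! 0) (?ts ! 1) k + ?d (?ts ! 1) (?ts ! 2) k + ?d (?ts ! 2) (?ts ! 3) k +
        ?d (?ts ! 3) (?ts ! 4) k + ?d (?ts ! 4) (?ts ! 0) k)"
      by simp
  qed
  have "penta_boundary (det3 v1 v2 v3) (\<lambda>p. of_bool (p = l)) ts =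
    (\<Sum>(i, j) \<leftarrow> [(0, 1), (1, 2), (2, 3), (3, 4), (4, 0)].
      ?F (ts ! i) * (of_bool (ts ! j = l) - of_bool (ts ! i = l)))"
    unfolding penta_boundary_def F ..
  also have "\<dots> = cyc_sum (\<lambda>a b c. penta_form (cyc ts) b c * (perm_act (cyc ts) a - a) $ l) v1 v2 v3"
    unfolding perm_act_cyc5[OF assms] by (simp add: cyc_sum_def algebra_simps)
  finally show ?thesis .
qed

text \<open>Checked one coordinate \<open>l\<close> at a time, the bracket is
  \<open>tri_tri_sum\<close> with \<open>L\<close> the indicator of \<open>l\<close>, hence the
  coboundary of the 5-cycle form. The square of \<open>a - b\<close> arises with one factor from the
  vector of each 3-cycle.\<close>

lemma tri_bracket:
  fixes g :: "'n::finite \<Rightarrow> 'n"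
  shows "cyc_sum (\<lambda>u v w. \<Sum>(x, y)\<in>fact_pairs g.
      kappaL_tri a b x (u + perm_act y u) (kappaL_tri a b y v w)) v1 v2 v3 =
    2 *s cyc_sum (\<lambda>u v w. kappaC_penta a b g v w *s (perm_act g u - u)) v1 v2 v3"
proof (subst vec_eq_iff, rule allI)
  fix l :: 'n
  let ?\<delta> = "det3 v1 v2 v3" and ?L = "\<lambda>p. of_bool (p = l) :: complex"
  let ?R = "cyc_sum (\<lambda>a b c. penta_form g b c * (perm_act g a - a) $ l) v1 v2 v3"
  have "kappaL_tri a b x (u + perm_act y u) (kappaL_tri a b y v w) $ l =
      (if is_kcycle 3 x \<and> is_kcycle 3 y then tri_vec a b x $ l *
        (tri_form y v w * (\<Sum>z\<in>UNIV. tri_diff x (u + perm_act y u) z * tri_vec a b y $ z)) else 0)"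
    for x y :: "'n \<Rightarrow> 'n" and u v w
    \<comment> \<open>The instance at 0 covers those \<open>y\<close> that are not 3-cycles, where
      the second argument is zero.\<close>
    unfolding kappaL_tri_eq using form_diff(1)[OF is_kcycle_permutes, of 3 x "u + perm_act y u"]
      tri_form_linear(4)[of x "u + perm_act y u" 0 0]
    by (auto simp: tri_form_linear(4) simp del: mult_cancel_left mult_cancel_right)
  then have "cyc_sum (\<lambda>u v w. \<Sum>(x, y)\<in>fact_pairs g.
      kappaL_tri a b x (u + perm_act y u) (kappaL_tri a b y v w)) v1 v2 v3 $ l =
    cyc_sum (\<lambda>u v w. \<Sum>(x, y)\<in>fact_pairs g. if is_kcycle 3 x \<and> is_kcycle 3 y then tri_vec a b x $ l *
        (tri_form y v w * (\<Sum>z\<in>UNIV. tri_diff x (u + perm_act y u) z * tri_vec a b y $ z)) else 0) v1 v2 v3"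
    by (simp add: cyc_sum_def sum_component case_prod_unfold)
  also have "\<dots> = 2 * (a - b) * (\<Sum>ts\<in>dlists 3. \<Sum>i\<in>- {ts ! 0}. \<Sum>j\<in>- {ts ! 0, i}.
      of_bool (cyc ts \<circ> cyc [ts ! 0, i, j] = g) * (tri_vec a b (cyc ts) $ l *
        cyc_sum (\<lambda>a b c. tri_form (cyc [ts ! 0, i, j]) b c * tri_diff (cyc ts) a (ts ! 0)) v1 v2 v3))"
    by (rule sum_fact_pairs_reduce) (simp_all add: diff_linear form_diff diff_fixed is_kcycle_permutes)
  also have "(\<Sum>ts\<in>dlists 3. \<Sum>i\<in>- {ts ! 0}. \<Sum>j\<in>- {ts ! 0, i}.
      of_bool (cyc ts \<circ> cyc [ts ! 0, i, j] = g) * (tri_vec a b (cyc ts) $ l *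
        cyc_sum (\<lambda>a b c. tri_form (cyc [ts ! 0, i, j]) b c * tri_diff (cyc ts) a (ts ! 0)) v1 v2 v3)) =
    (\<Sum>ts\<in>dlists 3. \<Sum>i\<in>- {ts ! 0}. \<Sum>j\<in>- {ts ! 0, i}.
      of_bool (cyc ts \<circ> cyc [ts ! 0, i, j] = g) * (tri_tri_term ?\<delta> (ts ! 0) (ts ! 1) (ts ! 2) i j *
        (b + (a - b) * (?L (ts ! 0) + ?L (ts ! 1) + ?L (ts ! 2)))))"
  proof (intro sum.cong refl)
    fix ts :: "'n list" and i j
    assume "ts \<in> dlists 3" and ij: "i \<in> - {ts ! 0}" "j \<in> - {ts ! 0, i}"
    then obtain p q r where ts: "ts = [p, q, r]" "distinct [p, q, r]"
      by (auto simp: dlists_def numeral_3_eq_3 length_Suc_conv)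
    have "tri_vec a b (cyc [p, q, r]) $ l = b + (a - b) * (?L p + ?L q + ?L r)"
      using ts(2) by (auto simp: tri_vec_def cyc_simps)
    moreover have "distinct [p, i, j]" using ij ts by auto
    ultimately show "of_bool (cyc ts \<circ> cyc [ts ! 0, i, j] = g) * (tri_vec a b (cyc ts) $ l *
        cyc_sum (\<lambda>a b c. tri_form (cyc [ts ! 0, i, j]) b c * tri_diff (cyc ts) a (ts ! 0)) v1 v2 v3) =
      of_bool (cyc ts \<circ> cyc [ts ! 0, i, j] = g) * (tri_tri_term ?\<delta> (ts ! 0) (ts ! 1) (ts ! 2) i j *
        (b + (a - b) * (?L (ts ! 0) + ?L (ts ! 1) + ?L (ts ! 2))))"
      using ts cyc_sum_tri_tri[OF ts(2), of i j v1 v2 v3] by simp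
  qed
  \<comment> \<open>\<open>tri_tri_sum\<close> determines five times the sum, and the 5 is divided
    out.\<close>
  also have "2 * (a - b) * \<dots> = 2 * (a - b) * ((a - b) * class_sum 5 cyc g (penta_boundary ?\<delta> ?L) / 5)"
    unfolding tri_tri_sum[OF alternating3_det3, where \<beta> = b, symmetric] by simp
  also have "class_sum 5 cyc g (penta_boundary ?\<delta> ?L) = (if is_kcycle 5 g then 5 * ?R else 0)"
    by (rule class_sum_5_cycles) (auto simp: penta_boundary_eq)
  also have "2 * (a - b) * ((a - b) * (if is_kcycle 5 g then 5 * ?R else 0) / 5) =
    (if is_kcycle 5 g then 2 * ((a - b)^2 * ?R) else 0)"
    by (simp add: power2_eq_square)
  also have "\<dots> = (2 *s cyc_sum (\<lambda>u v w. kappaC_penta a b g v w *s (perm_act g u - u)) v1 v2 v3) $ l"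
    by (simp add: kappaC_penta_eq cyc_sum_def algebra_simps)
  finally show "cyc_sum (\<lambda>u v w. \<Sum>(x, y)\<in>fact_pairs g.
      kappaL_tri a b x (u + perm_act y u) (kappaL_tri a b y v w)) v1 v2 v3 $ l =
    (2 *s cyc_sum (\<lambda>u v w. kappaC_penta a b g v w *s (perm_act g u - u)) v1 v2 v3) $ l" .
qed


text \<open>A constant weight is the case s = 0 of \<open>tri_tri_sum\<close>, where the right-hand
  side vanishes. The weight is spelled \<open>c + 0 * (0 + 0 + 0)\<close> to match that
  lemma.\<close>

lemma tri_const_bracket:
  fixes g :: "'n::finite \<Rightarrow> 'n"
  shows "cyc_sum (\<lambda>u v w. \<Sum>(x, y)\<in>fact_pairs g.
      kappaC_tri c x (u + perm_act y u) (kappaL_tri a b y v w)) v1 v2 v3 = 0"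
proof -
  let ?\<delta> = "det3 v1 v2 v3"
  have "kappaC_tri c x (u + perm_act y u) (kappaL_tri a b y v w) =
      (if is_kcycle 3 x \<and> is_kcycle 3 y then c *
        (tri_form y v w * (\<Sum>z\<in>UNIV. tri_diff x (u + perm_act y u) z * tri_vec a b y $ z)) else 0)"
    for x y :: "'n \<Rightarrow> 'n" and u v w
    unfolding kappaL_tri_eq kappaC_tri_eq
    using form_diff(1)[OF is_kcycle_permutes, of 3 x "u + perm_act y u"]
      tri_form_linear(4)[of x "u + perm_act y u" 0 0]
    by (auto simp: tri_form_linear(4) simp del: mult_cancel_left mult_cancel_right)
  then have "cyc_sum (\<lambda>u v w. \<Sum>(x, y)\<in>fact_pairs g.
      kappaC_tri c x (u + perm_act y u) (kappaL_tri a b y v w)) v1 v2 v3 =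
    cyc_sum (\<lambda>u v w. \<Sum>(x, y)\<in>fact_pairs g. if is_kcycle 3 x \<and> is_kcycle 3 y then c *
        (tri_form y v w * (\<Sum>z\<in>UNIV. tri_diff x (u + perm_act y u) z * tri_vec a b y $ z)) else 0) v1 v2 v3"
    by (simp add: cyc_sum_def)
  also have "\<dots> = 2 * (a - b) * (\<Sum>ts\<in>dlists 3. \<Sum>i\<in>- {ts ! 0}. \<Sum>j\<in>- {ts ! 0, i}.
      of_bool (cyc ts \<circ> cyc [ts ! 0, i, j] = g) * (c *
        cyc_sum (\<lambda>a b c. tri_form (cyc [ts ! 0, i, j]) b c * tri_diff (cyc ts) a (ts ! 0)) v1 v2 v3))"
    by (rule sum_fact_pairs_reduce[where w = "\<lambda>_. c"])
      (simp_all add: diff_linear form_diff diff_fixed is_kcycle_permutes)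
  also have "(\<Sum>ts\<in>dlists 3. \<Sum>i\<in>- {ts ! 0}. \<Sum>j\<in>- {ts ! 0, i}.
      of_bool (cyc ts \<circ> cyc [ts ! 0, i, j] = g) * (c *
        cyc_sum (\<lambda>a b c. tri_form (cyc [ts ! 0, i, j]) b c * tri_diff (cyc ts) a (ts ! 0)) v1 v2 v3)) =
    (\<Sum>ts\<in>dlists 3. \<Sum>i\<in>- {ts ! 0}. \<Sum>j\<in>- {ts ! 0, i}.
      of_bool (cyc ts \<circ> cyc [ts ! 0, i, j] = g) * (tri_tri_term ?\<delta> (ts ! 0) (ts ! 1) (ts ! 2) i j *
        (c + 0 * (0 + 0 + 0))))"
  proof (intro sum.cong refl)
    fix ts :: "'n list" and i j
    assume "ts \<in> dlists 3" and ij: "i \<in> - {ts ! 0}" "j \<in> - {ts ! 0, i}"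
    then obtain p q r where ts: "ts = [p, q, r]" "distinct [p, q, r]"
      by (auto simp: dlists_def numeral_3_eq_3 length_Suc_conv)
    then have "distinct [p, i, j]" using ij by auto
    then show "of_bool (cyc ts \<circ> cyc [ts ! 0, i, j] = g) * (c *
        cyc_sum (\<lambda>a b c. tri_form (cyc [ts ! 0, i, j]) b c * tri_diff (cyc ts) a (ts ! 0)) v1 v2 v3) =
      of_bool (cyc ts \<circ> cyc [ts ! 0, i, j] = g) * (tri_tri_term ?\<delta> (ts ! 0) (ts ! 1) (ts ! 2) i j *
        (c + 0 * (0 + 0 + 0)))"
      using ts cyc_sum_tri_tri[OF ts(2), of i j v1 v2 v3] by simp
  qed
  also have "\<dots> = 0"
    using tri_tri_sum[OF alternating3_det3, of g v1 v2 v3 c 0 "\<lambda>_. 0"] by simp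
  finally show ?thesis by simp
qed

text \<open>The same reduction with a 5-cycle \<open>x\<close> ends in the sum that
  \<open>penta_tri_cancel\<close> shows to be zero.\<close>

lemma penta_const_bracket:
  fixes g :: "'n::finite \<Rightarrow> 'n"
  shows "cyc_sum (\<lambda>u v w. \<Sum>(x, y)\<in>fact_pairs g.
      kappaC_penta a b x (u + perm_act y u) (kappaL_tri a b y v w)) v1 v2 v3 = 0"
proof -
  let ?\<delta> = "det3 v1 v2 v3"
  have "kappaC_penta a b x (u + perm_act y u) (kappaL_tri a b y v w) =
      (if is_kcycle 5 x \<and> is_kcycle 3 y then (a - b)^2 *
        (tri_form y v w * (\<Sum>z\<in>UNIV. penta_diff x (u + perm_act y u) z * tri_vec a b y $ z)) else 0)"
    for x y :: "'n \<Rightarrow> 'n" and u v w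
    unfolding kappaL_tri_eq kappaC_penta_eq
    using form_diff(2)[OF is_kcycle_permutes, of 5 x "u + perm_act y u"]
      penta_form_linear(4)[of x "u + perm_act y u" 0 0]
    by (auto simp: penta_form_linear(4) simp del: mult_cancel_left mult_cancel_right)
  then have "cyc_sum (\<lambda>u v w. \<Sum>(x, y)\<in>fact_pairs g.
      kappaC_penta a b x (u + perm_act y u) (kappaL_tri a b y v w)) v1 v2 v3 =
    cyc_sum (\<lambda>u v w. \<Sum>(x, y)\<in>fact_pairs g. if is_kcycle 5 x \<and> is_kcycle 3 y then (a - b)^2 *
        (tri_form y v w * (\<Sum>z\<in>UNIV. penta_diff x (u + perm_act y u) z * tri_vec a b y $ z)) else 0) v1 v2 v3"
    by (simp add: cyc_sum_def)
  also have "\<dots> = 2 * (a - b) * (\<Sum>ts\<in>dlists 5. \<Sum>i\<in>- {ts ! 0}. \<Sum>j\<in>- {ts ! 0, i}.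
      of_bool (cyc ts \<circ> cyc [ts ! 0, i, j] = g) * ((a - b)^2 *
        cyc_sum (\<lambda>a b c. tri_form (cyc [ts ! 0, i, j]) b c * penta_diff (cyc ts) a (ts ! 0)) v1 v2 v3))"
    by (rule sum_fact_pairs_reduce[where w = "\<lambda>_. (a - b)^2"])
      (simp_all add: diff_linear form_diff diff_fixed is_kcycle_permutes)
  also have "(\<Sum>ts\<in>dlists 5. \<Sum>i\<in>- {ts ! 0}. \<Sum>j\<in>- {ts ! 0, i}.
      of_bool (cyc ts \<circ> cyc [ts ! 0, i, j] = g) * ((a - b)^2 *
        cyc_sum (\<lambda>a b c. tri_form (cyc [ts ! 0, i, j]) b c * penta_diff (cyc ts) a (ts ! 0)) v1 v2 v3)) =
    (\<Sum>ts\<in>dlists 5. \<Sum>i\<in>- {ts ! 0}. \<Sum>j\<in>- {ts ! 0, i}. (a - b)^2 *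
      (of_bool (cyc ts \<circ> cyc [ts ! 0, i, j] = g) *
        penta_tri_term ?\<delta> (ts ! 0) (ts ! 1) (ts ! 2) (ts ! 3) (ts ! 4) i j))"
  proof (intro sum.cong refl)
    fix ts :: "'n list" and i j
    assume "ts \<in> dlists 5" and ij: "i \<in> - {ts ! 0}" "j \<in> - {ts ! 0, i}"
    then obtain p q r s t where ts: "ts = [p, q, r, s, t]" "distinct [p, q, r, s, t]"
      by (auto simp: dlists_def numeral_eq_Suc length_Suc_conv)
    then have "distinct [p, i, j]" using ij by auto
    then show "of_bool (cyc ts \<circ> cyc [ts ! 0, i, j] = g) * ((a - b)^2 *
        cyc_sum (\<lambda>a b c. tri_form (cyc [ts ! 0, i, j]) b c * penta_diff (cyc ts) a (ts ! 0)) v1 v2 v3) =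
      (a - b)^2 * (of_bool (cyc ts \<circ> cyc [ts ! 0, i, j] = g) *
        penta_tri_term ?\<delta> (ts ! 0) (ts ! 1) (ts ! 2) (ts ! 3) (ts ! 4) i j)"
      using ts cyc_sum_penta_tri[OF ts(2), of i j v1 v2 v3] by simp
  qed
  also have "\<dots> = 0"
    unfolding sum_distrib_left[symmetric] penta_tri_cancel[OF alternating3_det3] by simp
  finally show ?thesis by simp
qed

section \<open>Classification of cocycles\<close>

text \<open>\<open>B\<close> stands for the values of an alternating form on basis vectors.
  \<open>cocycle\<close> is coordinate \<open>i\<close> of the cyclic identity at the basis vectors
  of p, q, r; \<open>inv\<close> stems from conjugating \<open>g\<close> by itself, and
  \<open>swap\<close> from conjugating by the transposition of a 2-cycle of
  \<open>g\<close>.\<close>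

locale cocycle_coefficients =
  fixes g :: "'n::finite \<Rightarrow> 'n" and B :: "'n \<Rightarrow> 'n \<Rightarrow> complex"
  assumes perm: "g permutes UNIV" and non_id: "g \<noteq> id"
    and anti: "B p q = - B q p"
    and cocycle: "B q r * (of_bool (i = g p) - of_bool (i = p)) +
      B r p * (of_bool (i = g q) - of_bool (i = q)) + B p q * (of_bool (i = g r) - of_bool (i = r)) = 0"
    and inv: "B (g p) (g q) = B p q"
    and swap: "g (g q) = q \<Longrightarrow> g q \<noteq> q \<Longrightarrow> B (cyc [q, g q] p) (cyc [q, g q] r) = B p r"
begin

lemma g_inj: "g p = g q \<longleftrightarrow> p = q"
  using permutes_inj[OF perm] by (simp add: inj_eq)

lemma diag: "B p p = 0"
  using anti[of p p] by simp

text \<open>Coordinate \<open>p\<close> of the identity at p, q, r contains \<open>- B q r\<close>,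
  and the other two terms contribute there only if p = g q or p = g r.\<close>

lemma moved_near_support:
  assumes "B q r \<noteq> 0" "g p \<noteq> p" "p \<noteq> q" "p \<noteq> r"
  shows "p = g q \<or> p = g r"
  using cocycle[of q r p p] assms by (auto simp: of_bool_def split: if_splits)

text \<open>Were \<open>q\<close> fixed, only \<open>r\<close> and \<open>g r\<close> could be
  moved, so \<open>g\<close> would be their transposition. The cocycle identity and invariance then
  equate \<open>B q r\<close> with its negative.\<close>

lemma support_moved:
  assumes nz: "B q r \<noteq> 0"
  shows "g q \<noteq> q"
proof
  assume q: "g q = q"
  have qr: "q \<noteq> r" using nz diag by auto
  have near: "p = r \<or> p = g r" if "g p \<noteq> p" for p
    using moved_near_support[OF nz that] q that by auto
  obtain m where "g m \<noteq> m" using non_id by (auto simp: fun_eq_iff)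
  then have r: "g r \<noteq> r" using near by metis
  have s: "g (g r) = r" using near[of "g (g r)"] r g_inj by metis
  have "B q r = B (g r) q"
    using cocycle[of q r r "g r"] q r s qr g_inj[of r q] by (auto simp: of_bool_def split: if_splits)
  moreover have "B q (g r) = B q r" using inv[of q r] q by simp
  ultimately show False using anti[of "g r" q] nz by simp
qed

text \<open>For s = g r, invariance and antisymmetry exclude s = q, and
  \<open>moved_near_support\<close> at \<open>g s\<close> forces g s = q. Nothing else moves, so
  \<open>g\<close> is (q r s).\<close>

lemma support_3cycle_aux:
  assumes nz: "B q r \<noteq> 0" and "g q = r"
  shows "is_kcycle 3 g"
proof -
  have m: "g q \<noteq> q" "g r \<noteq> r"
    using support_moved[OF nz] support_moved[of r q] nz anti[of q r] by auto
  define s where "s = g r"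
  have "s \<noteq> q" using inv[of q r] anti[of q r] nz assms(2) by (auto simp: s_def)
  have gs: "g s = q"
    using moved_near_support[OF nz, of "g s"] m assms(2) \<open>s \<noteq> q\<close> g_inj unfolding s_def by metis
  have "g p = p" if "p \<notin> {q, r, s}" for p
    using moved_near_support[OF nz, of p] that assms(2) by (auto simp: s_def)
  then have "g = cyc [q, r, s]"
    using gs assms(2) by (auto simp: fun_eq_iff cyc_simps s_def)
  moreover have "distinct [q, r, s]" using m \<open>s \<noteq> q\<close> assms(2) by (auto simp: s_def)
  ultimately show ?thesis by (auto simp: is_kcycle_iff intro!: exI[of _ "[q, r, s]"])
qed

lemma support_3cycle:
  assumes nz: "B q r \<noteq> 0"
  shows "is_kcycle 3 g"
proof -
  have nz': "B r q \<noteq> 0" using nz anti[of q r] by simp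
  note m = support_moved[OF nz] support_moved[OF nz']
  have qr: "q \<noteq> r" using nz diag by auto
  show ?thesis
  proof (cases "g q = r \<or> g r = q")
    case True
    then show ?thesis using support_3cycle_aux[OF nz] support_3cycle_aux[OF nz'] by blast
  next
    case False
    define s where "s = g q"
    define t where "t = g r"
    have st: "s \<noteq> q" "s \<noteq> r" "t \<noteq> q" "t \<noteq> r" "s \<noteq> t"
      using False m qr g_inj by (auto simp: s_def t_def)
    \<comment> \<open>As \<open>g s\<close> is moved, avoiding \<open>q\<close> and \<open>r\<close>
      would place it at \<open>s\<close> or \<open>t\<close>, which injectivity excludes.\<close>
    have "g s = q \<or> g s = r"
      using moved_near_support[OF nz, of "g s"] st g_inj unfolding s_def t_def by metis
    then have False
    proof
      \<comment> \<open>Now \<open>q\<close> and \<open>s\<close> form a 2-cycle of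
        \<open>g\<close>; exchanging them preserves \<open>B\<close>, against the sign in the
        cocycle identity.\<close>
      assume gs: "g s = q"
      have "B q r = B r s"
        using cocycle[of q r q s] gs st qr by (simp add: s_def[symmetric] t_def[symmetric])
      moreover have "B s r = B q r"
        using swap[of q q r] gs st qr by (simp add: s_def[symmetric] cyc_simps)
      ultimately show False using anti[of r s] nz by simp
    next
      assume gs: "g s = r"
      have "B r s = 0"
        using cocycle[of q r q s] gs st qr by (simp add: s_def[symmetric] t_def[symmetric])
      moreover have "B q r = B r s"
        using cocycle[of q r s s] gs st qr by (simp add: s_def[symmetric] t_def[symmetric])
      ultimately show False using nz by simp
    qed
    then show ?thesis ..
  qed
qed

text \<open>On a 3-cycle the identity equates the values along its three arrows, which determines
  \<open>c\<close>. Pairs involving a fixed point have value 0 by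
  \<open>support_moved\<close>.\<close>

lemma coefficients_eq:
  "\<exists>c. \<forall>p q. B p q = (if is_kcycle 3 g then c * (of_bool (q = g p) - of_bool (p = g q)) else 0)"
proof (cases "is_kcycle 3 g")
  case True
  then obtain x y z where d: "distinct [x, y, z]" and g: "g = cyc [x, y, z]" by (rule three_cycleE)
  have neq: "x \<noteq> y" "y \<noteq> x" "x \<noteq> z" "z \<noteq> x" "y \<noteq> z" "z \<noteq> y" using d by auto
  have gx: "g x = y" "g y = z" "g z = x" using neq by (simp_all add: g cyc_simps)
  have fixed: "g p = p" if "p \<notin> {x, y, z}" for p using that by (simp add: g cyc_simps)
  define c where "c = B x y"
  have yz: "B y z = c" using cocycle[of x y x z] by (simp add: gx neq c_def)
  have zx: "B z x = c" using cocycle[of x y y z] by (simp add: gx neq yz)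
  have c: "B x y = c" "B y x = - c" "B z y = - c" "B x z = - c"
    using anti[of y x] anti[of z y] anti[of x z] by (simp_all add: c_def[symmetric] yz zx)
  have "B p q = c * (of_bool (q = g p) - of_bool (p = g q))" for p q
  proof (cases "p \<in> {x, y, z} \<and> q \<in> {x, y, z}")
    case True
    then show ?thesis by (elim conjE insertE emptyE) (simp_all add: gx neq diag yz zx c)
  next
    case False
    have "B p q = 0"
    proof (rule ccontr)
      assume "B p q \<noteq> 0"
      moreover from this have "B q p \<noteq> 0" using anti[of p q] by simp
      ultimately show False using support_moved fixed False by blast
    qed
    moreover have "q = g p \<longleftrightarrow> p = g q" using False fixed gx by (metis insert_iff g_inj)
    ultimately show ?thesis by simp
  qed
  then show ?thesis using True by auto
next
  case False
  then show ?thesis using support_3cycle by auto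
qed

end

section \<open>From coefficients to bilinear forms\<close>

lemma bilin_scal_sum:
  fixes \<beta> :: "complex^'n::finite \<Rightarrow> complex^'n \<Rightarrow> complex"
  assumes "bilin_scal \<beta>"
  shows "\<beta> v w = (\<Sum>p\<in>UNIV. \<Sum>q\<in>UNIV. v $ p * w $ q * \<beta> (axis p 1) (axis q 1))"
proof -
  have lin: "\<beta> (u + v) w = \<beta> u w + \<beta> v w" "\<beta> w (u + v) = \<beta> w u + \<beta> w v"
    "\<beta> (c *s u) w = c * \<beta> u w" "\<beta> w (c *s u) = c * \<beta> w u" for u v w c
    using assms unfolding bilin_scal_def by blast+
  have zero: "\<beta> 0 w = 0" "\<beta> w 0 = 0" for w using lin(3)[of 0 0 w] lin(4)[of w 0 0] by simp_all
  have s1: "\<beta> (\<Sum>p\<in>S. v $ p *s axis p 1) w = (\<Sum>p\<in>S. v $ p * \<beta> (axis p 1) w)" for S :: "'n set" and w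
    by (induction S rule: infinite_finite_induct) (simp_all add: zero lin)
  have s2: "\<beta> u (\<Sum>q\<in>S. w $ q *s axis q 1) = (\<Sum>q\<in>S. w $ q * \<beta> u (axis q 1))" for S :: "'n set" and u
    by (induction S rule: infinite_finite_induct) (simp_all add: zero lin)
  have "\<beta> v w = \<beta> (\<Sum>p\<in>UNIV. v $ p *s axis p 1) (\<Sum>q\<in>UNIV. w $ q *s axis q 1)"
    by (simp only: basis_expansion)
  also have "\<dots> = (\<Sum>p\<in>UNIV. v $ p * (\<Sum>q\<in>UNIV. w $ q * \<beta> (axis p 1) (axis q 1)))"
    unfolding s1 unfolding s2 ..
  finally show ?thesis by (simp add: sum_distrib_left mult.assoc)
qed

lemma perm_act_axis:
  fixes g :: "'n::finite \<Rightarrow> 'n"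
  assumes "g permutes UNIV"
  shows "perm_act g (axis p 1) = axis (g p) 1"
  using permutes_inv_eq[OF assms] by (auto simp: perm_act_def axis_def vec_eq_iff)

lemma cocycle_form_eq:
  fixes g :: "'n::finite \<Rightarrow> 'n"
  assumes perm: "g permutes UNIV" and "g \<noteq> id"
    and bil: "bilin_scal \<beta>" and alt: "\<And>v. \<beta> v v = 0"
    and cocycle: "\<And>v1 v2 v3. cyc_sum (\<lambda>a b c. \<beta> b c *s (perm_act g a - a)) v1 v2 v3 = 0"
    and inv: "\<And>v w. \<beta> (perm_act g v) (perm_act g w) = \<beta> v w"
    and swap: "\<And>q v w. g (g q) = q \<Longrightarrow> g q \<noteq> q \<Longrightarrow>
      \<beta> (perm_act (cyc [q, g q]) v) (perm_act (cyc [q, g q]) w) = \<beta> v w"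
  shows "\<exists>c. \<forall>v w. \<beta> v w = (if is_kcycle 3 g then c * tri_form g v w else 0)"
proof -
  define B where "B p q = \<beta> (axis p 1) (axis q 1)" for p q
  have lin: "\<beta> (u + v) w = \<beta> u w + \<beta> v w" "\<beta> w (u + v) = \<beta> w u + \<beta> w v" for u v w
    using bil unfolding bilin_scal_def by blast+
  interpret cocycle_coefficients g B
  proof
    show "g permutes UNIV" "g \<noteq> id" by fact+
    show "B p q = - B q p" for p q
      using alt[of "axis p 1 + axis q 1", unfolded lin] by (simp add: alt B_def eq_neg_iff_add_eq_0 add.commute)
    show "B (g p) (g q) = B p q" for p q
      using inv[of "axis p 1" "axis q 1"] by (simp add: perm_act_axis[OF perm] B_def)
    show "B (cyc [q, g q] p) (cyc [q, g q] r) = B p r" if "g (g q) = q" "g q \<noteq> q" for q p r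
    proof -
      have "cyc [q, g q] permutes UNIV" using that(2) by (intro cyc_permutes) auto
      then show ?thesis using swap[OF that, of "axis p 1" "axis r 1"] by (simp add: perm_act_axis B_def)
    qed
    show "B q r * (of_bool (i = g p) - of_bool (i = p)) +
      B r p * (of_bool (i = g q) - of_bool (i = q)) + B p q * (of_bool (i = g r) - of_bool (i = r)) = 0" for q r i p
    proof -
      have "cyc_sum (\<lambda>a b c. \<beta> b c *s (perm_act g a - a)) (axis p 1) (axis q 1) (axis r 1) $ i = 0"
        unfolding cocycle by simp
      moreover have "axis p 1 $ i = (of_bool (i = p) :: complex)" for p i :: 'n
        by (simp add: axis_def)
      ultimately show ?thesis
        by (simp only: cyc_sum_def perm_act_axis[OF perm] B_def vector_add_component
            vector_minus_component vector_smult_component)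
    qed
  qed
  obtain c where c: "B p q = (if is_kcycle 3 g then c * (of_bool (q = g p) - of_bool (p = g q)) else 0)" for p q
    using coefficients_eq by blast
  have "\<beta> v w = (if is_kcycle 3 g then c * tri_form g v w else 0)" for v w
    unfolding bilin_scal_sum[OF bil, of v w] B_def[symmetric] c tri_form_double_sum
    by (simp add: sum_distrib_left mult_ac)
  then show ?thesis by blast
qed


section \<open>Conjugacy of 3-cycles and invariance of the explicit cochains\<close>

text \<open>The matching of entries is extended by a bijection between the complements, which have
  equal cardinality.\<close>

lemma ex_permutes_map:
  fixes xs ys :: "'n::finite list"
  assumes "distinct xs" "distinct ys" "length xs = length ys"
  obtains h where "h permutes UNIV" "map h xs = ys"
proof -
  define f where "f = (\<lambda>x. the (map_of (zip xs ys) x))"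
  have f: "f (xs ! i) = ys ! i" if "i < length xs" for i
    using map_of_zip_nth[of xs ys i] assms that by (simp add: f_def)
  then have fmap: "map f xs = ys" using assms(3) by (simp add: list_eq_iff_nth_eq)
  then have "inj_on f (set xs)" using assms(1,2) by (metis distinct_map)
  then have bf: "bij_betw f (set xs) (set ys)" using fmap by (auto simp: bij_betw_def)
  have "card (- set xs) = card (- set ys)"
    using assms by (simp add: Compl_eq_Diff_UNIV card_Diff_subset distinct_card)
  then obtain k where bk: "bij_betw k (- set xs) (- set ys)"
    using finite_same_card_bij[of "- set xs" "- set ys"] by auto
  define h where "h = (\<lambda>x. if x \<in> set xs then f x else k x)"
  have "bij_betw h (set xs \<union> - set xs) (set ys \<union> - set ys)"
  proof (rule bij_betw_combine)
    show "bij_betw h (set xs) (set ys)" using bf by (rule bij_betw_cong[THEN iffD1, rotated]) (simp add: h_def)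
    show "bij_betw h (- set xs) (- set ys)" using bk by (rule bij_betw_cong[THEN iffD1, rotated]) (simp add: h_def)
  qed simp
  then have "h permutes UNIV" by (intro bij_imp_permutes) auto
  moreover have "map h xs = ys" using fmap by (auto simp: h_def)
  ultimately show ?thesis by (rule that)
qed

lemma conj_cyc3:
  fixes h :: "'n::finite \<Rightarrow> 'n"
  assumes "h permutes UNIV"
  shows "h \<circ> cyc [x, y, z] \<circ> inv h = cyc [h x, h y, h z]"
proof
  fix l
  have "inv h l = p \<longleftrightarrow> l = h p" for p using permutes_inv_eq[OF assms, of l p] by auto
  then show "(h \<circ> cyc [x, y, z] \<circ> inv h) l = cyc [h x, h y, h z] l"
    by (simp add: cyc_simps permutes_inverses[OF assms])
qed

lemma three_cycles_conj:
  fixes g g0 :: "'n::finite \<Rightarrow> 'n"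
  assumes "is_kcycle 3 g0" "is_kcycle 3 g"
  obtains h where "h permutes UNIV" "g = h \<circ> g0 \<circ> inv h"
proof -
  obtain x y z where g: "distinct [x, y, z]" "g = cyc [x, y, z]" using assms(2) by (rule three_cycleE)
  obtain x0 y0 z0 where g0: "distinct [x0, y0, z0]" "g0 = cyc [x0, y0, z0]" using assms(1) by (rule three_cycleE)
  obtain h where "h permutes UNIV" "map h [x0, y0, z0] = [x, y, z]"
    using ex_permutes_map[OF g0(1) g(1)] by auto
  then show ?thesis using that[of h] conj_cyc3[of h x0 y0 z0] g g0 by simp
qed

lemma perm_act_inverse:
  fixes h :: "'n::finite \<Rightarrow> 'n"
  assumes "h permutes UNIV"
  shows "perm_act h (perm_act (inv h) v) = v"
  by (simp add: perm_act_def vec_eq_iff permutes_inv_inv[OF assms] permutes_inverses[OF assms])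

lemma not_kcycle_id: "k \<ge> 2 \<Longrightarrow> \<not> is_kcycle k (id :: 'n::finite \<Rightarrow> 'n)"
proof
  assume k: "k \<ge> 2" and "is_kcycle k (id :: 'n \<Rightarrow> 'n)"
  then obtain ts :: "'n list" where ts: "length ts = k" "distinct ts" "id = cyc ts"
    by (auto simp: is_kcycle_iff)
  have "Suc 0 mod k = Suc 0" using k by simp
  moreover have "cyc ts (ts ! 0) = ts ! (Suc 0 mod k)" using cyc_nth[of ts 0] ts k by simp
  ultimately have "ts ! 0 = ts ! 1" using ts(3) by (metis One_nat_def id_apply)
  then show False using ts k by (simp add: nth_eq_iff_index_eq)
qed

lemma kappa_conj:
  fixes h :: "'n::finite \<Rightarrow> 'n"
  assumes "h permutes UNIV"
  shows "kappaL_tri a b (h \<circ> g \<circ> inv h) (perm_act h v) (perm_act h w) = perm_act h (kappaL_tri a b g v w)"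
    and "kappaC_tri c (h \<circ> g \<circ> inv h) (perm_act h v) (perm_act h w) = kappaC_tri c g v w"
    and "kappaC_penta a b (h \<circ> g \<circ> inv h) (perm_act h v) (perm_act h w) = kappaC_penta a b g v w"
proof -
  have "perm_act h (c *s v) = c *s perm_act h v" "perm_act h 0 = 0" for c v
    by (simp_all add: perm_act_def vec_eq_iff)
  then show "kappaL_tri a b (h \<circ> g \<circ> inv h) (perm_act h v) (perm_act h w) = perm_act h (kappaL_tri a b g v w)"
    by (simp add: kappaL_tri_eq is_kcycle_conj[OF assms] forms_conj[OF assms])
qed (simp_all add: kappaC_tri_eq kappaC_penta_eq is_kcycle_conj[OF assms] forms_conj[OF assms])

section \<open>Sufficiency of the stated form\<close>

lemma DOA_map_kappa:
  fixes kL :: "('n::finite \<Rightarrow> 'n) \<Rightarrow> complex^'n \<Rightarrow> complex^'n \<Rightarrow> complex^'n"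
  assumes kL: "\<And>g v w. g permutes UNIV \<Longrightarrow> kL g v w = kappaL_tri a b g v w"
    and kC: "\<And>g v w. g permutes UNIV \<Longrightarrow> kC g v w = kappaC_penta a b g v w + kappaC_tri c g v w"
  shows "DOA_map kL kC"
  unfolding DOA_map_def
proof (intro conjI allI impI)
  fix g :: "'n \<Rightarrow> 'n" and v w assume g: "g permutes UNIV"
  have "perm_act g (c *s v) = c *s perm_act g v" "perm_act g 0 = 0" for c v
    by (simp_all add: perm_act_def vec_eq_iff)
  then show "perm_act g (kL g v w) = kL g v w"
    by (simp add: kL[OF g] kappaL_tri_eq perm_act_tri_vec[OF g])
next
  fix g h :: "'n \<Rightarrow> 'n" and v w assume g: "g permutes UNIV" and h: "h permutes UNIV"
  have c: "h \<circ> g \<circ> inv h permutes UNIV" using g h by (intro permutes_compose permutes_inv)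
  show "perm_act h (kL g v w) = kL (h \<circ> g \<circ> inv h) (perm_act h v) (perm_act h w)"
    by (simp add: kL[OF g] kL[OF c] kappa_conj[OF h])
  show "kC g v w = kC (h \<circ> g \<circ> inv h) (perm_act h v) (perm_act h w)"
    by (simp add: kC[OF g] kC[OF c] kappa_conj[OF h])
next
  fix g :: "'n \<Rightarrow> 'n" and v1 v2 v3 assume g: "g permutes UNIV"
  show "cyc_sum (\<lambda>a b c. sym_prod (kL g b c) (perm_act g a - a)) v1 v2 v3 = 0"
  proof (cases "is_kcycle 3 g")
    case True
    let ?X = "tri_vec a b g" and ?S = "cyc_sum (\<lambda>a b c. tri_form g b c *s (perm_act g a - a)) v1 v2 v3"
    \<comment> \<open>All values of \<open>kL g\<close> are multiples of one vector, so (2) factors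
      through the cocycle sum of \<open>tri_form\<close>.\<close>
    have "cyc_sum (\<lambda>a b c. sym_prod (kL g b c) (perm_act g a - a)) v1 v2 v3 = sym_prod ?X ?S"
      using True by (simp add: cyc_sum_def sym_prod_def kL[OF g] kappaL_tri_eq vec_eq_iff algebra_simps)
    then show ?thesis unfolding tri_form_cocycle[OF True] by (simp add: sym_prod_def vec_eq_iff)
  next
    case False
    then show ?thesis by (simp add: kL[OF g] kappaL_tri_eq cyc_sum_def sym_prod_def vec_eq_iff)
  qed
  \<comment> \<open>Factor pairs consist of permutations, where the given cochains agree with the
    explicit ones.\<close>
  have 3: "(\<Sum>(x, y)\<in>fact_pairs g. kL x (u + perm_act y u) (kL y v w)) =
      (\<Sum>(x, y)\<in>fact_pairs g. kappaL_tri a b x (u + perm_act y u) (kappaL_tri a b y v w))" for u v w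
    by (rule sum.cong) (auto simp: fact_pairs_def kL)
  have 4: "(\<Sum>(x, y)\<in>fact_pairs g. kC x (u + perm_act y u) (kL y v w)) =
      (\<Sum>(x, y)\<in>fact_pairs g. kappaC_penta a b x (u + perm_act y u) (kappaL_tri a b y v w)) +
      (\<Sum>(x, y)\<in>fact_pairs g. kappaC_tri c x (u + perm_act y u) (kappaL_tri a b y v w))" for u v w
    unfolding sum.distrib[symmetric] by (rule sum.cong) (auto simp: fact_pairs_def kL kC)
  \<comment> \<open>The 3-cycle part of \<open>kC\<close> drops out of the right side of (3), which
    leaves the identity \<open>tri_bracket\<close>.\<close>
  have "cyc_sum (\<lambda>u v w. kappaC_tri c g v w *s (perm_act g u - u)) v1 v2 v3 = 0"
  proof (cases "is_kcycle 3 g")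
    case True
    have "cyc_sum (\<lambda>u v w. kappaC_tri c g v w *s (perm_act g u - u)) v1 v2 v3 =
        c *s cyc_sum (\<lambda>u v w. tri_form g v w *s (perm_act g u - u)) v1 v2 v3"
      using True by (simp add: kappaC_tri_eq cyc_sum_def vec_eq_iff algebra_simps)
    then show ?thesis unfolding tri_form_cocycle[OF True] by simp
  qed (simp add: kappaC_tri_eq cyc_sum_def)
  moreover have "cyc_sum (\<lambda>u v w. kC g v w *s (perm_act g u - u)) v1 v2 v3 =
      cyc_sum (\<lambda>u v w. kappaC_penta a b g v w *s (perm_act g u - u)) v1 v2 v3 +
      cyc_sum (\<lambda>u v w. kappaC_tri c g v w *s (perm_act g u - u)) v1 v2 v3"
    by (simp add: kC[OF g] cyc_sum_def vec_eq_iff algebra_simps)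
  ultimately show "cyc_sum (\<lambda>u v w. \<Sum>(x, y)\<in>fact_pairs g. kL x (u + perm_act y u) (kL y v w)) v1 v2 v3 =
      2 *s cyc_sum (\<lambda>u v w. kC g v w *s (perm_act g u - u)) v1 v2 v3"
    unfolding 3 tri_bracket by simp
  have "cyc_sum (\<lambda>u v w. \<Sum>(x, y)\<in>fact_pairs g. kC x (u + perm_act y u) (kL y v w)) v1 v2 v3 =
      cyc_sum (\<lambda>u v w. \<Sum>(x, y)\<in>fact_pairs g. kappaC_penta a b x (u + perm_act y u) (kappaL_tri a b y v w)) v1 v2 v3 +
      cyc_sum (\<lambda>u v w. \<Sum>(x, y)\<in>fact_pairs g. kappaC_tri c x (u + perm_act y u) (kappaL_tri a b y v w)) v1 v2 v3"
    unfolding 4 by (simp add: cyc_sum_def)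
  then show "cyc_sum (\<lambda>u v w. \<Sum>(x, y)\<in>fact_pairs g. kC x (u + perm_act y u) (kL y v w)) v1 v2 v3 = 0"
    unfolding penta_const_bracket tri_const_bracket by simp
qed

section \<open>Necessity of the stated form\<close>

lemma perm_act_fixed_iff:
  fixes g :: "'n::finite \<Rightarrow> 'n"
  assumes "g permutes UNIV"
  shows "perm_act g v = v \<longleftrightarrow> (\<forall>l. v $ (g l) = v $ l)"
proof -
  have "(\<forall>l. v $ (inv g l) = v $ l) \<longleftrightarrow> (\<forall>l. v $ (g l) = v $ l)"
    using permutes_inverses[OF assms] by metis
  then show ?thesis by (simp add: perm_act_def vec_eq_iff)
qed

text \<open>The values of \<open>\<kappa>\<close> are \<open>g\<close>-invariant while \<open>g a - a\<close> sums to zero over every \<open>g\<close>-stable set of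
  indices, so summing the symmetric tensor over such a set separates its two halves.\<close>
lemma sym_cocycle_component:
  fixes g :: "'n::finite \<Rightarrow> 'n" and \<kappa> :: "complex^'n \<Rightarrow> complex^'n \<Rightarrow> complex^'n"
  assumes g: "g permutes UNIV" and fixed: "\<And>v w. perm_act g (\<kappa> v w) = \<kappa> v w"
    and sym: "\<And>v1 v2 v3. cyc_sum (\<lambda>a b c. sym_prod (\<kappa> b c) (perm_act g a - a)) v1 v2 v3 = 0"
  shows "cyc_sum (\<lambda>a b c. \<kappa> b c $ j *s (perm_act g a - a)) v1 v2 v3 = 0"
proof -
  \<comment> \<open>This choice makes stability under \<open>g\<close> immediate from the invariance
    of the values. It contains \<open>j\<close>, so its cardinality can be cancelled at the
    end.\<close>
  define S where "S = {l. \<forall>v w. \<kappa> v w $ l = \<kappa> v w $ j}"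
  have step: "g l \<in> S \<longleftrightarrow> l \<in> S" for l
    using fixed unfolding S_def perm_act_fixed_iff[OF g] by simp
  have S: "\<kappa> v w $ l = \<kappa> v w $ j" if "l \<in> S" for v w l using that by (simp add: S_def)
  have "(\<Sum>l\<in>S. a $ (inv g l)) = (\<Sum>l\<in>S. a $ l)" for a :: "complex^'n"
    by (rule sum.reindex_bij_witness[of _ g "inv g"]) (use permutes_inverses[OF g] step in \<open>metis+\<close>)
  then have tot: "(\<Sum>l\<in>S. (perm_act g a - a) $ l) = 0" for a :: "complex^'n"
    by (simp add: perm_act_def sum_subtractf)
  have "cyc_sum (\<lambda>a b c. \<kappa> b c $ j *s (perm_act g a - a)) v1 v2 v3 $ i = 0" for i
  proof -
    let ?w = "\<lambda>a. perm_act g a - a"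
    have comp: "cyc_sum (\<lambda>a b c. \<kappa> b c $ i * ?w a $ l + \<kappa> b c $ l * ?w a $ i) v1 v2 v3 = 0" for l
      using arg_cong[OF sym[of v1 v2 v3], of "\<lambda>M. M $ i $ l"] by (simp add: cyc_sum_def sym_prod_def)
    have "0 = (\<Sum>l\<in>S. cyc_sum (\<lambda>a b c. \<kappa> b c $ i * ?w a $ l + \<kappa> b c $ l * ?w a $ i) v1 v2 v3)"
      unfolding comp by simp
    also have "\<dots> = cyc_sum (\<lambda>a b c. \<Sum>l\<in>S. \<kappa> b c $ i * ?w a $ l + \<kappa> b c $ l * ?w a $ i) v1 v2 v3"
      by (rule cyc_sum_sum[symmetric])
    also have "\<dots> = cyc_sum (\<lambda>a b c. of_nat (card S) * (\<kappa> b c $ j * ?w a $ i)) v1 v2 v3"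
    proof -
      have "(\<Sum>l\<in>S. \<kappa> b c $ i * ?w a $ l + \<kappa> b c $ l * ?w a $ i) =
          of_nat (card S) * (\<kappa> b c $ j * ?w a $ i)" for a b c
        unfolding sum.distrib sum_distrib_left[symmetric] tot by (simp add: S)
      then show ?thesis by (simp only:)
    qed
    also have "\<dots> = of_nat (card S) * cyc_sum (\<lambda>a b c. \<kappa> b c $ j * ?w a $ i) v1 v2 v3"
      by (rule cyc_sum_mult)
    finally have "cyc_sum (\<lambda>a b c. \<kappa> b c $ j * ?w a $ i) v1 v2 v3 = 0"
      using finite_subset[of S UNIV] by (auto simp: S_def)
    then show ?thesis by (simp add: cyc_sum_def right_diff_distrib)
  qed
  then show ?thesis by (simp only: vec_eq_iff zero_index) simp
qed

text \<open>The transposition respects the 2-orbit and the rest of \<open>g\<close>. Invariance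
  under conjugation by it supplies the \<open>swap\<close> condition of the classification.\<close>

lemma swap_commutes:
  fixes g :: "'n::finite \<Rightarrow> 'n"
  assumes g: "g permutes UNIV" and "g (g q) = q" "g q \<noteq> q"
  shows "cyc [q, g q] permutes UNIV" "cyc [q, g q] \<circ> g \<circ> inv (cyc [q, g q]) = g"
proof -
  let ?t = "cyc [q, g q]"
  show t: "?t permutes UNIV" using assms(3) by (intro cyc_permutes) auto
  have "?t (g l) = g (?t l)" for l
  proof (cases "l = q \<or> l = g q")
    case True
    then show ?thesis using assms(2,3) by (auto simp: cyc_simps)
  next
    case False
    then have "g l \<noteq> q" "g l \<noteq> g q"
      using assms(2) permutes_inj[OF g] by (metis inj_eq)+
    then show ?thesis using False by (simp add: cyc_simps)
  qed
  then have "?t \<circ> g = g \<circ> ?t" by (simp add: fun_eq_iff)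
  then show "?t \<circ> g \<circ> inv ?t = g" by (simp add: comp_assoc permutes_inv_o[OF t])
qed

text \<open>A vector fixed by \<open>g\<close> has equal coordinates at \<open>q\<close> and
  \<open>g q\<close>.\<close>

lemma swap_fixes:
  fixes g :: "'n::finite \<Rightarrow> 'n"
  assumes g: "g permutes UNIV" and "g (g q) = q" "g q \<noteq> q" and "perm_act g v = v"
  shows "perm_act (cyc [q, g q]) v = v"
  unfolding perm_act_fixed_iff[OF swap_commutes(1)[OF assms(1-3)]]
  using assms(4) unfolding perm_act_fixed_iff[OF g] by (simp add: cyc_simps)

context
  fixes kL :: "('n::finite \<Rightarrow> 'n) \<Rightarrow> complex^'n \<Rightarrow> complex^'n \<Rightarrow> complex^'n"
    and kC :: "('n \<Rightarrow> 'n) \<Rightarrow> complex^'n \<Rightarrow> complex^'n \<Rightarrow> complex"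
  assumes card: "CARD('n) \<ge> 3" and kL: "linear_cochain kL" and kC: "const_cochain kC"
    and kL_id: "\<And>v w. kL id v w = 0" and kC_id: "\<And>v w. kC id v w = 0"
    and doa: "DOA_map kL kC"
begin

lemmas doa_conds = doa[unfolded DOA_map_def]

lemma kL_fixed: "g permutes UNIV \<Longrightarrow> perm_act g (kL g v w) = kL g v w"
  using doa_conds[THEN conjunct1] by simp

lemma kL_conj: "g permutes UNIV \<Longrightarrow> h permutes UNIV \<Longrightarrow>
    kL (h \<circ> g \<circ> inv h) (perm_act h v) (perm_act h w) = perm_act h (kL g v w)"
  using doa_conds[THEN conjunct2, THEN conjunct1] by simp

lemma kC_conj: "g permutes UNIV \<Longrightarrow> h permutes UNIV \<Longrightarrow>
    kC (h \<circ> g \<circ> inv h) (perm_act h v) (perm_act h w) = kC g v w"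
  using doa_conds[THEN conjunct2, THEN conjunct2, THEN conjunct1] by (elim allE[of _ g] allE[of _ h]) simp

lemma conj_self: "g permutes UNIV \<Longrightarrow> g \<circ> g \<circ> inv g = (g :: 'n \<Rightarrow> 'n)"
  by (simp add: comp_assoc permutes_inv_o)

text \<open>Each coordinate of \<open>kL g\<close> is a scalar form covered by the classification;
  the multipliers of the coordinates assemble to \<open>X\<close>.\<close>

lemma kL_form:
  assumes g: "g permutes UNIV"
  obtains X where "\<And>v w. kL g v w = (if is_kcycle 3 g then tri_form g v w *s X else 0)"
proof (cases "g = id")
  case True
  then show ?thesis using that[of 0] kL_id by (simp add: not_kcycle_id)
next
  case False
  have "\<exists>c. \<forall>v w. kL g v w $ j = (if is_kcycle 3 g then c * tri_form g v w else 0)" for j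
  proof (rule cocycle_form_eq[OF g False])
    have bil: "bilin_vec (kL g)" and alt: "\<And>v. kL g v v = 0"
      using kL g unfolding linear_cochain_def by blast+
    show "bilin_scal (\<lambda>v w. kL g v w $ j)"
      using bil unfolding bilin_vec_def bilin_scal_def by simp
    show "kL g v v $ j = 0" for v by (simp add: alt)
    show "cyc_sum (\<lambda>a b c. kL g b c $ j *s (perm_act g a - a)) v1 v2 v3 = 0" for v1 v2 v3
      by (rule sym_cocycle_component[OF g kL_fixed[OF g]])
        (rule doa_conds[THEN conjunct2, THEN conjunct2, THEN conjunct2, THEN conjunct1, rule_format, OF g])
    show "kL g (perm_act g v) (perm_act g w) $ j = kL g v w $ j" for v w
      using kL_conj[OF g g, of v w] by (simp only: conj_self[OF g] kL_fixed[OF g])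
    show "kL g (perm_act (cyc [q, g q]) v) (perm_act (cyc [q, g q]) w) $ j = kL g v w $ j"
      if "g (g q) = q" "g q \<noteq> q" for q v w
      using kL_conj[OF g swap_commutes(1)[OF g that], of v w]
      by (simp only: swap_commutes(2)[OF g that] swap_fixes[OF g that kL_fixed[OF g]])
  qed
  then obtain c where "\<And>j v w. kL g v w $ j = (if is_kcycle 3 g then c j * tri_form g v w else 0)"
    by metis
  then show ?thesis using that[of "\<chi> j. c j"] by (simp add: vec_eq_iff mult.commute)
qed

lemma ex_three_cycle: obtains x y z :: 'n where "distinct [x, y, z]"
proof -
  obtain T :: "'n set" where "card T = 3" using obtain_subset_with_card_n[OF card] by auto
  then show ?thesis using that by (auto simp: card_3_iff)
qed

text \<open>For one fixed 3-cycle, invariance under itself makes \<open>X\<close> constant on its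
  points, and invariance under transpositions of two other points makes it constant off them.
  Conjugation carries the result to all 3-cycles.\<close>

lemma kL_eq:
  obtains a b where "\<And>g v w. g permutes UNIV \<Longrightarrow> kL g v w = kappaL_tri a b g v w"
proof -
  obtain x y z :: 'n where d: "distinct [x, y, z]" by (rule ex_three_cycle)
  define g0 where "g0 = cyc [x, y, z]"
  have g0: "g0 permutes UNIV" "is_kcycle 3 g0"
    using d cyc_permutes[OF d] by (auto simp: g0_def is_kcycle_iff intro!: exI[of _ "[x, y, z]"])
  obtain X where X: "\<And>v w. kL g0 v w = tri_form g0 v w *s X"
    using kL_form[OF g0(1)] g0(2) by (metis (full_types))
  have one: "tri_form g0 (axis x 1) (axis y 1) = 1"
    unfolding g0_def tri_form_cyc[OF d] using d by (auto simp: axis_def)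
  then have Xval: "kL g0 (axis x 1) (axis y 1) = X" by (simp add: X)
  have "X $ (g0 l) = X $ l" for l
    using kL_fixed[OF g0(1), of "axis x 1" "axis y 1"] unfolding Xval perm_act_fixed_iff[OF g0(1)] by blast
  from this[of x] this[of y] have Xin: "X $ y = X $ x" "X $ z = X $ x"
    using d by (auto simp: g0_def cyc_simps)
  have Xout: "X $ l = X $ m" if lm: "l \<notin> {x, y, z}" "m \<notin> {x, y, z}" for l m
  proof (cases "l = m")
    case False
    let ?t = "cyc [l, m]"
    have t: "?t permutes UNIV" using False by (intro cyc_permutes) auto
    have fx: "?t x = x" "?t y = y" "?t z = z" using lm by (auto simp: cyc_simps)
    then have "?t \<circ> g0 \<circ> inv ?t = g0" using conj_cyc3[OF t, of x y z] by (simp add: g0_def)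
    then have "perm_act ?t X = X"
      using kL_conj[OF g0(1) t, of "axis x 1" "axis y 1"] by (simp add: perm_act_axis[OF t] fx Xval)
    then have "X $ (?t l) = X $ l" unfolding perm_act_fixed_iff[OF t] by blast
    then show ?thesis by (simp add: cyc_simps)
  qed simp
  define a where "a = X $ x"
  \<comment> \<open>For n = 3 no such index exists and \<open>b\<close> is an arbitrary coordinate;
    \<open>tri_vec\<close> takes the value \<open>b\<close> only at fixed points, and a 3-cycle then
    has none.\<close>
  define b where "b = X $ (SOME l. l \<notin> {x, y, z})"
  have "X = tri_vec a b g0"
  proof (subst vec_eq_iff, rule allI)
    fix l
    show "X $ l = tri_vec a b g0 $ l"
    proof (cases "l \<in> {x, y, z}")
      case True
      then show ?thesis using d Xin by (auto simp: tri_vec_def g0_def cyc_simps a_def)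
    next
      case False
      then have "(SOME l. l \<notin> {x, y, z}) \<notin> {x, y, z}" by (rule someI)
      then have "X $ l = b" unfolding b_def using False by (rule Xout[rotated])
      then show ?thesis using False by (auto simp: tri_vec_def g0_def cyc_simps)
    qed
  qed
  then have base: "kL g0 v w = kappaL_tri a b g0 v w" for v w by (simp add: X kappaL_tri_eq g0(2))
  have "kL g v w = kappaL_tri a b g v w" if g: "g permutes UNIV" for g v w
  proof (cases "is_kcycle 3 g")
    case True
    obtain h where h: "h permutes UNIV" "g = h \<circ> g0 \<circ> inv h" using three_cycles_conj[OF g0(2) True] .
    show ?thesis
      using kL_conj[OF g0(1) h(1), of "perm_act (inv h) v" "perm_act (inv h) w"]
        kappa_conj(1)[OF h(1), of a b g0 "perm_act (inv h) v" "perm_act (inv h) w"]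
      by (simp add: h(2)[symmetric] base perm_act_inverse[OF h(1)])
  next
    case False
    then show ?thesis using kL_form[OF g] by (metis kappaL_tri_eq)
  qed
  then show ?thesis by (rule that)
qed

text \<open>By \<open>tri_bracket\<close> the left side of (3) is matched by the 5-cycle form. The
  difference \<beta> therefore satisfies the cocycle identity and is a multiple of
  \<open>tri_form\<close> on each 3-cycle and zero elsewhere; conjugation makes the multiplier
  uniform.\<close>

lemma kC_eq:
  assumes kL_eq: "\<And>g v w. g permutes UNIV \<Longrightarrow> kL g v w = kappaL_tri a b g v w"
  obtains c where "\<And>g v w. g permutes UNIV \<Longrightarrow> kC g v w = kappaC_penta a b g v w + kappaC_tri c g v w"
proof -
  define \<beta> where "\<beta> g v w = kC g v w - kappaC_penta a b g v w" for g v w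
  have conj: "\<beta> (h \<circ> g \<circ> inv h) (perm_act h v) (perm_act h w) = \<beta> g v w"
    if "g permutes UNIV" "h permutes UNIV" for g h v w
    by (simp add: \<beta>_def kC_conj[OF that] kappa_conj[OF that(2)])
  have form: "\<exists>c. \<forall>v w. \<beta> g v w = (if is_kcycle 3 g then c * tri_form g v w else 0)"
    if g: "g permutes UNIV" for g
  proof (cases "g = id")
    case True
    then show ?thesis by (simp add: \<beta>_def kC_id kappaC_penta_eq not_kcycle_id)
  next
    case False
    show ?thesis
    proof (rule cocycle_form_eq[OF g False])
      have bil: "bilin_scal (kC g)" and alt: "\<And>v. kC g v v = 0"
        using kC g unfolding const_cochain_def by blast+
      show "bilin_scal (\<beta> g)"
        using bil unfolding bilin_scal_def \<beta>_def kappaC_penta_eq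
        by (simp add: penta_form_linear algebra_simps)
      show "\<beta> g v v = 0" for v by (simp add: \<beta>_def alt kappaC_penta_eq penta_form_linear)
      show "cyc_sum (\<lambda>u v w. \<beta> g v w *s (perm_act g u - u)) v1 v2 v3 = 0" for v1 v2 v3
      proof -
        let ?S = "\<lambda>f. cyc_sum (\<lambda>u v w. f v w *s (perm_act g u - u)) v1 v2 v3"
        have "cyc_sum (\<lambda>u v w. \<Sum>(x, y)\<in>fact_pairs g. kL x (u + perm_act y u) (kL y v w)) v1 v2 v3 =
            2 *s ?S (kC g)"
          by (rule doa_conds[THEN conjunct2, THEN conjunct2, THEN conjunct2, THEN conjunct2, THEN conjunct1, rule_format, OF g])
        moreover have "(\<Sum>(x, y)\<in>fact_pairs g. kL x (u + perm_act y u) (kL y v w)) =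
            (\<Sum>(x, y)\<in>fact_pairs g. kappaL_tri a b x (u + perm_act y u) (kappaL_tri a b y v w))" for u v w
          by (rule sum.cong) (auto simp: fact_pairs_def kL_eq)
        ultimately have "2 *s ?S (kC g) = 2 *s ?S (kappaC_penta a b g)"
          by (simp only: tri_bracket)
        then have "?S (kC g) = ?S (kappaC_penta a b g)" by (simp add: vec_eq_iff)
        moreover have "?S (\<beta> g) = ?S (kC g) - ?S (kappaC_penta a b g)"
          by (simp add: \<beta>_def cyc_sum_def vec_eq_iff algebra_simps)
        ultimately show ?thesis by simp
      qed
      show "\<beta> g (perm_act g v) (perm_act g w) = \<beta> g v w" for v w
        using conj[OF g g, of v w] by (simp only: conj_self[OF g])
      show "\<beta> g (perm_act (cyc [q, g q]) v) (perm_act (cyc [q, g q]) w) = \<beta> g v w"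
        if "g (g q) = q" "g q \<noteq> q" for q v w
        using conj[OF g swap_commutes(1)[OF g that], of v w] by (simp only: swap_commutes(2)[OF g that])
    qed
  qed
  obtain x y z :: 'n where d: "distinct [x, y, z]" by (rule ex_three_cycle)
  define g0 where "g0 = cyc [x, y, z]"
  have g0: "g0 permutes UNIV" "is_kcycle 3 g0"
    using d cyc_permutes[OF d] by (auto simp: g0_def is_kcycle_iff intro!: exI[of _ "[x, y, z]"])
  obtain c where base: "\<And>v w. \<beta> g0 v w = kappaC_tri c g0 v w"
    using form[OF g0(1)] g0(2) by (auto simp: kappaC_tri_eq)
  have "\<beta> g v w = kappaC_tri c g v w" if g: "g permutes UNIV" for g v w
  proof (cases "is_kcycle 3 g")
    case True
    obtain h where h: "h permutes UNIV" "g = h \<circ> g0 \<circ> inv h" using three_cycles_conj[OF g0(2) True] .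
    show ?thesis
      using conj[OF g0(1) h(1), of "perm_act (inv h) v" "perm_act (inv h) w"]
        kappa_conj(2)[OF h(1), of c g0 "perm_act (inv h) v" "perm_act (inv h) w"]
      by (simp add: h(2)[symmetric] base perm_act_inverse[OF h(1)])
  next
    case False
    then show ?thesis using form[OF g] by (auto simp: kappaC_tri_eq)
  qed
  then show ?thesis using that[of c] by (simp add: \<beta>_def diff_eq_eq add.commute)
qed

end

text \<open>Support off the identity means that both parts vanish at \<open>id\<close>, as their sum
  lies in the direct sum of V and the scalars. Cochains are compared at permutations only, since
  other functions are not group elements.\<close>

theorem theorem6p2:
  fixes kL :: "('n::finite \<Rightarrow> 'n) \<Rightarrow> complex^'n \<Rightarrow> complex^'n \<Rightarrow> complex^'n"
    and kC :: "('n \<Rightarrow> 'n) \<Rightarrow> complex^'n \<Rightarrow> complex^'n \<Rightarrow> complex"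
  assumes "CARD('n) \<ge> 3"
    and "linear_cochain kL" and "const_cochain kC"
    and "\<forall>v w. kL id v w = 0" and "\<forall>v w. kC id v w = 0"
  shows "DOA_map kL kC \<longleftrightarrow>
    (\<exists>a b c. \<forall>g. g permutes (UNIV::'n set) \<longrightarrow>
       (\<forall>v w. kL g v w = kappaL_tri a b g v w \<and>
              kC g v w = kappaC_penta a b g v w + kappaC_tri c g v w))"
proof
  assume doa: "DOA_map kL kC"
  note hyps = assms(1-3) assms(4,5)[rule_format] doa
  obtain a b where kL: "\<And>g v w. g permutes UNIV \<Longrightarrow> kL g v w = kappaL_tri a b g v w"
    using kL_eq[OF hyps] by blast
  obtain c where "\<And>g v w. g permutes UNIV \<Longrightarrow> kC g v w = kappaC_penta a b g v w + kappaC_tri c g v w"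
    using kC_eq[OF hyps kL] by blast
  with kL show "\<exists>a b c. \<forall>g. g permutes (UNIV::'n set) \<longrightarrow>
       (\<forall>v w. kL g v w = kappaL_tri a b g v w \<and>
              kC g v w = kappaC_penta a b g v w + kappaC_tri c g v w)"
    by blast
next
  assume "\<exists>a b c. \<forall>g. g permutes (UNIV::'n set) \<longrightarrow>
       (\<forall>v w. kL g v w = kappaL_tri a b g v w \<and>
              kC g v w = kappaC_penta a b g v w + kappaC_tri c g v w)"
  then show "DOA_map kL kC" using DOA_map_kappa by blast
qed

end
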